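(* Let $k\ge1$ be an integer. (1) Let $n=k(k+1)$ and $\lambda=(k^{k+1})\in P(n)$. Assume either Saxl's conjecture or the generalised Saxl conjecture for type C. Then $\sigma_\lambda\otimes\sigma_\lambda\otimes\left(\bigoplus_{0\le j\le n/2}\sigma_{(n-j,j)}\right)$ contains all irreducible representations of $S_n$. (2) Let $n=k^2$ and $\lambda=(k^k)\in P(n)$. Assume either Saxl's conjecture or the generalised Saxl conjecture for type D. Then $\sigma_\lambda\otimes\sigma_\lambda\otimes\left(\bigoplus_{0\le j\le n/2}\sigma_{(n-j,j)}\right)$ contains all irreducible representations of $S_n$.
   Context: $P(n)$ is the set of partitions of $n$; $\sigma_\lambda$ is the complex irreducible representation of $S_n$ indexed by $\lambda\in P(n)$ ($\sigma_{(n)}$ trivial); $(k^m)$ is the partition with $m$ parts equal to $k$. Saxl's conjecture: for every $m\ge1$, with $\rho=(m,m-1,\dots,1)$, the representation $\sigma_\rho\otimes\sigma_\rho$ of $S_{m(m+1)/2}$ contains every irreducible representation of $S_{m(m+1)/2}$. Weyl group representations: $W(C_n)=(\mathbb Z/2\mathbb Z)^n\rtimes S_n$; for a bipartition $(\alpha,\beta)$ of $n$ with $|\alpha|=a,|\beta|=b$, $\sigma_{(\alpha,\beta)}$ is induced from $(\mathbb Z/2\mathbb Z)^n\rtimes(S_a\times S_b)$ of $\sigma_\alpha\boxtimes\sigma_\beta$ twisted by the character of $(\mathbb Z/2\mathbb Z)^n$ that is trivial on the first $a$ factors and sign on the last $b$. $W(D_n)\le W(C_n)$ is the index 2 subgroup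 of elements with an even number of sign changes; for $\alpha\ne\beta$, $\sigma_{(\alpha,\beta)}$ and $\sigma_{(\beta,\alpha)}$ restrict to the same irreducible representation of $W(D_n)$, also denoted $\sigma_{(\alpha,\beta)}$. Generalised Saxl conjecture for type C (resp. D): for every simple $\mathfrak g$ of type C (resp. D) whose unique minimal solvable nilpotent orbit is fixed by the Spaltenstein map, if $F\subseteq\mathrm{Irr}(W)$ is the Lusztig family attached to that orbit, then $(\bigoplus_{\sigma\in F}\sigma)^{\otimes2}$ contains all irreducible characters of the Weyl group $W$. Explicitly, these cases and families are: Type C: $\mathfrak g=\mathfrak{sp}(2n)$ with $n=k(k+1)$, orbit $(2k,2k,\dots,2,2)$; $F$ consists of the $\sigma_{(\alpha,\beta)}$ with $\alpha=(\alpha_0\le\dots\le\alpha_k)$, $\beta=(\beta_0\le\dots\le\beta_{k-1})$ (zero parts allowed), $|\alpha|+|\beta|=n$, such that the numbers $\alpha_i+i$ $(0\le i\le k)$, $\beta_j+j$ $(0\le j\le k-1)$ are exactly $0,1,\dots,2k$. Type D: $\mathfrak g=\mathfrak{so}(2n)$ with $n=k^2$, orbit $(2k-1,2k-1,\dots,1,1)$; $F$ consists of the $\sigma_{(\alpha,\beta)}$ with $\alpha=(\alpha_0\le\dots\le\alpha_{k-1})$, $\beta=(\beta_0\le\dots\le\beta_{k-1})$ (zero parts allowed), $|\alpha|+|\beta|=n$, such that the numbers $\alpha_i+i$, $\beta_j+j$ $(0\le i,j\le k-1)$ are exactly $0,1,\dots,2k-1$. *)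

theory Defs
  imports "HOL-Algebra.Sym_Groups" "Jordan_Normal_Form.Matrix"
begin

section \<open>Complex matrix representations\<close>

text \<open>A representation of \<open>G\<close> is a homomorphism from \<open>G\<close> to some \<open>GL\<^sub>d(\<complex>)\<close>, given as a function whose
  values outside the carrier of \<open>G\<close> are irrelevant. Restriction to a subgroup is therefore the same
  function, regarded on a smaller carrier.\<close>

definition rep_dim :: "('g, 'm) monoid_scheme \<Rightarrow> ('g \<Rightarrow> complex mat) \<Rightarrow> nat" where
  "rep_dim G \<rho> = dim_row (\<rho> \<one>\<^bsub>G\<^esub>)"

definition is_rep :: "('g, 'm) monoid_scheme \<Rightarrow> ('g \<Rightarrow> complex mat) \<Rightarrow> bool" where
  "is_rep G \<rho> \<longleftrightarrow>
     (\<forall>g\<in>carrier G. \<rho> g \<in> carrier_mat (rep_dim G \<rho>) (rep_dim G \<rho>)) \<and>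
     \<rho> \<one>\<^bsub>G\<^esub> = 1\<^sub>m (rep_dim G \<rho>) \<and>
     (\<forall>g\<in>carrier G. \<forall>h\<in>carrier G. \<rho> (g \<otimes>\<^bsub>G\<^esub> h) = \<rho> g * \<rho> h)"

definition invariant_subspace ::
    "('g, 'm) monoid_scheme \<Rightarrow> ('g \<Rightarrow> complex mat) \<Rightarrow> complex vec set \<Rightarrow> bool" where
  "invariant_subspace G \<rho> U \<longleftrightarrow>
     U \<subseteq> carrier_vec (rep_dim G \<rho>) \<and>
     0\<^sub>v (rep_dim G \<rho>) \<in> U \<and>
     (\<forall>u\<in>U. \<forall>v\<in>U. u + v \<in> U) \<and>
     (\<forall>c. \<forall>u\<in>U. c \<cdot>\<^sub>v u \<in> U) \<and>
     (\<forall>g\<in>carrier G. \<forall>u\<in>U. \<rho> g *\<^sub>v u \<in> U)"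

definition irreducible_rep :: "('g, 'm) monoid_scheme \<Rightarrow> ('g \<Rightarrow> complex mat) \<Rightarrow> bool" where
  "irreducible_rep G \<rho> \<longleftrightarrow>
     is_rep G \<rho> \<and> rep_dim G \<rho> > 0 \<and>
     (\<forall>U. invariant_subspace G \<rho> U \<longrightarrow>
        U = {0\<^sub>v (rep_dim G \<rho>)} \<or> U = carrier_vec (rep_dim G \<rho>))"

text \<open>\<open>\<rho>\<close> contains \<open>\<tau>\<close> if there is an injective \<open>G\<close>-equivariant linear map from \<open>\<tau>\<close> to \<open>\<rho>\<close>.\<close>

definition contains_rep ::
    "('g, 'm) monoid_scheme \<Rightarrow> ('g \<Rightarrow> complex mat) \<Rightarrow> ('g \<Rightarrow> complex mat) \<Rightarrow> bool" where
  "contains_rep G \<rho> \<tau> \<longleftrightarrow>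
     (\<exists>T\<in>carrier_mat (rep_dim G \<rho>) (rep_dim G \<tau>).
        (\<forall>v\<in>carrier_vec (rep_dim G \<tau>).
           T *\<^sub>v v = 0\<^sub>v (rep_dim G \<rho>) \<longrightarrow> v = 0\<^sub>v (rep_dim G \<tau>)) \<and>
        (\<forall>g\<in>carrier G. \<rho> g * T = T * \<tau> g))"

definition contains_all_irreps :: "('g, 'm) monoid_scheme \<Rightarrow> ('g \<Rightarrow> complex mat) \<Rightarrow> bool" where
  "contains_all_irreps G \<rho> \<longleftrightarrow> (\<forall>\<tau>. irreducible_rep G \<tau> \<longrightarrow> contains_rep G \<rho> \<tau>)"

definition kronecker :: "complex mat \<Rightarrow> complex mat \<Rightarrow> complex mat" where
  "kronecker A B = mat (dim_row A * dim_row B) (dim_col A * dim_col B)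
     (\<lambda>(i, j). A $$ (i div dim_row B, j div dim_col B) * B $$ (i mod dim_row B, j mod dim_col B))"

definition tensor_rep ::
    "('g \<Rightarrow> complex mat) \<Rightarrow> ('g \<Rightarrow> complex mat) \<Rightarrow> 'g \<Rightarrow> complex mat" where
  "tensor_rep \<rho> \<tau> = (\<lambda>g. kronecker (\<rho> g) (\<tau> g))"

definition direct_sum_list :: "('g \<Rightarrow> complex mat) list \<Rightarrow> 'g \<Rightarrow> complex mat" where
  "direct_sum_list \<rho>s = (\<lambda>g. diag_block_mat (map (\<lambda>\<rho>. \<rho> g) \<rho>s))"

text \<open>Direct sum of a family over a finite index set; the summation order is chosen arbitrarily,
  as it does not affect the isomorphism class.\<close>

definition direct_sum :: "'i set \<Rightarrow> ('i \<Rightarrow> 'g \<Rightarrow> complex mat) \<Rightarrow> 'g \<Rightarrow> complex mat" where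
  "direct_sum I \<rho> = direct_sum_list (map \<rho> (SOME is. distinct is \<and> set is = I))"

definition left_transversal :: "('g, 'm) monoid_scheme \<Rightarrow> 'g set \<Rightarrow> 'g list" where
  "left_transversal G H = (SOME ts. distinct ts \<and> set ts \<subseteq> carrier G \<and>
     (\<forall>g\<in>carrier G. \<exists>!t. t \<in> set ts \<and> inv\<^bsub>G\<^esub> t \<otimes>\<^bsub>G\<^esub> g \<in> H))"

text \<open>The representation of a finite group \<open>G\<close> induced from a representation \<open>\<rho>\<close> of a subgroup \<open>H\<close>:
  for coset representatives \<open>t\<^sub>i\<close> of \<open>G/H\<close>, the \<open>(i, j)\<close> block at \<open>g\<close> is \<open>\<rho>(t\<^sub>i\<inverse> g t\<^sub>j)\<close> if
  \<open>t\<^sub>i\<inverse> g t\<^sub>j \<in> H\<close>, and zero otherwise.\<close>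

definition induced_rep ::
    "('g, 'm) monoid_scheme \<Rightarrow> 'g set \<Rightarrow> ('g \<Rightarrow> complex mat) \<Rightarrow> 'g \<Rightarrow> complex mat" where
  "induced_rep G H \<rho> = (\<lambda>g.
     let ts = left_transversal G H; d = rep_dim G \<rho> in
     mat (length ts * d) (length ts * d) (\<lambda>(i, j).
       let x = inv\<^bsub>G\<^esub> (ts ! (i div d)) \<otimes>\<^bsub>G\<^esub> g \<otimes>\<^bsub>G\<^esub> (ts ! (j div d)) in
       if x \<in> H then \<rho> x $$ (i mod d, j mod d) else 0))"

section \<open>Irreducible representations of the symmetric group\<close>

text \<open>Elements of the group algebra \<open>\<complex>[G]\<close> are functions vanishing outside the carrier.\<close>

definition group_algebra_mult ::
    "('g, 'm) monoid_scheme \<Rightarrow> ('g \<Rightarrow> complex) \<Rightarrow> ('g \<Rightarrow> complex) \<Rightarrow> 'g \<Rightarrow> complex" where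
  "group_algebra_mult G x y = (\<lambda>g. if g \<in> carrier G
     then \<Sum>h\<in>carrier G. x h * y (inv\<^bsub>G\<^esub> h \<otimes>\<^bsub>G\<^esub> g) else 0)"

definition left_translate ::
    "('g, 'm) monoid_scheme \<Rightarrow> 'g \<Rightarrow> ('g \<Rightarrow> complex) \<Rightarrow> 'g \<Rightarrow> complex" where
  "left_translate G g x = (\<lambda>h. if h \<in> carrier G then x (inv\<^bsub>G\<^esub> g \<otimes>\<^bsub>G\<^esub> h) else 0)"

text \<open>\<open>\<rho>\<close> is the matrix form, in some basis \<open>b 0, b 1, \<dots>\<close>, of the action of \<open>G\<close> by left translation on
  the left ideal \<open>V\<close> of \<open>\<complex>[G]\<close>.\<close>

definition matrix_form_of_ideal ::
    "('g, 'm) monoid_scheme \<Rightarrow> ('g \<Rightarrow> complex) set \<Rightarrow> ('g \<Rightarrow> complex mat) \<Rightarrow> bool" where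
  "matrix_form_of_ideal G V \<rho> \<longleftrightarrow> is_rep G \<rho> \<and>
     (\<exists>b :: nat \<Rightarrow> 'g \<Rightarrow> complex.
        (\<forall>j<rep_dim G \<rho>. b j \<in> V) \<and>
        (\<forall>v\<in>V. \<exists>!c. c \<in> carrier_vec (rep_dim G \<rho>) \<and> v = (\<lambda>h. \<Sum>i<rep_dim G \<rho>. c $ i * b i h)) \<and>
        (\<forall>g\<in>carrier G. \<forall>j<rep_dim G \<rho>.
           left_translate G g (b j) = (\<lambda>h. \<Sum>i<rep_dim G \<rho>. \<rho> g $$ (i, j) * b i h)))"

text \<open>A partition is the list of its (positive) parts in weakly decreasing order. The following
  turns a weakly increasing list, zeros allowed, into the partition it denotes.\<close>

definition partition_of :: "nat list \<Rightarrow> nat list" where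
  "partition_of xs = rev (filter (\<lambda>x. 0 < x) xs)"

text \<open>The Young tableau of shape \<open>\<lambda>\<close> whose rows, read from top to bottom, contain \<open>1, 2, \<dots>, |\<lambda>|\<close> in
  order; rows and columns are numbered from zero.\<close>

definition tableau_row :: "nat list \<Rightarrow> nat \<Rightarrow> nat set" where
  "tableau_row lam r = {sum_list (take r lam) + c + 1 |c. c < lam ! r}"

definition tableau_col :: "nat list \<Rightarrow> nat \<Rightarrow> nat set" where
  "tableau_col lam c = {sum_list (take r lam) + c + 1 |r. r < length lam \<and> c < lam ! r}"

definition row_group :: "nat list \<Rightarrow> (nat \<Rightarrow> nat) set" where
  "row_group lam = {p. p permutes {1..sum_list lam} \<and>
     (\<forall>r<length lam. p ` tableau_row lam r = tableau_row lam r)}"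

definition col_group :: "nat list \<Rightarrow> (nat \<Rightarrow> nat) set" where
  "col_group lam = {p. p permutes {1..sum_list lam} \<and>
     (\<forall>c. p ` tableau_col lam c = tableau_col lam c)}"

definition young_symmetrizer :: "nat list \<Rightarrow> (nat \<Rightarrow> nat) \<Rightarrow> complex" where
  "young_symmetrizer lam = (\<lambda>g.
     \<Sum>(p, q)\<in>row_group lam \<times> col_group lam. if p \<circ> q = g then of_int (sign q) else 0)"

text \<open>The left ideal \<open>\<complex>[S\<^sub>n] c\<^sub>\<lambda>\<close> generated by the Young symmetrizer.\<close>

definition specht_module :: "nat list \<Rightarrow> ((nat \<Rightarrow> nat) \<Rightarrow> complex) set" where
  "specht_module lam =
     range (\<lambda>x. group_algebra_mult (sym_group (sum_list lam)) x (young_symmetrizer lam))"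

text \<open>\<open>\<sigma>\<^sub>\<lambda>\<close>, in an arbitrarily chosen basis.\<close>

definition sigma :: "nat list \<Rightarrow> (nat \<Rightarrow> nat) \<Rightarrow> complex mat" where
  "sigma lam = (SOME \<rho>. matrix_form_of_ideal (sym_group (sum_list lam)) (specht_module lam) \<rho>)"

section \<open>Weyl groups of types C and D\<close>

text \<open>\<open>(\<int>/2\<int>)\<^sup>n\<close> is the group of subsets of \<open>{1..n}\<close> (the set of signs changed) under symmetric
  difference, with \<open>S\<^sub>n\<close> acting by taking images.\<close>

definition weyl_C :: "nat \<Rightarrow> (nat set \<times> (nat \<Rightarrow> nat)) monoid" where
  "weyl_C n = \<lparr> carrier = {(A, p). A \<subseteq> {1..n} \<and> p permutes {1..n}},
     mult = (\<lambda>(A, p) (B, q). (sym_diff A (p ` B), p \<circ> q)), one = ({}, id) \<rparr>"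

definition weyl_D :: "nat \<Rightarrow> (nat set \<times> (nat \<Rightarrow> nat)) monoid" where
  "weyl_D n = (weyl_C n) \<lparr> carrier := {(A, p) \<in> carrier (weyl_C n). even (card A)} \<rparr>"

text \<open>The subgroup \<open>(\<int>/2\<int>)\<^sup>n \<rtimes> (S\<^sub>a \<times> S\<^sub>b)\<close> with \<open>n = a + b\<close>.\<close>

definition young_subgroup_C :: "nat \<Rightarrow> nat \<Rightarrow> (nat set \<times> (nat \<Rightarrow> nat)) set" where
  "young_subgroup_C a b = {(A, p) \<in> carrier (weyl_C (a + b)). p ` {1..a} = {1..a}}"

text \<open>The representation \<open>\<sigma>\<^sub>\<alpha> \<boxtimes> \<sigma>\<^sub>\<beta>\<close> of that subgroup, twisted by the character of \<open>(\<int>/2\<int>)\<^sup>n\<close> that is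
  trivial on the first \<open>a\<close> and sign on the last \<open>b\<close> factors. The two components of \<open>p\<close> are its
  restriction to \<open>{1..a}\<close> and its restriction to \<open>{a+1..a+b}\<close> shifted down to \<open>{1..b}\<close>.\<close>

definition twisted_outer_tensor ::
    "nat list \<Rightarrow> nat list \<Rightarrow> nat set \<times> (nat \<Rightarrow> nat) \<Rightarrow> complex mat" where
  "twisted_outer_tensor \<alpha> \<beta> = (\<lambda>(A, p).
     let a = sum_list \<alpha>; b = sum_list \<beta> in
     (-1) ^ card (A \<inter> {a + 1..a + b}) \<cdot>\<^sub>m
       kronecker (sigma \<alpha> (\<lambda>i. if i \<in> {1..a} then p i else i))
                 (sigma \<beta> (\<lambda>i. if i \<in> {1..b} then p (a + i) - a else i)))"

definition sigma_bip :: "nat list \<times> nat list \<Rightarrow> nat set \<times> (nat \<Rightarrow> nat) \<Rightarrow> complex mat" where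
  "sigma_bip = (\<lambda>(\<alpha>, \<beta>).
     induced_rep (weyl_C (sum_list \<alpha> + sum_list \<beta>))
       (young_subgroup_C (sum_list \<alpha>) (sum_list \<beta>)) (twisted_outer_tensor \<alpha> \<beta>))"

definition family_C :: "nat \<Rightarrow> (nat list \<times> nat list) set" where
  "family_C k = {(partition_of as, partition_of bs) |as bs.
     length as = k + 1 \<and> length bs = k \<and> sorted as \<and> sorted bs \<and>
     sum_list as + sum_list bs = k * (k + 1) \<and>
     {as ! i + i |i. i \<le> k} \<union> {bs ! j + j |j. j < k} = {0..2 * k}}"

text \<open>On \<open>W(D\<^sub>n)\<close> the representations labelled by \<open>(\<alpha>, \<beta>)\<close> and \<open>(\<beta>, \<alpha>)\<close> coincide, and the defining
  condition of the family is symmetric in \<open>\<alpha>\<close> and \<open>\<beta>\<close>. To list every member exactly once, we keep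
  from each unordered pair the ordering for which the number \<open>0\<close> occurs among the \<open>\<alpha>\<^sub>i + i\<close>,
  that is, \<open>\<alpha>\<^sub>0 = 0\<close>.\<close>

definition family_D :: "nat \<Rightarrow> (nat list \<times> nat list) set" where
  "family_D k = {(partition_of as, partition_of bs) |as bs.
     length as = k \<and> length bs = k \<and> sorted as \<and> sorted bs \<and>
     sum_list as + sum_list bs = k ^ 2 \<and>
     {as ! i + i |i. i < k} \<union> {bs ! j + j |j. j < k} = {0..<2 * k} \<and>
     0 \<in> {as ! i + i |i. i < k}}"

section \<open>The conjectures\<close>

definition saxl_conjecture :: bool where
  "saxl_conjecture \<longleftrightarrow> (\<forall>m\<ge>1.
     let \<rho> = sigma (rev [1..<m + 1]) in
     contains_all_irreps (sym_group (m * (m + 1) div 2)) (tensor_rep \<rho> \<rho>))"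

definition generalised_saxl_conjecture_C :: bool where
  "generalised_saxl_conjecture_C \<longleftrightarrow> (\<forall>k\<ge>1.
     let F = direct_sum (family_C k) sigma_bip in
     contains_all_irreps (weyl_C (k * (k + 1))) (tensor_rep F F))"

text \<open>\<open>k = 1\<close> is left out since \<open>so(2)\<close> is not simple.\<close>

definition generalised_saxl_conjecture_D :: bool where
  "generalised_saxl_conjecture_D \<longleftrightarrow> (\<forall>k\<ge>2.
     let F = direct_sum (family_D k) sigma_bip in
     contains_all_irreps (weyl_D (k ^ 2)) (tensor_rep F F))"

text \<open>\<open>\<sigma>\<^sub>\<lambda> \<otimes> \<sigma>\<^sub>\<lambda> \<otimes> (\<Oplus>\<^bsub>0\<le>j\<le>n/2\<^esub> \<sigma>\<^bsub>(n-j,j)\<^esub>)\<close>, where \<open>\<lambda>\<close> is a partition of \<open>n\<close>.\<close>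

definition square_times_two_rows :: "nat \<Rightarrow> nat list \<Rightarrow> (nat \<Rightarrow> nat) \<Rightarrow> complex mat" where
  "square_times_two_rows n lam =
     tensor_rep (tensor_rep (sigma lam) (sigma lam))
       (direct_sum_list (map (\<lambda>j. sigma (partition_of [j, n - j])) [0..<n div 2 + 1]))"

end

theory Submission
  imports Defs "HOL-Library.Function_Algebras"
begin

text \<open>Fix a finite group and let the coefficient space of a representation be the span of its matrix
coefficients, regarded as functions on the group. A representation contains every irreducible one
iff its coefficient space consists of all functions, and for the direction from the space to the
representation it is enough that the indicator \<open>\<delta>\<close> of the identity is in the space
(\<open>coeffs_if_contains_all_irreps\<close>, \<open>contains_all_irreps_if_delta\<close>). Tensor products become spans of
pointwise products and direct sums become sums of spaces. So, for \<open>\<lambda>\<close> the rectangle, the task is to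
write \<open>\<delta>\<close> as a combination of products \<open>f * f' * h\<close> with \<open>f\<close>, \<open>f'\<close> coefficients of \<open>\<sigma>\<^sub>\<lambda>\<close> and \<open>h\<close> a
coefficient of a two-row representation.

The coefficient space of \<open>\<sigma>\<^sub>\<lambda>\<close> is spanned by the two-sided translates of the Young symmetrizer
(\<open>coeffs_sigma\<close>), which leads to two facts about \<open>S\<^sub>n\<close>.

\<^item> Let a diagram \<open>\<alpha>\<close> be cut off from the rectangle, leaving \<open>\<gamma>\<close>, and number the cells so that
\<open>1, \<dots>, a\<close> are those of \<open>\<alpha>\<close>. If \<open>p\<close> preserves rows, \<open>q\<close> preserves columns and \<open>p \<circ> q\<close> preserves
\<open>{1..a}\<close>, then \<open>q\<close> moves \<open>\<alpha>\<close> to a set of cells with the row and column sums of \<open>\<alpha>\<close>, and \<open>\<alpha>\<close> is the only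
such set. Hence on \<open>H = S\<^sub>a \<times> S\<^sub>b\<close> the symmetrizer of the rectangle is the product of those of \<open>\<alpha>\<close> and
\<open>\<gamma>\<close>, and products of coefficients of \<open>\<sigma>\<^sub>\<alpha>\<close> and \<open>\<sigma>\<^sub>\<gamma>\<close> are restrictions of coefficients of \<open>\<sigma>\<^sub>\<lambda>\<close>
(\<open>rectangle_restriction\<close>).

\<^item> For sets \<open>B\<^sub>0\<close>, \<open>B\<^sub>1\<close> of the same size, the indicator of \<open>{p. p(B\<^sub>0) = B\<^sub>1}\<close> is a coefficient of the sum
of the two-row representations (\<open>set_transport_indicator\<close>).

Under Saxl's conjecture, cut the rectangle into two staircases. On each factor of \<open>H\<close> the function \<open>\<delta>\<close>
is a combination of products of two coefficients, so there is a combination \<open>F\<close> of products of two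
coefficients of \<open>\<sigma>\<^sub>\<lambda>\<close> that agrees with \<open>\<delta>\<close> on \<open>H\<close>. Then \<open>\<delta> = F * 1\<^sub>H\<close>.

In type C the family consists of the pairs \<open>(\<alpha>, \<beta>)\<close> with \<open>\<beta>\<close> the transpose of the complement \<open>\<gamma>\<close>.
Transposing multiplies coefficients by the sign, so every matrix coefficient of a member of the family
has the form \<open>(A, p) \<mapsto> \<plusminus>(-1)\<^bsup>|A \<inter> B\<^sub>1|\<^esup> [p(B\<^sub>0) = B\<^sub>1] \<epsilon>(p) f(p)\<close>, where \<open>\<epsilon>(p)\<close> is the sign of \<open>p\<close> from \<open>B\<^sub>0\<close>
to \<open>B\<^sub>1\<close> and \<open>f\<close> is a coefficient of \<open>\<sigma>\<^sub>\<lambda>\<close>. Sum a product of two such functions over all \<open>A\<close>. Unless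
the sets \<open>B\<^sub>1\<close> agree, the result is \<open>0\<close>; if they agree, the two signs cancel up to a constant and a
multiple of \<open>f f' [p(B\<^sub>0) = B\<^sub>1]\<close> remains. The same sum turns \<open>\<delta>\<close> on the Weyl group into \<open>\<delta>\<close> on \<open>S\<^sub>n\<close>.
In type D only the sets \<open>A\<close> of even size are available, and a pair of complementary sets survives as
well. It brings in the factor \<open>sign(p)\<close>, which is harmless because the square is its own transpose.\<close>

section \<open>Linear algebra of functions on a finite set\<close>

interpretation cfun: vector_space "\<lambda>(c::complex) (f :: 'a \<Rightarrow> complex) x. c * f x"
  by unfold_locales (auto simp: fun_eq_iff algebra_simps)

lemma sum_fun_apply: "(\<Sum>i\<in>I. f i) x = (\<Sum>i\<in>I. f i x :: complex)"
  by (induction I rule: infinite_finite_induct) auto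

lemma sum_fun_lambda: "(\<lambda>x. \<Sum>i\<in>I. f i x :: complex) = (\<Sum>i\<in>I. f i)"
  by (simp add: fun_eq_iff sum_fun_apply)

lemma subspace_sum_scaled:
  assumes "cfun.subspace V" "\<And>i. i \<in> I \<Longrightarrow> f i \<in> V"
  shows "(\<lambda>x. \<Sum>i\<in>I. c i * f i x) \<in> V"
proof -
  have "(\<lambda>x. \<Sum>i\<in>I. c i * f i x) = (\<Sum>i\<in>I. (\<lambda>x. c i * f i x))"
    by (rule sum_fun_lambda)
  also have "\<dots> \<in> V"
    using assms by (intro cfun.subspace_sum cfun.subspace_scale)
  finally show ?thesis .
qed

definition inner_on :: "'a set \<Rightarrow> ('a \<Rightarrow> complex) \<Rightarrow> ('a \<Rightarrow> complex) \<Rightarrow> complex" where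
  "inner_on S f g = (\<Sum>x\<in>S. f x * cnj (g x))"

definition supported_on :: "'a set \<Rightarrow> ('a \<Rightarrow> complex) set" where
  "supported_on S = {f. \<forall>x. x \<notin> S \<longrightarrow> f x = 0}"

lemma inner_on_linear:
  "inner_on S 0 g = 0"
  "inner_on S (f + f') g = inner_on S f g + inner_on S f' g"
  "inner_on S (f - f') g = inner_on S f g - inner_on S f' g"
  "inner_on S (\<lambda>x. c * f x) g = c * inner_on S f g"
  "inner_on S g 0 = 0"
  "inner_on S g (f + f') = inner_on S g f + inner_on S g f'"
  "inner_on S g (f - f') = inner_on S g f - inner_on S g f'"
  "inner_on S g (\<lambda>x. c * f x) = cnj c * inner_on S g f"
  by (simp_all add: inner_on_def sum.distrib sum_subtractf sum_distrib_left algebra_simps)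

lemma inner_on_self_eq_0:
  assumes "finite S"
  shows "inner_on S f f = 0 \<longleftrightarrow> (\<forall>x\<in>S. f x = 0)"
proof -
  have "inner_on S f f = of_real (\<Sum>x\<in>S. (cmod (f x))\<^sup>2)"
    by (simp add: inner_on_def complex_mult_cnj cmod_power2)
  then show ?thesis
    using assms by (auto simp: sum_nonneg_eq_0_iff simp del: of_real_sum)
qed

lemma supported_on_subspace: "cfun.subspace (supported_on S)"
  by (auto simp: cfun.subspace_def supported_on_def)

lemma orthogonal_to_span:
  assumes "\<And>t. t \<in> T \<Longrightarrow> inner_on S m t = 0" "v \<in> cfun.span T"
  shows "inner_on S m v = 0"
  using assms(2)
proof (rule cfun.span_induct)
  show "cfun.subspace {v. inner_on S m v = 0}"
    by (auto simp: cfun.subspace_def inner_on_linear)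
qed (use assms(1) in auto)

lemma orthogonal_projection:
  assumes "finite S" "finite T"
  shows "\<exists>y\<in>cfun.span T. \<forall>t\<in>cfun.span T. inner_on S (x - y) t = 0"
  using assms(2)
proof (induction T arbitrary: x rule: finite_induct)
  case empty
  then show ?case by (auto simp: inner_on_def)
next
  case (insert t T)
  obtain t0 where t0: "t0 \<in> cfun.span T" "\<And>v. v \<in> cfun.span T \<Longrightarrow> inner_on S (t - t0) v = 0"
    using insert.IH[of t] by blast
  obtain y where y: "y \<in> cfun.span T" "\<And>v. v \<in> cfun.span T \<Longrightarrow> inner_on S (x - y) v = 0"
    using insert.IH[of x] by blast
  define t' where "t' = t - t0"
  define c where "c = (if inner_on S t' t' = 0 then 0 else inner_on S (x - y) t' / inner_on S t' t')"
  define y' where "y' = y + (\<lambda>a. c * t' a)"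
  have sub: "cfun.span T \<subseteq> cfun.span (insert t T)"
    by (intro cfun.span_mono) auto
  have t'_in: "t' \<in> cfun.span (insert t T)"
    unfolding t'_def using t0(1) sub by (intro cfun.span_diff) (auto intro: cfun.span_base)
  have "y' \<in> cfun.span (insert t T)"
    unfolding y'_def using y sub t'_in by (intro cfun.span_add cfun.span_scale) auto
  moreover have "inner_on S (x - y') v = 0" if "v \<in> cfun.span (insert t T)" for v
  proof -
    have eq: "x - y' = (x - y) - (\<lambda>a. c * t' a)" by (simp add: y'_def)
    have orth: "inner_on S (x - y') w = 0" if "w \<in> cfun.span T" for w
      unfolding eq inner_on_linear using y(2)[OF that] t0(2)[OF that]
      by (simp add: inner_on_linear(3) t'_def[symmetric])
    have "inner_on S (x - y') t' = 0"
    proof (cases "inner_on S t' t' = 0")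
      case True
      then have "\<forall>a\<in>S. t' a = 0" using inner_on_self_eq_0[OF assms(1)] by blast
      then show ?thesis by (simp add: inner_on_def)
    next
      case False
      then show ?thesis unfolding eq inner_on_linear by (simp add: inner_on_linear c_def)
    qed
    moreover have "inner_on S (x - y') t0 = 0" using orth t0 by blast
    ultimately have "inner_on S (x - y') t = 0"
      by (simp add: t'_def inner_on_linear)
    then show ?thesis
      using orth cfun.span_base by (intro orthogonal_to_span[OF _ that]) auto
  qed
  ultimately show ?case by blast
qed

lemma subspace_finite_basis:
  assumes "finite S" "cfun.subspace V" "V \<subseteq> supported_on S"
  shows "\<exists>B. finite B \<and> B \<subseteq> V \<and> cfun.independent B \<and> cfun.span B = V"
proof -
  define D :: "('a \<Rightarrow> complex) set" where "D = (\<lambda>s x. if x = s then 1 else 0) ` S"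
  have "f \<in> cfun.span D" if "f \<in> supported_on S" for f
  proof -
    have "f = (\<lambda>x. \<Sum>s\<in>S. f s * (if x = s then 1 else 0))"
      using that assms(1) by (auto simp: fun_eq_iff supported_on_def if_distrib cong: if_cong)
    also have "\<dots> \<in> cfun.span D"
      by (intro subspace_sum_scaled cfun.subspace_span cfun.span_base) (auto simp: D_def)
    finally show ?thesis .
  qed
  then have VD: "V \<subseteq> cfun.span D" using assms(3) by blast
  obtain B where B: "B \<subseteq> V" "cfun.independent B" "V \<subseteq> cfun.span B"
    using cfun.maximal_independent_subset by blast
  have "finite B"
    using cfun.independent_span_bound[of D B] B VD assms(1) by (auto simp: D_def)
  moreover have "cfun.span B = V"
    using B assms(2) cfun.span_minimal by blast
  ultimately show ?thesis using B by blast
qed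

text \<open>A finite-dimensional space equals its double orthogonal complement; in this form it proves
membership in a coefficient space by testing against everything orthogonal to it.\<close>

lemma in_subspace_if_ortho:
  assumes "finite S" "cfun.subspace V" "V \<subseteq> supported_on S" "x \<in> supported_on S"
    and ortho: "\<And>m. m \<in> supported_on S \<Longrightarrow> (\<And>v. v \<in> V \<Longrightarrow> inner_on S m v = 0) \<Longrightarrow> inner_on S x m = 0"
  shows "x \<in> V"
proof -
  obtain B where B: "finite B" "cfun.span B = V"
    using subspace_finite_basis[OF assms(1-3)] by blast
  obtain y where y: "y \<in> V" "\<And>v. v \<in> V \<Longrightarrow> inner_on S (x - y) v = 0"
    using orthogonal_projection[OF assms(1) B(1), of x] B(2) by auto
  have supp: "x - y \<in> supported_on S"
    using y(1) assms(3,4) cfun.subspace_diff[OF supported_on_subspace] by blast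
  then have "inner_on S x (x - y) = 0" using ortho y by blast
  moreover have "inner_on S y (x - y) = cnj (inner_on S (x - y) y)"
    by (simp add: inner_on_def mult.commute)
  then have "inner_on S y (x - y) = 0" using y by simp
  ultimately have "inner_on S (x - y) (x - y) = 0" by (simp add: inner_on_linear)
  then have "\<forall>a\<in>S. (x - y) a = 0"
    using inner_on_self_eq_0[OF assms(1)] by blast
  then have "x = y" using supp by (auto simp: supported_on_def fun_eq_iff)
  then show ?thesis using y by simp
qed

lemma span_family:
  assumes "finite I" "y \<in> cfun.span (b ` I)"
  shows "\<exists>c. y = (\<lambda>x. \<Sum>j\<in>I. c j * b j x)"
  using assms(2)
proof (rule cfun.span_induct)
  show "cfun.subspace {y. \<exists>c. y = (\<lambda>x. \<Sum>j\<in>I. c j * b j x)}"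
  proof (rule cfun.subspaceI)
    show "0 \<in> {y. \<exists>c. y = (\<lambda>x. \<Sum>j\<in>I. c j * b j x)}"
      by (auto intro!: exI[of _ "\<lambda>_. 0"])
  next
    fix u v
    assume "u \<in> {y. \<exists>c. y = (\<lambda>x. \<Sum>j\<in>I. c j * b j x)}"
      and "v \<in> {y. \<exists>c. y = (\<lambda>x. \<Sum>j\<in>I. c j * b j x)}"
    then obtain c d where "u = (\<lambda>x. \<Sum>j\<in>I. c j * b j x)" "v = (\<lambda>x. \<Sum>j\<in>I. d j * b j x)"
      by auto
    then have "u + v = (\<lambda>x. \<Sum>j\<in>I. (c j + d j) * b j x)"
      by (simp add: fun_eq_iff sum.distrib algebra_simps)
    then show "u + v \<in> {y. \<exists>c. y = (\<lambda>x. \<Sum>j\<in>I. c j * b j x)}"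
      by (auto intro!: exI[of _ "\<lambda>j. c j + d j"])
  next
    fix k v
    assume "v \<in> {y. \<exists>c. y = (\<lambda>x. \<Sum>j\<in>I. c j * b j x)}"
    then obtain d where "v = (\<lambda>x. \<Sum>j\<in>I. d j * b j x)"
      by auto
    then show "(\<lambda>x. k * v x) \<in> {y. \<exists>c. y = (\<lambda>x. \<Sum>j\<in>I. c j * b j x)}"
      by (auto intro!: exI[of _ "\<lambda>j. k * d j"] simp: sum_distrib_left mult.assoc)
  qed
next
  fix a assume "a \<in> b ` I"
  then obtain i where i: "i \<in> I" "a = b i" by auto
  then show "\<exists>c. a = (\<lambda>x. \<Sum>j\<in>I. c j * b j x)"
    using assms(1)
    by (auto intro!: exI[of _ "\<lambda>j. if j = i then 1 else 0"] simp: fun_eq_iff if_distrib if_distribR sum.delta cong: if_cong)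
qed

text \<open>Functions that are independent on \<open>S\<close> are separated by evaluations at points of \<open>S\<close>, so the
coordinates with respect to them are combinations of such evaluations. The dual functional is pairing
with the component of \<open>b i\<close> orthogonal to the other members.\<close>

lemma dual_family:
  fixes b :: "nat \<Rightarrow> 'a \<Rightarrow> complex"
  assumes "finite S" "i < d"
    and indep: "\<And>c. (\<forall>x\<in>S. (\<Sum>j<d. c j * b j x) = 0) \<Longrightarrow> \<forall>j<d. c j = 0"
  shows "\<exists>\<xi>. \<forall>j<(d::nat). (\<Sum>x\<in>S. \<xi> x * b j x) = (if j = i then 1 else 0)"
proof -
  let ?T = "b ` ({..<d} - {i})"
  obtain y where y: "y \<in> cfun.span ?T"
    "\<And>v. v \<in> cfun.span ?T \<Longrightarrow> inner_on S (b i - y) v = 0"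
    using orthogonal_projection[OF assms(1), of ?T "b i"] by blast
  obtain c where c: "y = (\<lambda>x. \<Sum>j\<in>{..<d} - {i}. c j * b j x)"
    using span_family[OF _ y(1)] by auto
  define z where "z = b i - y"
  \<comment> \<open>otherwise \<open>b i\<close> would be a combination of the others on \<open>S\<close>\<close>
  have zz: "inner_on S z z \<noteq> 0"
  proof
    assume "inner_on S z z = 0"
    then have z0: "\<forall>x\<in>S. z x = 0" using inner_on_self_eq_0[OF assms(1)] by blast
    have "z x = (\<Sum>j<d. (if j = i then 1 else - c j) * b j x)" for x
      using assms(2) by (simp add: z_def c sum.remove[of "{..<d}" i] sum_negf)
    then have "\<forall>j<d. (if j = i then 1 else - c j) = 0"
      using z0 by (intro indep) simp
    then show False using assms(2) by auto
  qed
  have conj: "inner_on S u v = cnj (inner_on S v u)" for u v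
    by (simp add: inner_on_def mult.commute)
  have zy: "inner_on S z y = 0" using y by (simp add: z_def)
  have "b i = z + y" by (simp add: z_def)
  then have bz: "inner_on S (b i) z = inner_on S z z"
    using conj[of y z] zy by (simp add: inner_on_linear)
  have oz: "inner_on S (b j) z = 0" if "j < d" "j \<noteq> i" for j
    using conj[of "b j" z] y(2)[of "b j"] that cfun.span_base[of "b j" ?T] by (simp add: z_def)
  have "(\<Sum>x\<in>S. (cnj (z x) / inner_on S z z) * b j x) = inner_on S (b j) z / inner_on S z z" for j
    by (simp add: inner_on_def sum_divide_distrib mult.commute)
  then show ?thesis using bz oz zz
    by (intro exI[of _ "\<lambda>x. cnj (z x) / inner_on S z z"]) auto
qed

text \<open>Linearity of \<open>L\<close> enters as two equations, since the operators it is used for are defined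
pointwise on all functions.\<close>

lemma span_linear_image:
  fixes L :: "('a \<Rightarrow> complex) \<Rightarrow> ('b \<Rightarrow> complex)"
  assumes "f \<in> cfun.span S" "cfun.subspace V" "\<And>s. s \<in> S \<Longrightarrow> L s \<in> V"
    and add: "\<And>f g. L (f + g) = L f + L g" and scale: "\<And>c f. L (\<lambda>x. c * f x) = (\<lambda>x. c * L f x)"
  shows "L f \<in> V"
  using assms(1)
proof (rule cfun.span_induct)
  have "L 0 = 0" using add[of 0 0] by simp
  then show "cfun.subspace {f. L f \<in> V}"
    using assms(2) by (auto simp: cfun.subspace_def add scale)
qed (use assms(3) in auto)

section \<open>Translation-invariant spaces of functions on a finite group\<close>

locale fin_group = group G for G (structure) +
  assumes fin: "finite (carrier G)"

definition translate :: "('g, 'm) monoid_scheme \<Rightarrow> 'g \<Rightarrow> 'g \<Rightarrow> ('g \<Rightarrow> complex) \<Rightarrow> 'g \<Rightarrow> complex" where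
  "translate G x y f = (\<lambda>g. if g \<in> carrier G then f (x \<otimes>\<^bsub>G\<^esub> g \<otimes>\<^bsub>G\<^esub> y) else 0)"

text \<open>Inversion of the argument intertwines left and right translation. It separates the coefficients of
the representation on a left ideal from the elements of that ideal.\<close>

definition flip :: "('g, 'm) monoid_scheme \<Rightarrow> ('g \<Rightarrow> complex) \<Rightarrow> 'g \<Rightarrow> complex" where
  "flip G f = (\<lambda>g. if g \<in> carrier G then f (inv\<^bsub>G\<^esub> g) else 0)"

definition two_sided_span :: "('g, 'm) monoid_scheme \<Rightarrow> ('g \<Rightarrow> complex) \<Rightarrow> ('g \<Rightarrow> complex) set" where
  "two_sided_span G f = cfun.span {translate G x y f |x y. x \<in> carrier G \<and> y \<in> carrier G}"

definition two_sided :: "('g, 'm) monoid_scheme \<Rightarrow> ('g \<Rightarrow> complex) set \<Rightarrow> bool" where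
  "two_sided G J \<longleftrightarrow> cfun.subspace J \<and> J \<subseteq> supported_on (carrier G) \<and>
     (\<forall>f\<in>J. \<forall>x\<in>carrier G. \<forall>y\<in>carrier G. translate G x y f \<in> J)"

text \<open>Entries are set to zero off the carrier, so that equality of spaces speaks about the group only.\<close>

definition coeffs :: "('g, 'm) monoid_scheme \<Rightarrow> ('g \<Rightarrow> complex mat) \<Rightarrow> ('g \<Rightarrow> complex) set" where
  "coeffs G \<rho> = cfun.span {\<lambda>g. if g \<in> carrier G then \<rho> g $$ (i, j) else 0 |i j.
     i < rep_dim G \<rho> \<and> j < rep_dim G \<rho>}"

lemma translate_linear:
  "translate G x y (f + f') = translate G x y f + translate G x y f'"
  "translate G x y (\<lambda>g. c * f g) = (\<lambda>g. c * translate G x y f g)"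
  by (auto simp: translate_def fun_eq_iff)

lemma translate_supported: "translate G x y f \<in> supported_on (carrier G)"
  by (simp add: translate_def supported_on_def)

lemma coeffs_supported: "coeffs G \<rho> \<subseteq> supported_on (carrier G)"
  unfolding coeffs_def
  by (rule cfun.span_minimal[OF _ supported_on_subspace]) (auto simp: supported_on_def)

lemma coeffs_subspace: "cfun.subspace (coeffs G \<rho>)"
  by (simp add: coeffs_def cfun.subspace_span)

lemma coeffs_entry:
  "i < rep_dim G \<rho> \<Longrightarrow> j < rep_dim G \<rho> \<Longrightarrow> (\<lambda>g. if g \<in> carrier G then \<rho> g $$ (i, j) else 0) \<in> coeffs G \<rho>"
  unfolding coeffs_def by (rule cfun.span_base) blast

context fin_group
begin

lemma translate_translate:
  assumes "x \<in> carrier G" "y \<in> carrier G" "u \<in> carrier G" "v \<in> carrier G"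
  shows "translate G x y (translate G u v f) = translate G (u \<otimes> x) (y \<otimes> v) f"
  using assms by (auto simp: translate_def fun_eq_iff m_assoc)

lemma two_sided_span_two_sided: "two_sided G (two_sided_span G f)"
  unfolding two_sided_def
proof (intro conjI ballI)
  show "cfun.subspace (two_sided_span G f)" by (simp add: two_sided_span_def cfun.subspace_span)
  show "two_sided_span G f \<subseteq> supported_on (carrier G)"
    unfolding two_sided_span_def
    by (rule cfun.span_minimal[OF _ supported_on_subspace]) (auto intro: translate_supported)
next
  fix h x y assume "h \<in> two_sided_span G f" and xy: "x \<in> carrier G" "y \<in> carrier G"
  have "translate G x y (translate G u v f) \<in> two_sided_span G f" if "u \<in> carrier G" "v \<in> carrier G" for u v
    unfolding translate_translate[OF xy that] two_sided_span_def
    using xy that by (intro cfun.span_base CollectI exI[of _ "u \<otimes> x"] exI[of _ "y \<otimes> v"]) auto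
  then show "translate G x y h \<in> two_sided_span G f"
    using \<open>h \<in> two_sided_span G f\<close> unfolding two_sided_span_def
    by (intro span_linear_image[where L = "translate G x y" and f = h, OF _ cfun.subspace_span _ translate_linear])
       auto
qed

lemma in_two_sided_span:
  assumes "f \<in> supported_on (carrier G)"
  shows "f \<in> two_sided_span G f"
proof -
  have "f = translate G \<one> \<one> f"
    using assms by (auto simp: fun_eq_iff translate_def supported_on_def)
  then have "f \<in> {translate G x y f |x y. x \<in> carrier G \<and> y \<in> carrier G}" by blast
  then show ?thesis unfolding two_sided_span_def by (rule cfun.span_base)
qed

lemma two_sided_span_minimal: "two_sided G J \<Longrightarrow> f \<in> J \<Longrightarrow> two_sided_span G f \<subseteq> J"
  unfolding two_sided_span_def by (rule cfun.span_minimal) (auto simp: two_sided_def)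

lemma two_sided_translate:
  "two_sided G J \<Longrightarrow> f \<in> J \<Longrightarrow> x \<in> carrier G \<Longrightarrow> y \<in> carrier G \<Longrightarrow> translate G x y f \<in> J"
  by (simp add: two_sided_def)

lemma flip_two_sided:
  assumes "two_sided G J"
  shows "two_sided G {f \<in> supported_on (carrier G). flip G f \<in> J}"
  unfolding two_sided_def
proof (intro conjI ballI)
  have lin: "flip G 0 = 0" "flip G (f + f') = flip G f + flip G f'"
    "flip G (\<lambda>g. c * f g) = (\<lambda>g. c * flip G f g)" for f f' c
    by (auto simp: flip_def fun_eq_iff)
  show "cfun.subspace {f \<in> supported_on (carrier G). flip G f \<in> J}"
    using assms supported_on_subspace[of "carrier G"]
    by (auto simp: two_sided_def cfun.subspace_def lin)
next
  fix f x y assume f: "f \<in> {f \<in> supported_on (carrier G). flip G f \<in> J}"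
    and xy: "x \<in> carrier G" "y \<in> carrier G"
  have "flip G (translate G x y f) = translate G (inv y) (inv x) (flip G f)"
    using xy by (auto simp: fun_eq_iff flip_def translate_def inv_mult_group m_assoc)
  then show "translate G x y f \<in> {f \<in> supported_on (carrier G). flip G f \<in> J}"
    using f xy assms by (auto simp: two_sided_def translate_supported)
qed auto

lemma sum_shift_right: "a \<in> carrier G \<Longrightarrow> (\<Sum>g\<in>carrier G. f (g \<otimes> a)) = (\<Sum>g\<in>carrier G. f g)"
  by (rule sum.reindex_bij_witness[where i = "\<lambda>g. g \<otimes> inv a" and j = "\<lambda>g. g \<otimes> a"])
     (auto simp: m_assoc)

lemma sum_shift_left: "a \<in> carrier G \<Longrightarrow> (\<Sum>g\<in>carrier G. f (a \<otimes> g)) = (\<Sum>g\<in>carrier G. f g)"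
  by (rule sum.reindex_bij_witness[where i = "\<lambda>g. inv a \<otimes> g" and j = "\<lambda>g. a \<otimes> g"])
     (auto simp: m_assoc[symmetric])

lemma inner_translate:
  assumes "x \<in> carrier G" "y \<in> carrier G"
  shows "inner_on (carrier G) (translate G x y f) h =
    inner_on (carrier G) f (translate G (inv x) (inv y) h)"
proof -
  have "inner_on (carrier G) (translate G x y f) h =
      (\<Sum>g\<in>carrier G. f (x \<otimes> g \<otimes> y) * cnj (h (inv x \<otimes> (x \<otimes> g \<otimes> y) \<otimes> inv y)))"
    unfolding inner_on_def
  proof (rule sum.cong[OF refl])
    fix g assume "g \<in> carrier G"
    then have "inv x \<otimes> (x \<otimes> g \<otimes> y) \<otimes> inv y = g"
      using assms by (simp add: m_assoc) (simp add: m_assoc[symmetric])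
    then show "translate G x y f g * cnj (h g) = f (x \<otimes> g \<otimes> y) * cnj (h (inv x \<otimes> (x \<otimes> g \<otimes> y) \<otimes> inv y))"
      using \<open>g \<in> carrier G\<close> by (simp add: translate_def)
  qed
  also have "\<dots> = (\<Sum>g\<in>carrier G. f (x \<otimes> g) * cnj (h (inv x \<otimes> (x \<otimes> g) \<otimes> inv y)))"
    using sum_shift_right[OF assms(2), of "\<lambda>g. f (x \<otimes> g) * cnj (h (inv x \<otimes> (x \<otimes> g) \<otimes> inv y))"] assms
    by (simp add: m_assoc cong: sum.cong)
  also have "\<dots> = (\<Sum>g\<in>carrier G. f g * cnj (h (inv x \<otimes> g \<otimes> inv y)))"
    by (rule sum_shift_left[OF assms(1), of "\<lambda>g. f g * cnj (h (inv x \<otimes> g \<otimes> inv y))"])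
  also have "\<dots> = inner_on (carrier G) f (translate G (inv x) (inv y) h)"
    by (simp add: inner_on_def translate_def)
  finally show ?thesis .
qed

lemma orthogonal_two_sided:
  assumes "two_sided G J"
  shows "two_sided G {m \<in> supported_on (carrier G). \<forall>v\<in>J. inner_on (carrier G) m v = 0}"
  unfolding two_sided_def
proof (intro conjI ballI)
  show "cfun.subspace {m \<in> supported_on (carrier G). \<forall>v\<in>J. inner_on (carrier G) m v = 0}"
    using supported_on_subspace[of "carrier G"]
    by (auto simp: cfun.subspace_def inner_on_linear)
next
  fix f x y assume "f \<in> {m \<in> supported_on (carrier G). \<forall>v\<in>J. inner_on (carrier G) m v = 0}"
    and "x \<in> carrier G" "y \<in> carrier G"
  then show "translate G x y f \<in> {m \<in> supported_on (carrier G). \<forall>v\<in>J. inner_on (carrier G) m v = 0}"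
    using assms by (auto simp: inner_translate translate_supported two_sided_def)
qed auto

text \<open>In the group algebra the hypothesis says that \<open>x x\<^sup>*\<close> lies in the two-sided ideal \<open>J\<close>, where
\<open>x\<^sup>*(g)\<close> is the conjugate of \<open>x(g\<inverse>)\<close>. Split \<open>x = y + z\<close> with \<open>y \<in> J\<close> and \<open>z\<close> orthogonal to \<open>J\<close>. Then
\<open>z x\<^sup>*\<close> is in \<open>J\<close> and orthogonal to \<open>J\<close>, hence zero, and its value at the identity is
\<open>\<langle>z, x\<rangle> = \<langle>z, z\<rangle>\<close>.\<close>

lemma in_two_sided_if_star_square:
  assumes J: "two_sided G J" and x: "x \<in> supported_on (carrier G)"
    and xx: "(\<lambda>g. if g \<in> carrier G then \<Sum>h\<in>carrier G. cnj (x h) * x (g \<otimes> h) else 0) \<in> J"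
  shows "x \<in> J"
proof (rule in_subspace_if_ortho[OF fin])
  \<comment> \<open>right multiplication by \<open>x\<^sup>*\<close>\<close>
  define R where "R f = (\<lambda>g. \<Sum>h\<in>carrier G. cnj (x h) * translate G \<one> h f g)" for f
  have R_in: "R f \<in> K" if "two_sided G K" "f \<in> K" for K f
    unfolding R_def using that
    by (intro subspace_sum_scaled) (auto simp: two_sided_def)
  have R_linear: "R (f - f') = R f - R f'" for f f'
  proof (rule ext)
    show "R (f - f') g = (R f - R f') g" for g
      by (cases "g \<in> carrier G") (simp_all add: R_def translate_def sum_subtractf right_diff_distrib)
  qed
  have R_1: "R f \<one> = inner_on (carrier G) f x" for f
    by (simp add: R_def translate_def inner_on_def mult.commute cong: sum.cong)
  have "R x = (\<lambda>g. if g \<in> carrier G then \<Sum>h\<in>carrier G. cnj (x h) * x (g \<otimes> h) else 0)"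
    by (auto simp: R_def translate_def fun_eq_iff cong: sum.cong)
  then have Rx: "R x \<in> J" using xx by simp
  fix m assume m: "m \<in> supported_on (carrier G)" "\<And>v. v \<in> J \<Longrightarrow> inner_on (carrier G) m v = 0"
  define K where "K = {m \<in> supported_on (carrier G). \<forall>v\<in>J. inner_on (carrier G) m v = 0}"
  have K: "two_sided G K" unfolding K_def by (rule orthogonal_two_sided[OF J])
  obtain B where B: "finite B" "cfun.span B = J"
    using subspace_finite_basis[OF fin, of J] J by (auto simp: two_sided_def)
  obtain y where y: "y \<in> J" "\<And>v. v \<in> J \<Longrightarrow> inner_on (carrier G) (x - y) v = 0"
    using orthogonal_projection[OF fin B(1), of x] B(2) by auto
  define z where "z = x - y"
  have z: "z \<in> K"
  proof -
    have "y \<in> supported_on (carrier G)" using y(1) J by (auto simp: two_sided_def)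
    then show ?thesis
      unfolding K_def z_def using y x cfun.subspace_diff[OF supported_on_subspace] by blast
  qed
  have "R z \<in> K" using R_in[OF K z] .
  moreover have "R z \<in> J" unfolding z_def R_linear
    using Rx R_in[OF J y(1)] J by (auto simp: two_sided_def intro: cfun.subspace_diff)
  ultimately have "inner_on (carrier G) (R z) (R z) = 0" by (auto simp: K_def)
  then have "R z \<one> = 0" using inner_on_self_eq_0[OF fin, of "R z"] by simp
  then have "inner_on (carrier G) z x = 0" by (simp add: R_1)
  moreover have "inner_on (carrier G) z y = 0" using y by (simp add: z_def)
  moreover have "x = z + y" by (simp add: z_def)
  ultimately have "inner_on (carrier G) z z = 0" by (simp add: inner_on_linear)
  then have "z g = 0" for g
    using inner_on_self_eq_0[OF fin, of z] z by (cases "g \<in> carrier G") (auto simp: K_def supported_on_def)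
  then have "x = y" by (simp add: z_def fun_eq_iff)
  moreover have "inner_on (carrier G) y m = cnj (inner_on (carrier G) m y)"
    by (simp add: inner_on_def mult.commute)
  ultimately show "inner_on (carrier G) x m = 0" using m(2)[OF y(1)] by simp
qed (use J x in \<open>auto simp: two_sided_def\<close>)

end

section \<open>Matrix coefficients and irreducible constituents\<close>

definition left_invariant :: "('g, 'm) monoid_scheme \<Rightarrow> ('g \<Rightarrow> complex) set \<Rightarrow> bool" where
  "left_invariant G V \<longleftrightarrow> cfun.subspace V \<and> V \<subseteq> supported_on (carrier G) \<and>
     (\<forall>g\<in>carrier G. \<forall>v\<in>V. left_translate G g v \<in> V)"

lemma left_translate_sum:
  "left_translate G x (\<lambda>h. \<Sum>i\<in>I. c i * b i h) = (\<lambda>h. \<Sum>i\<in>I. c i * left_translate G x (b i) h)"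
  by (auto simp: left_translate_def fun_eq_iff)

lemma vec_eq_coordsI:
  "c \<in> carrier_vec d \<Longrightarrow> c' \<in> carrier_vec d \<Longrightarrow> (\<And>i. i < d \<Longrightarrow> c $ i = c' $ i) \<Longrightarrow> c = c'"
  by auto

lemma mult_mat_entry:
  assumes "A \<in> carrier_mat m n" "B \<in> carrier_mat n p" "i < m" "j < p"
  shows "(A * B) $$ (i, j) = (\<Sum>k<n. A $$ (i, k) * B $$ (k, j))"
  using assms by (auto simp: scalar_prod_def lessThan_atLeast0 intro!: sum.cong)

lemma mult_mat_vec_entry:
  assumes "A \<in> carrier_mat m n" "v \<in> carrier_vec n" "i < m"
  shows "(A *\<^sub>v v) $ i = (\<Sum>k<n. A $$ (i, k) * v $ k)"
  using assms by (auto simp: scalar_prod_def lessThan_atLeast0 intro!: sum.cong)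

lemma is_rep_entries:
  assumes "group G" "is_rep G \<rho>" "g \<in> carrier G" "h \<in> carrier G" "i < rep_dim G \<rho>" "j < rep_dim G \<rho>"
  shows "\<rho> (g \<otimes>\<^bsub>G\<^esub> h) $$ (i, j) = (\<Sum>k<rep_dim G \<rho>. \<rho> g $$ (i, k) * \<rho> h $$ (k, j))"
proof -
  have dims: "\<rho> g \<in> carrier_mat (rep_dim G \<rho>) (rep_dim G \<rho>)" "\<rho> h \<in> carrier_mat (rep_dim G \<rho>) (rep_dim G \<rho>)"
    and eq: "\<rho> (g \<otimes>\<^bsub>G\<^esub> h) = \<rho> g * \<rho> h"
    using assms by (auto simp: is_rep_def)
  show ?thesis
    unfolding eq by (rule mult_mat_entry[OF dims assms(5,6)])
qed

context fin_group
begin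

lemma left_translate_mult:
  assumes "x \<in> carrier G" "y \<in> carrier G"
  shows "left_translate G (x \<otimes> y) f = left_translate G x (left_translate G y f)"
  using assms by (auto simp: left_translate_def fun_eq_iff inv_mult_group m_assoc)

lemma left_translate_one:
  "f \<in> supported_on (carrier G) \<Longrightarrow> left_translate G \<one> f = f"
  by (auto simp: left_translate_def fun_eq_iff supported_on_def)

lemma matrix_form_basis:
  assumes V: "left_invariant G V" and \<rho>: "matrix_form_of_ideal G V \<rho>"
  obtains b where
    "\<And>j. j < rep_dim G \<rho> \<Longrightarrow> b j \<in> V"
    "\<And>v. v \<in> V \<Longrightarrow> \<exists>c. c \<in> carrier_vec (rep_dim G \<rho>) \<and> v = (\<lambda>h. \<Sum>i<rep_dim G \<rho>. c $ i * b i h)"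
    "\<And>c. (\<forall>h\<in>carrier G. (\<Sum>i<rep_dim G \<rho>. c i * b i h) = 0) \<Longrightarrow> \<forall>i<rep_dim G \<rho>. c i = 0"
    "\<And>g j. g \<in> carrier G \<Longrightarrow> j < rep_dim G \<rho> \<Longrightarrow>
       left_translate G g (b j) = (\<lambda>h. \<Sum>i<rep_dim G \<rho>. \<rho> g $$ (i, j) * b i h)"
proof -
  let ?d = "rep_dim G \<rho>"
  obtain b where b: "\<forall>j<?d. b j \<in> V"
     "\<forall>v\<in>V. \<exists>!c. c \<in> carrier_vec ?d \<and> v = (\<lambda>h. \<Sum>i<?d. c $ i * b i h)"
     "\<forall>g\<in>carrier G. \<forall>j<?d. left_translate G g (b j) = (\<lambda>h. \<Sum>i<?d. \<rho> g $$ (i, j) * b i h)"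
    using \<rho> by (auto simp: matrix_form_of_ideal_def)
  have indep: "\<forall>i<?d. c i = 0" if c: "\<forall>h\<in>carrier G. (\<Sum>i<?d. c i * b i h) = 0" for c
  proof -
    have "(\<Sum>i<?d. c i * b i h) = 0" for h
    proof (cases "h \<in> carrier G")
      case False
      then have "\<forall>i<?d. b i h = 0" using b(1) V by (auto simp: left_invariant_def supported_on_def)
      then show ?thesis by simp
    qed (use c in auto)
    then have "0 = (\<lambda>h. \<Sum>i<?d. vec ?d c $ i * b i h)" by (simp add: fun_eq_iff)
    moreover have "0 = (\<lambda>h. \<Sum>i<?d. 0\<^sub>v ?d $ i * b i h)" by (simp add: fun_eq_iff)
    moreover have "0 \<in> V" using V by (auto simp: left_invariant_def cfun.subspace_def)
    ultimately have "vec ?d c = 0\<^sub>v ?d" using b(2) vec_carrier zero_carrier_vec by blast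
    then show ?thesis by (metis index_vec index_zero_vec(1))
  qed
  show thesis
    by (rule that[of b]) (use b indep in blast)+
qed

text \<open>The relation \<open>b\<^sub>j(g\<inverse> h) = \<Sum>\<^sub>i \<rho>(g)\<^sub>i\<^sub>j b\<^sub>i(h)\<close> expresses translates of elements of \<open>V\<close> by matrix
entries, and the dual family to the basis \<open>b\<close> inverts it.\<close>

lemma coeffs_matrix_form:
  assumes V: "left_invariant G V" and \<rho>: "matrix_form_of_ideal G V \<rho>"
  shows "coeffs G \<rho> = cfun.span {flip G (translate G \<one> h v) |v h. v \<in> V \<and> h \<in> carrier G}"
    (is "_ = cfun.span ?F")
proof
  let ?d = "rep_dim G \<rho>"
  obtain b where b: "\<And>j. j < ?d \<Longrightarrow> b j \<in> V"
    "\<And>v. v \<in> V \<Longrightarrow> \<exists>c. c \<in> carrier_vec ?d \<and> v = (\<lambda>h. \<Sum>i<?d. c $ i * b i h)"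
    "\<And>c. (\<forall>h\<in>carrier G. (\<Sum>i<?d. c i * b i h) = 0) \<Longrightarrow> \<forall>i<?d. c i = 0"
    "\<And>g j. g \<in> carrier G \<Longrightarrow> j < ?d \<Longrightarrow> left_translate G g (b j) = (\<lambda>h. \<Sum>i<?d. \<rho> g $$ (i, j) * b i h)"
    by (rule matrix_form_basis[OF assms], rule that)
  have action: "b j (inv g \<otimes> h) = (\<Sum>i<?d. \<rho> g $$ (i, j) * b i h)"
    if "g \<in> carrier G" "h \<in> carrier G" "j < ?d" for g h j
    using fun_cong[OF b(4)[OF that(1,3)], of h] that(2) by (simp add: left_translate_def)
  have flip: "flip G (translate G \<one> h v) g = (if g \<in> carrier G then v (inv g \<otimes> h) else 0)"
    if "h \<in> carrier G" for g h v
    using that by (simp add: flip_def translate_def)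
  show "coeffs G \<rho> \<subseteq> cfun.span ?F"
    unfolding coeffs_def
  proof (rule cfun.span_minimal[OF _ cfun.subspace_span], safe)
    fix i j assume ij: "i < ?d" "j < ?d"
    obtain \<xi> where \<xi>: "\<forall>l<?d. (\<Sum>h\<in>carrier G. \<xi> h * b l h) = (if l = i then 1 else 0)"
      using dual_family[OF fin ij(1) b(3)] by blast
    have "(\<lambda>g. if g \<in> carrier G then \<rho> g $$ (i, j) else 0) =
        (\<lambda>g. \<Sum>h\<in>carrier G. \<xi> h * flip G (translate G \<one> h (b j)) g)"
    proof
      fix g
      show "(if g \<in> carrier G then \<rho> g $$ (i, j) else 0) =
        (\<Sum>h\<in>carrier G. \<xi> h * flip G (translate G \<one> h (b j)) g)"
      proof (cases "g \<in> carrier G")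
        case True
        have "(\<Sum>h\<in>carrier G. \<xi> h * flip G (translate G \<one> h (b j)) g) =
            (\<Sum>h\<in>carrier G. \<Sum>l<?d. \<xi> h * (\<rho> g $$ (l, j) * b l h))"
          using True ij by (intro sum.cong[OF refl]) (simp add: flip action sum_distrib_left)
        also have "\<dots> = (\<Sum>l<?d. \<rho> g $$ (l, j) * (\<Sum>h\<in>carrier G. \<xi> h * b l h))"
          by (subst sum.swap) (simp add: sum_distrib_left mult.left_commute)
        also have "\<dots> = (\<Sum>l<?d. if l = i then \<rho> g $$ (l, j) else 0)"
          using \<xi> by (intro sum.cong) auto
        also have "\<dots> = \<rho> g $$ (i, j)" using ij(1) by simp
        finally show ?thesis using True by simp
      qed (simp add: flip)
    qed
    also have "\<dots> \<in> cfun.span ?F"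
      using b(1)[OF ij(2)] by (intro subspace_sum_scaled cfun.subspace_span cfun.span_base) blast
    finally show "(\<lambda>g. if g \<in> carrier G then \<rho> g $$ (i, j) else 0) \<in> cfun.span ?F" .
  qed
  show "cfun.span ?F \<subseteq> coeffs G \<rho>"
  proof (rule cfun.span_minimal[OF _ coeffs_subspace], safe)
    fix v h assume v: "v \<in> V" and h: "h \<in> carrier G"
    obtain c where c: "v = (\<lambda>h. \<Sum>j<?d. c $ j * b j h)" using b(2)[OF v] by blast
    have "flip G (translate G \<one> h v) = (\<lambda>g. \<Sum>j<?d. c $ j * (\<Sum>i<?d. b i h * (if g \<in> carrier G then \<rho> g $$ (i, j) else 0)))"
      using h by (auto simp: fun_eq_iff flip c action mult.commute intro!: sum.cong)
    also have "\<dots> \<in> coeffs G \<rho>"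
      by (intro subspace_sum_scaled coeffs_subspace coeffs_entry) auto
    finally show "flip G (translate G \<one> h v) \<in> coeffs G \<rho>" .
  qed
qed

lemma ex_matrix_form:
  assumes V: "left_invariant G V"
  shows "\<exists>\<rho>. matrix_form_of_ideal G V \<rho>"
proof -
  have subV: "cfun.subspace V" and suppV: "V \<subseteq> supported_on (carrier G)"
    using V by (auto simp: left_invariant_def)
  obtain B where B: "finite B" "B \<subseteq> V" "cfun.independent B" "cfun.span B = V"
    using subspace_finite_basis[OF fin subV suppV] by blast
  obtain bs where bs: "distinct bs" "set bs = B" using B(1) finite_distinct_list by blast
  define d where "d = length bs"
  define b where "b j = bs ! j" for j
  have inj: "inj_on b {..<d}" and img: "b ` {..<d} = B"
    using bs by (auto simp: b_def d_def inj_on_def nth_eq_iff_index_eq set_conv_nth)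
  have bV: "b j \<in> V" if "j < d" for j using that B(2) img by auto
  have span: "\<exists>c. v = (\<lambda>h. \<Sum>i<d. c i * b i h)" if "v \<in> V" for v
    using span_family[of "{..<d}" v b] that B(4) img by auto
  have indep: "\<forall>i<d. c i = 0" if c: "\<forall>h\<in>carrier G. (\<Sum>i<d. c i * b i h) = 0" for c
  proof -
    have "(\<Sum>i<d. c i * b i h) = 0" for h
    proof (cases "h \<in> carrier G")
      case False
      then have "\<forall>i<d. b i h = 0" using bV suppV by (auto simp: supported_on_def)
      then show ?thesis by simp
    qed (use c in auto)
    then have "(\<Sum>i<d. (\<lambda>h. c i * b i h)) = 0" by (simp add: fun_eq_iff sum_fun_apply)
    then have sum0: "(\<Sum>v\<in>B. (\<lambda>h. c (the_inv_into {..<d} b v) * v h)) = 0"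
      unfolding img[symmetric] sum.reindex[OF inj] using inj by (simp add: the_inv_into_f_f)
    have "c i = 0" if "i < d" for i
    proof -
      have "c (the_inv_into {..<d} b (b i)) = 0"
        using cfun.independentD[OF B(3,1) subset_refl sum0, of "b i"] that img by auto
      then show ?thesis using inj that by (simp add: the_inv_into_f_f)
    qed
    then show ?thesis by blast
  qed
  have "\<forall>i\<in>{..<d}. \<exists>\<xi>. \<forall>j<d. (\<Sum>x\<in>carrier G. \<xi> x * b j x) = (if j = i then 1 else 0)"
    using dual_family[OF fin _ indep] by blast
  then obtain \<xi> where \<xi>: "\<And>i j. i < d \<Longrightarrow> j < d \<Longrightarrow> (\<Sum>x\<in>carrier G. \<xi> i x * b j x) = (if j = i then 1 else 0)"
    by (metis lessThan_iff)
  \<comment> \<open>coordinates are defined on all functions, which makes them visibly linear\<close>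
  define coord where "coord i v = (\<Sum>x\<in>carrier G. \<xi> i x * v x)" for i v
  have coord_sum: "coord i (\<lambda>h. \<Sum>j<d. c j * b j h) = c i" if "i < d" for i c
  proof -
    have "coord i (\<lambda>h. \<Sum>j<d. c j * b j h) = (\<Sum>j<d. c j * (\<Sum>x\<in>carrier G. \<xi> i x * b j x))"
      unfolding coord_def sum_distrib_left by (subst sum.swap) (simp add: mult.left_commute)
    also have "\<dots> = c i" using that by (simp add: \<xi> if_distrib cong: if_cong)
    finally show ?thesis .
  qed
  have expand: "v = (\<lambda>h. \<Sum>i<d. coord i v * b i h)" if v: "v \<in> V" for v
  proof -
    obtain c where c: "v = (\<lambda>h. \<Sum>i<d. c i * b i h)" using span[OF v] by blast
    have "coord i v = c i" if "i < d" for i unfolding c using coord_sum[OF that] .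
    then show ?thesis by (subst c) simp
  qed
  define \<rho> where "\<rho> g = mat d d (\<lambda>(i, j). coord i (left_translate G g (b j)))" for g
  have dim: "rep_dim G \<rho> = d" by (simp add: rep_dim_def \<rho>_def)
  have action: "left_translate G g (b j) = (\<lambda>h. \<Sum>i<d. \<rho> g $$ (i, j) * b i h)" if "g \<in> carrier G" "j < d" for g j
  proof -
    have "left_translate G g (b j) \<in> V" using V bV that by (auto simp: left_invariant_def)
    from expand[OF this] show ?thesis using that(2) by (simp add: \<rho>_def)
  qed
  have "is_rep G \<rho>"
    unfolding is_rep_def dim
  proof (intro conjI ballI)
    fix g h assume gh: "g \<in> carrier G" "h \<in> carrier G"
    show "\<rho> (g \<otimes> h) = \<rho> g * \<rho> h"
    proof (rule eq_matI)
      fix i j assume ij: "i < dim_row (\<rho> g * \<rho> h)" "j < dim_col (\<rho> g * \<rho> h)"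
      then have ij: "i < d" "j < d" by (auto simp: \<rho>_def)
      have "left_translate G (g \<otimes> h) (b j) = (\<lambda>x. \<Sum>k<d. \<rho> h $$ (k, j) * (\<Sum>i<d. \<rho> g $$ (i, k) * b i x))"
        unfolding left_translate_mult[OF gh] action[OF gh(2) ij(2)] left_translate_sum
        by (intro ext sum.cong[OF refl]) (simp add: action[OF gh(1)])
      also have "\<dots> = (\<lambda>x. \<Sum>i<d. (\<Sum>k<d. \<rho> g $$ (i, k) * \<rho> h $$ (k, j)) * b i x)"
        by (rule ext, unfold sum_distrib_left sum_distrib_right, subst sum.swap) (simp add: ac_simps)
      finally have "coord i (left_translate G (g \<otimes> h) (b j)) = (\<Sum>k<d. \<rho> g $$ (i, k) * \<rho> h $$ (k, j))"
        using coord_sum[OF ij(1)] by simp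
      then show "\<rho> (g \<otimes> h) $$ (i, j) = (\<rho> g * \<rho> h) $$ (i, j)"
        using ij by (simp add: \<rho>_def scalar_prod_def lessThan_atLeast0)
    qed (auto simp: \<rho>_def)
  next
    show "\<rho> \<one> = 1\<^sub>m d"
    proof (rule eq_matI)
      fix i j assume ij: "i < dim_row (1\<^sub>m d :: complex mat)" "j < dim_col (1\<^sub>m d :: complex mat)"
      have "left_translate G \<one> (b j) = b j" using left_translate_one bV suppV ij by auto
      then show "\<rho> \<one> $$ (i, j) = 1\<^sub>m d $$ (i, j)"
        using ij \<xi>[of i j] by (auto simp: \<rho>_def coord_def)
    qed (auto simp: \<rho>_def)
  qed (auto simp: \<rho>_def)
  moreover have "\<exists>!c. c \<in> carrier_vec d \<and> v = (\<lambda>h. \<Sum>i<d. c $ i * b i h)" if v: "v \<in> V" for v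
  proof (rule ex1I[of _ "vec d (\<lambda>i. coord i v)"])
    show "vec d (\<lambda>i. coord i v) \<in> carrier_vec d \<and> v = (\<lambda>h. \<Sum>i<d. vec d (\<lambda>i. coord i v) $ i * b i h)"
      using expand[OF v] by simp
    fix c assume c: "c \<in> carrier_vec d \<and> v = (\<lambda>h. \<Sum>i<d. c $ i * b i h)"
    then have "coord i v = c $ i" if "i < d" for i using coord_sum[OF that, of "\<lambda>i. c $ i"] by simp
    then show "c = vec d (\<lambda>i. coord i v)" using c by auto
  qed
  ultimately have "matrix_form_of_ideal G V \<rho>"
    unfolding matrix_form_of_ideal_def dim using bV action by (intro conjI exI[of _ b]) auto
  then show ?thesis by blast
qed

text \<open>A basis of least possible size among the nonzero invariant subspaces spans a minimal one.\<close>

lemma minimal_left_invariant: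
  assumes V: "left_invariant G V" "V \<noteq> {0}"
  shows "\<exists>L. left_invariant G L \<and> L \<noteq> {0} \<and> L \<subseteq> V \<and>
    (\<forall>L'. left_invariant G L' \<and> L' \<subseteq> L \<longrightarrow> L' = {0} \<or> L' = L)"
proof -
  define P where "P n \<longleftrightarrow> (\<exists>B. finite B \<and> cfun.independent B \<and> left_invariant G (cfun.span B) \<and>
     cfun.span B \<noteq> {0} \<and> cfun.span B \<subseteq> V \<and> card B = n)" for n
  have basis: "\<exists>B. finite B \<and> cfun.independent B \<and> cfun.span B = L" if "left_invariant G L" for L
    using subspace_finite_basis[OF fin, of L] that by (auto simp: left_invariant_def)
  have "\<exists>n. P n" using basis[OF V(1)] V by (auto simp: P_def)
  then have "P (LEAST n. P n)" by (metis LeastI)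
  then obtain B where B: "finite B" "cfun.independent B" "left_invariant G (cfun.span B)"
     "cfun.span B \<noteq> {0}" "cfun.span B \<subseteq> V" "card B = (LEAST n. P n)"
    by (auto simp: P_def)
  have "L' = {0} \<or> L' = cfun.span B" if L': "left_invariant G L'" "L' \<subseteq> cfun.span B" for L'
  proof (rule ccontr)
    assume *: "\<not> (L' = {0} \<or> L' = cfun.span B)"
    obtain B' where B': "finite B'" "cfun.independent B'" "cfun.span B' = L'"
      using basis[OF L'(1)] by blast
    obtain x where x: "x \<in> cfun.span B" "x \<notin> L'" using * L' by blast
    have "cfun.independent (insert x B')" using x B' by (simp add: cfun.independent_insertI)
    moreover have "insert x B' \<subseteq> cfun.span B"
      using x L'(2) B'(3) cfun.span_superset[of B'] by auto
    ultimately have "card (insert x B') \<le> card B"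
      using cfun.independent_span_bound[OF B(1)] by blast
    moreover have "x \<notin> B'" using x B'(3) cfun.span_base by blast
    ultimately have "card B' < card B" using B'(1) by simp
    moreover have "cfun.span B' \<noteq> {0}" "cfun.span B' \<subseteq> V" "left_invariant G (cfun.span B')"
      using * L' B(5) B'(3) by blast+
    then have "P (card B')" unfolding P_def using B'(1,2) by blast
    then have "(LEAST n. P n) \<le> card B'" by (rule Least_le)
    ultimately show False using B(6) by simp
  qed
  then show ?thesis using B by blast
qed

text \<open>An invariant subspace of the coordinate space corresponds to an invariant subspace of \<open>L\<close>.\<close>

lemma irreducible_matrix_form:
  assumes L: "left_invariant G L" "L \<noteq> {0}"
    and minimal: "\<And>L'. left_invariant G L' \<Longrightarrow> L' \<subseteq> L \<Longrightarrow> L' = {0} \<or> L' = L"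
    and \<rho>: "matrix_form_of_ideal G L \<rho>"
  shows "irreducible_rep G \<rho>"
proof -
  let ?d = "rep_dim G \<rho>"
  obtain b where b: "\<And>j. j < ?d \<Longrightarrow> b j \<in> L"
    "\<And>v. v \<in> L \<Longrightarrow> \<exists>c. c \<in> carrier_vec ?d \<and> v = (\<lambda>h. \<Sum>i<?d. c $ i * b i h)"
    "\<And>c. (\<forall>h\<in>carrier G. (\<Sum>i<?d. c i * b i h) = 0) \<Longrightarrow> \<forall>i<?d. c i = 0"
    "\<And>g j. g \<in> carrier G \<Longrightarrow> j < ?d \<Longrightarrow> left_translate G g (b j) = (\<lambda>h. \<Sum>i<?d. \<rho> g $$ (i, j) * b i h)"
    by (rule matrix_form_basis[OF L(1) \<rho>], rule that)
  have subL: "cfun.subspace L" and suppL: "L \<subseteq> supported_on (carrier G)"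
    using L by (auto simp: left_invariant_def)
  have rep: "is_rep G \<rho>" using \<rho> by (simp add: matrix_form_of_ideal_def)
  have "?d > 0"
  proof (rule ccontr)
    assume "\<not> ?d > 0"
    then have "v = 0" if "v \<in> L" for v using b(2)[OF that] by (auto simp: fun_eq_iff)
    then show False using L(2) subL cfun.subspace_0 by blast
  qed
  moreover have "U = {0\<^sub>v ?d} \<or> U = carrier_vec ?d" if U: "invariant_subspace G \<rho> U" for U
  proof -
    define comb where "comb u = (\<lambda>h. \<Sum>i<?d. u $ i * b i h)" for u :: "complex vec"
    have U': "U \<subseteq> carrier_vec ?d" "0\<^sub>v ?d \<in> U" "\<And>u v. u \<in> U \<Longrightarrow> v \<in> U \<Longrightarrow> u + v \<in> U"
      "\<And>c u. u \<in> U \<Longrightarrow> c \<cdot>\<^sub>v u \<in> U" "\<And>g u. g \<in> carrier G \<Longrightarrow> u \<in> U \<Longrightarrow> \<rho> g *\<^sub>v u \<in> U"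
      using U by (auto simp: invariant_subspace_def)
    have comb_L: "comb u \<in> L" for u
      unfolding comb_def using b(1) by (intro subspace_sum_scaled subL) auto
    have comb_inj: "u = v" if "comb u = comb v" "u \<in> carrier_vec ?d" "v \<in> carrier_vec ?d" for u v
    proof -
      have "\<forall>i<?d. u $ i - v $ i = 0"
        using fun_cong[OF that(1)] by (intro b(3)) (simp add: comb_def algebra_simps sum_subtractf)
      then show ?thesis using that by (intro vec_eq_coordsI) auto
    qed
    have comb_act: "left_translate G g (comb u) = comb (\<rho> g *\<^sub>v u)" if "g \<in> carrier G" "u \<in> U" for g u
    proof -
      have dims: "\<rho> g \<in> carrier_mat ?d ?d" "u \<in> carrier_vec ?d" using that rep U'(1) by (auto simp: is_rep_def)
      have "left_translate G g (comb u) = (\<lambda>h. \<Sum>j<?d. \<Sum>i<?d. u $ j * (\<rho> g $$ (i, j) * b i h))"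
        using that by (simp add: comb_def left_translate_sum b(4) sum_distrib_left)
      also have "\<dots> = (\<lambda>h. \<Sum>i<?d. (\<rho> g *\<^sub>v u) $ i * b i h)"
        by (rule ext, subst sum.swap, intro sum.cong[OF refl])
           (simp add: mult_mat_vec_entry[OF dims] sum_distrib_left ac_simps)
      finally show ?thesis by (simp add: comb_def)
    qed
    have comb_add: "comb (u + v) = comb u + comb v" if "u \<in> U" "v \<in> U" for u v
      using that U'(1) by (auto simp: comb_def fun_eq_iff sum.distrib[symmetric] algebra_simps intro!: sum.cong)
    have comb_smult: "comb (c \<cdot>\<^sub>v u) = (\<lambda>h. c * comb u h)" if "u \<in> U" for u c
      using that U'(1) by (auto simp: comb_def fun_eq_iff sum_distrib_left algebra_simps intro!: sum.cong)
    have comb0: "comb (0\<^sub>v ?d) = 0" by (simp add: comb_def fun_eq_iff)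
    have "cfun.subspace (comb ` U)"
    proof (rule cfun.subspaceI)
      show "0 \<in> comb ` U" using comb0 U'(2) by force
      show "f + f' \<in> comb ` U" if "f \<in> comb ` U" "f' \<in> comb ` U" for f f'
        using that comb_add[symmetric] U'(3) by auto
      show "(\<lambda>x. c * f x) \<in> comb ` U" if "f \<in> comb ` U" for c f
        using that comb_smult[symmetric] U'(4) by auto
    qed
    then have "left_invariant G (comb ` U)"
      using comb_act U'(5) comb_L suppL unfolding left_invariant_def by blast
    then have "comb ` U = {0} \<or> comb ` U = L" using comb_L by (intro minimal) auto
    then show ?thesis
    proof
      assume 0: "comb ` U = {0}"
      have "u = 0\<^sub>v ?d" if "u \<in> U" for u
        using that 0 comb0 U'(1) by (intro comb_inj) auto
      then show ?thesis using U'(2) by blast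
    next
      assume all: "comb ` U = L"
      have "u \<in> U" if u: "u \<in> carrier_vec ?d" for u
      proof -
        obtain u' where "u' \<in> U" "comb u = comb u'" using comb_L[of u] all by blast
        then show ?thesis using comb_inj[of u u'] u U'(1) by auto
      qed
      then show ?thesis using U'(1) by blast
    qed
  qed
  ultimately show ?thesis using rep by (simp add: irreducible_rep_def)
qed

text \<open>An injective intertwiner \<open>T\<close> has independent columns, and a left inverse, taken from their dual
family, turns \<open>\<rho> T = T \<tau>\<close> into a formula for the entries of \<open>\<tau>\<close> by those of \<open>\<rho>\<close>.\<close>

lemma coeffs_of_contained:
  assumes \<rho>: "\<And>g. g \<in> carrier G \<Longrightarrow> \<rho> g \<in> carrier_mat (rep_dim G \<rho>) (rep_dim G \<rho>)"
    and \<tau>: "is_rep G \<tau>" and contains: "contains_rep G \<rho> \<tau>"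
  shows "coeffs G \<tau> \<subseteq> coeffs G \<rho>"
proof -
  let ?d = "rep_dim G \<rho>" and ?e = "rep_dim G \<tau>"
  obtain T where T: "T \<in> carrier_mat ?d ?e"
    "\<And>v. v \<in> carrier_vec ?e \<Longrightarrow> T *\<^sub>v v = 0\<^sub>v ?d \<Longrightarrow> v = 0\<^sub>v ?e"
    "\<And>g. g \<in> carrier G \<Longrightarrow> \<rho> g * T = T * \<tau> g"
    using contains unfolding contains_rep_def by blast
  have indep: "\<forall>j<?e. c j = 0" if c: "\<forall>i\<in>{..<?d}. (\<Sum>j<?e. c j * T $$ (i, j)) = 0" for c
  proof -
    have "T *\<^sub>v vec ?e c = 0\<^sub>v ?d"
      using T(1) c by (intro eq_vecI) (auto simp: scalar_prod_def lessThan_atLeast0 mult.commute)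
    then have "vec ?e c = 0\<^sub>v ?e" by (intro T(2)) auto
    then show ?thesis by (metis index_vec index_zero_vec(1))
  qed
  show ?thesis
    unfolding coeffs_def[of G \<tau>]
  proof (rule cfun.span_minimal[OF _ coeffs_subspace], safe)
    fix i j assume ij: "i < ?e" "j < ?e"
    obtain \<xi> where \<xi>: "\<forall>l<?e. (\<Sum>x<?d. \<xi> x * T $$ (x, l)) = (if l = i then 1 else 0)"
      using dual_family[OF finite_lessThan ij(1), of "?d" "\<lambda>l x. T $$ (x, l)"] indep by blast
    have "(\<lambda>g. if g \<in> carrier G then \<tau> g $$ (i, j) else 0) =
       (\<lambda>g. \<Sum>x<?d. \<xi> x * (\<Sum>k<?d. T $$ (k, j) * (if g \<in> carrier G then \<rho> g $$ (x, k) else 0)))"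
    proof
      fix g
      show "(if g \<in> carrier G then \<tau> g $$ (i, j) else 0) =
         (\<Sum>x<?d. \<xi> x * (\<Sum>k<?d. T $$ (k, j) * (if g \<in> carrier G then \<rho> g $$ (x, k) else 0)))"
      proof (cases "g \<in> carrier G")
        case True
        have \<rho>g: "\<rho> g \<in> carrier_mat ?d ?d" and \<tau>g: "\<tau> g \<in> carrier_mat ?e ?e"
          using \<rho> \<tau> True by (auto simp: is_rep_def)
        have "(\<Sum>k<?d. T $$ (k, j) * \<rho> g $$ (x, k)) = (\<Sum>l<?e. T $$ (x, l) * \<tau> g $$ (l, j))" if "x < ?d" for x
        proof -
          have "(\<rho> g * T) $$ (x, j) = (T * \<tau> g) $$ (x, j)" using T(3)[OF True] by simp
          then show ?thesis using that ij \<rho>g \<tau>g T(1)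
            by (simp add: scalar_prod_def lessThan_atLeast0 mult.commute)
        qed
        then have "(\<Sum>x<?d. \<xi> x * (\<Sum>k<?d. T $$ (k, j) * \<rho> g $$ (x, k))) =
           (\<Sum>x<?d. \<Sum>l<?e. \<xi> x * (T $$ (x, l) * \<tau> g $$ (l, j)))"
          by (simp add: sum_distrib_left)
        also have "\<dots> = (\<Sum>l<?e. (\<Sum>x<?d. \<xi> x * T $$ (x, l)) * \<tau> g $$ (l, j))"
          by (subst sum.swap) (simp add: sum_distrib_right mult.assoc)
        also have "\<dots> = (\<Sum>l<?e. if l = i then \<tau> g $$ (l, j) else 0)"
          using \<xi> by (intro sum.cong) auto
        also have "\<dots> = \<tau> g $$ (i, j)" using ij by simp
        finally show ?thesis using True by simp
      qed simp
    qed
    also have "\<dots> \<in> coeffs G \<rho>"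
      by (intro subspace_sum_scaled coeffs_subspace coeffs_entry) auto
    finally show "(\<lambda>g. if g \<in> carrier G then \<tau> g $$ (i, j) else 0) \<in> coeffs G \<rho>" .
  qed
qed

lemma coeffs_left_translate:
  assumes "is_rep G \<tau>" "f \<in> coeffs G \<tau>" "x \<in> carrier G"
  shows "translate G \<one> x f \<in> coeffs G \<tau>"
  using assms(2) unfolding coeffs_def[of G \<tau>]
proof (rule span_linear_image[where L = "translate G \<one> x" and f = f, OF _ cfun.subspace_span _ translate_linear],
    fold coeffs_def)
  fix s assume "s \<in> {\<lambda>g. if g \<in> carrier G then \<tau> g $$ (i, j) else 0 |i j. i < rep_dim G \<tau> \<and> j < rep_dim G \<tau>}"
  then obtain i j where s: "s = (\<lambda>g. if g \<in> carrier G then \<tau> g $$ (i, j) else 0)"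
    and ij: "i < rep_dim G \<tau>" "j < rep_dim G \<tau>" by blast
  have "translate G \<one> x s = (\<lambda>g. \<Sum>k<rep_dim G \<tau>. \<tau> x $$ (k, j) * (if g \<in> carrier G then \<tau> g $$ (i, k) else 0))"
    using assms ij is_rep_entries[OF is_group assms(1) _ assms(3) ij]
    by (auto simp: translate_def s fun_eq_iff mult.commute)
  also have "\<dots> \<in> coeffs G \<tau>"
    using ij by (intro subspace_sum_scaled coeffs_subspace coeffs_entry) auto
  finally show "translate G \<one> x s \<in> coeffs G \<tau>" .
qed

text \<open>Let \<open>M\<close> be the space of functions whose inverses are orthogonal to the coefficients of every
irreducible representation. If it were not zero, it would contain a minimal invariant subspace \<open>L\<close>,
which carries an irreducible \<open>\<tau>\<close>. The inverses of the elements of \<open>L\<close> are coefficients of \<open>\<tau>\<close> and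
therefore orthogonal to themselves. So \<open>M = 0\<close>, and nothing but \<open>0\<close> is orthogonal to the coefficients of
\<open>\<rho>\<close>.\<close>

theorem coeffs_if_contains_all_irreps:
  assumes \<rho>: "\<And>g. g \<in> carrier G \<Longrightarrow> \<rho> g \<in> carrier_mat (rep_dim G \<rho>) (rep_dim G \<rho>)"
    and all: "contains_all_irreps G \<rho>"
  shows "coeffs G \<rho> = supported_on (carrier G)"
proof (rule antisym[OF coeffs_supported], rule subsetI)
  fix f assume f: "f \<in> supported_on (carrier G)"
  \<comment> \<open>the inversion makes \<open>M\<close> invariant under left translation and puts \<open>flip G l\<close> on both sides below\<close>
  define M where "M = {m \<in> supported_on (carrier G).
    \<forall>\<tau>. irreducible_rep G \<tau> \<longrightarrow> (\<forall>v\<in>coeffs G \<tau>. inner_on (carrier G) v (flip G m) = 0)}"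
  have "left_invariant G M"
    unfolding left_invariant_def
  proof (intro conjI ballI)
    have "flip G 0 = 0" "flip G (f + f') = flip G f + flip G f'"
      "flip G (\<lambda>g. c * f g) = (\<lambda>g. c * flip G f g)" for f f' c
      by (auto simp: flip_def fun_eq_iff)
    then show "cfun.subspace M"
      using supported_on_subspace[of "carrier G"] unfolding M_def
      by (auto simp: cfun.subspace_def inner_on_linear)
  next
    fix x m assume x: "x \<in> carrier G" and m: "m \<in> M"
    have "flip G (left_translate G x m) = translate G \<one> x (flip G m)"
      using x by (auto simp: flip_def left_translate_def translate_def fun_eq_iff inv_mult_group)
    then have "inner_on (carrier G) v (flip G (left_translate G x m)) = inner_on (carrier G) (translate G \<one> (inv x) v) (flip G m)" for v
      using inner_translate[of "\<one>" "inv x" v "flip G m"] x by simp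
    then have "inner_on (carrier G) v (flip G (left_translate G x m)) = 0"
      if "irreducible_rep G \<tau>" "v \<in> coeffs G \<tau>" for \<tau> v
      using m that x coeffs_left_translate[of \<tau> v "inv x"] by (auto simp: M_def irreducible_rep_def)
    then show "left_translate G x m \<in> M" by (auto simp: M_def supported_on_def left_translate_def)
  qed (auto simp: M_def)
  have "M = {0}"
  proof (rule ccontr)
    assume "M \<noteq> {0}"
    then obtain L where L: "left_invariant G L" "L \<noteq> {0}" "L \<subseteq> M"
      "\<And>L'. left_invariant G L' \<Longrightarrow> L' \<subseteq> L \<Longrightarrow> L' = {0} \<or> L' = L"
      using minimal_left_invariant[OF \<open>left_invariant G M\<close>] by blast
    obtain \<tau> where \<tau>: "matrix_form_of_ideal G L \<tau>" using ex_matrix_form[OF L(1)] by blast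
    have irr: "irreducible_rep G \<tau>" by (rule irreducible_matrix_form[OF L(1,2,4) \<tau>])
    have "l = 0" if l: "l \<in> L" for l
    proof -
      have "flip G (translate G \<one> \<one> l) \<in> coeffs G \<tau>"
        unfolding coeffs_matrix_form[OF L(1) \<tau>] using l by (intro cfun.span_base) auto
      moreover have "flip G (translate G \<one> \<one> l) = flip G l"
        by (auto simp: flip_def translate_def fun_eq_iff)
      ultimately have "inner_on (carrier G) (flip G l) (flip G l) = 0"
        using l L(3) irr by (auto simp: M_def)
      then have "\<forall>g\<in>carrier G. l (inv g) = 0"
        using inner_on_self_eq_0[OF fin, of "flip G l"] by (simp add: flip_def)
      then have "l g = 0" if "g \<in> carrier G" for g using that inv_inv[of g] inv_closed[of g] by metis
      then show ?thesis using l L(1) by (auto simp: left_invariant_def supported_on_def fun_eq_iff)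
    qed
    then show False using L(1,2) cfun.subspace_0 by (auto simp: left_invariant_def)
  qed
  show "f \<in> coeffs G \<rho>"
  proof (rule in_subspace_if_ortho[OF fin coeffs_subspace coeffs_supported f])
    fix m assume m: "m \<in> supported_on (carrier G)" "\<And>v. v \<in> coeffs G \<rho> \<Longrightarrow> inner_on (carrier G) m v = 0"
    have "flip G (flip G m) = m" using m(1) by (auto simp: flip_def supported_on_def fun_eq_iff)
    moreover have "inner_on (carrier G) v m = cnj (inner_on (carrier G) m v)" for v
      by (simp add: inner_on_def mult.commute)
    moreover have "coeffs G \<tau> \<subseteq> coeffs G \<rho>" if "irreducible_rep G \<tau>" for \<tau>
      using that all coeffs_of_contained[OF \<rho>] by (auto simp: contains_all_irreps_def irreducible_rep_def)
    ultimately have "flip G m \<in> M" using m(2) by (auto simp: M_def supported_on_def flip_def)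
    then have "flip G m = 0" using \<open>M = {0}\<close> by simp
    then have "m = 0" using \<open>flip G (flip G m) = m\<close> by (auto simp: flip_def fun_eq_iff)
    then show "inner_on (carrier G) f m = 0" by (simp add: inner_on_linear)
  qed
qed

text \<open>Pairing \<open>\<delta>\<close> with the inverse of a diagonal entry of an irreducible \<open>\<tau>\<close> gives \<open>1\<close>, so some entry of
\<open>\<rho>\<close> has a nonzero pairing with it. That pairing is an entry of the average over \<open>g\<close> of
\<open>\<rho>(g) E \<tau>(g\<inverse>)\<close> for an elementary matrix \<open>E\<close>. This average is an intertwiner from \<open>\<tau>\<close> to \<open>\<rho>\<close>, and its
kernel, an invariant subspace other than the whole space, is zero.\<close>

theorem contains_all_irreps_if_delta:
  assumes rep: "is_rep G \<rho>" and delta: "(\<lambda>g. if g = \<one> then 1 else 0) \<in> coeffs G \<rho>"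
  shows "contains_all_irreps G \<rho>"
  unfolding contains_all_irreps_def
proof (intro allI impI)
  fix \<tau> assume irr: "irreducible_rep G \<tau>"
  let ?d = "rep_dim G \<rho>" and ?e = "rep_dim G \<tau>"
  have \<tau>: "is_rep G \<tau>" "?e > 0" using irr by (auto simp: irreducible_rep_def)
  have \<rho>g: "\<rho> g \<in> carrier_mat ?d ?d" and \<tau>g: "\<tau> g \<in> carrier_mat ?e ?e" if "g \<in> carrier G" for g
    using that rep \<tau> by (auto simp: is_rep_def)
  define pair where "pair f = (\<Sum>g\<in>carrier G. f g * \<tau> (inv g) $$ (0, 0))" for f :: "'a \<Rightarrow> complex"
  have "\<exists>i<?d. \<exists>j<?d. pair (\<lambda>g. if g \<in> carrier G then \<rho> g $$ (i, j) else 0) \<noteq> 0"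
  proof (rule ccontr)
    assume *: "\<not> ?thesis"
    have "pair f = 0" if "f \<in> coeffs G \<rho>" for f
      using that unfolding coeffs_def
    proof (rule cfun.span_induct)
      show "cfun.subspace {f. pair f = 0}"
        by (auto simp: cfun.subspace_def pair_def algebra_simps sum.distrib sum_distrib_left[symmetric])
    qed (use * in auto)
    then have "pair (\<lambda>g. if g = \<one> then 1 else 0) = 0" using delta by blast
    moreover have "pair (\<lambda>g. if g = \<one> then 1 else 0) = \<tau> \<one> $$ (0, 0)"
      using fin by (simp add: pair_def if_distrib if_distribR cong: if_cong)
    ultimately show False using \<tau> by (simp add: is_rep_def)
  qed
  then obtain i j where ij: "i < ?d" "j < ?d"
    and ne: "(\<Sum>g\<in>carrier G. \<rho> g $$ (i, j) * \<tau> (inv g) $$ (0, 0)) \<noteq> 0"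
    by (auto simp: pair_def cong: sum.cong)
  define T where "T = mat ?d ?e (\<lambda>(k, l). \<Sum>g\<in>carrier G. \<rho> g $$ (k, j) * \<tau> (inv g) $$ (0, l))"
  have T: "T \<in> carrier_mat ?d ?e" by (simp add: T_def)
  have inter: "\<rho> h * T = T * \<tau> h" if h: "h \<in> carrier G" for h
  proof (rule eq_matI)
    fix k l assume "k < dim_row (T * \<tau> h)" "l < dim_col (T * \<tau> h)"
    then have kl: "k < ?d" "l < ?e" using \<tau>g[OF h] by (auto simp: T_def)
    have "(\<rho> h * T) $$ (k, l) = (\<Sum>m<?d. \<Sum>g\<in>carrier G. \<rho> h $$ (k, m) * (\<rho> g $$ (m, j) * \<tau> (inv g) $$ (0, l)))"
      using kl \<rho>g[OF h] by (simp add: T_def scalar_prod_def lessThan_atLeast0 sum_distrib_left)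
    also have "\<dots> = (\<Sum>g\<in>carrier G. \<rho> (h \<otimes> g) $$ (k, j) * \<tau> (inv (h \<otimes> g) \<otimes> h) $$ (0, l))"
      using h kl ij
      by (subst sum.swap, intro sum.cong[OF refl])
         (simp add: is_rep_entries[OF is_group rep] sum_distrib_right inv_mult_group m_assoc mult.assoc)
    also have "\<dots> = (\<Sum>g\<in>carrier G. \<rho> g $$ (k, j) * \<tau> (inv g \<otimes> h) $$ (0, l))"
      by (rule sum_shift_left[OF h, of "\<lambda>g. \<rho> g $$ (k, j) * \<tau> (inv g \<otimes> h) $$ (0, l)"])
    also have "\<dots> = (\<Sum>g\<in>carrier G. \<Sum>m<?e. \<rho> g $$ (k, j) * (\<tau> (inv g) $$ (0, m) * \<tau> h $$ (m, l)))"
      using h kl \<tau>(2) by (simp add: is_rep_entries[OF is_group \<tau>(1)] sum_distrib_left)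
    also have "\<dots> = (T * \<tau> h) $$ (k, l)"
      using kl \<tau>g[OF h]
      by (subst sum.swap) (simp add: T_def scalar_prod_def lessThan_atLeast0 sum_distrib_right mult.assoc)
    finally show "(\<rho> h * T) $$ (k, l) = (T * \<tau> h) $$ (k, l)" .
  qed (use \<rho>g[OF h] \<tau>g[OF h] T in auto)
  define U where "U = {v \<in> carrier_vec ?e. T *\<^sub>v v = 0\<^sub>v ?d}"
  have "invariant_subspace G \<tau> U"
    unfolding invariant_subspace_def
  proof (intro conjI ballI allI)
    show "0\<^sub>v ?e \<in> U" using T by (auto simp: U_def)
    show "u + v \<in> U" if "u \<in> U" "v \<in> U" for u v
      using that T by (auto simp: U_def mult_add_distrib_mat_vec)
    show "c \<cdot>\<^sub>v u \<in> U" if "u \<in> U" for u c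
      using that T by (auto simp: U_def mult_mat_vec)
    show "\<tau> g *\<^sub>v u \<in> U" if g: "g \<in> carrier G" and u: "u \<in> U" for g u
    proof -
      have u': "u \<in> carrier_vec ?e" "T *\<^sub>v u = 0\<^sub>v ?d" using u by (auto simp: U_def)
      have "T *\<^sub>v (\<tau> g *\<^sub>v u) = (T * \<tau> g) *\<^sub>v u"
        using assoc_mult_mat_vec[OF T \<tau>g[OF g] u'(1)] by simp
      also have "\<dots> = \<rho> g *\<^sub>v (T *\<^sub>v u)"
        unfolding inter[OF g, symmetric] by (rule assoc_mult_mat_vec[OF \<rho>g[OF g] T u'(1)])
      also have "\<dots> = 0\<^sub>v ?d" using u'(2) \<rho>g[OF g] by (auto)
      finally show ?thesis using u' \<tau>g[OF g] by (auto simp: U_def)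
    qed
  qed (auto simp: U_def)
  then have "U = {0\<^sub>v ?e} \<or> U = carrier_vec ?e" using irr by (auto simp: irreducible_rep_def)
  moreover have "U \<noteq> carrier_vec ?e"
  proof
    assume "U = carrier_vec ?e"
    then have "unit_vec ?e 0 \<in> U" by simp
    then have "T *\<^sub>v unit_vec ?e 0 = 0\<^sub>v ?d" unfolding U_def by blast
    moreover have "(T *\<^sub>v unit_vec ?e 0) $ i = T $$ (i, 0)" using T ij \<tau>(2) by simp
    ultimately have "T $$ (i, 0) = 0" using ij by simp
    then show False using ne ij \<tau>(2) by (simp add: T_def)
  qed
  ultimately have "U = {0\<^sub>v ?e}" by blast
  then show "contains_rep G \<rho> \<tau>"
    unfolding contains_rep_def using T inter by (intro bexI[of _ T]) (auto simp: U_def)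
qed

end

section \<open>Tensor products and direct sums\<close>

lemma sum_div_mod:
  fixes f :: "nat \<Rightarrow> nat \<Rightarrow> complex"
  shows
  "(\<Sum>k<n * q. f (k div q) (k mod q)) = (\<Sum>i<n. \<Sum>j<q. f i j)"
proof (cases "q = 0")
  case False
  have bound: "i * q + j < n * q" if "i < n" "j < q" for i j
  proof -
    have "i * q + j < Suc i * q" using that by simp
    also have "\<dots> \<le> n * q" using that by (intro mult_le_mono1) simp
    finally show ?thesis .
  qed
  have "(\<Sum>i<n. \<Sum>j<q. f i j) = (\<Sum>(i, j)\<in>{..<n} \<times> {..<q}. f i j)"
    by (simp add: sum.cartesian_product)
  also have "\<dots> = (\<Sum>k<n * q. f (k div q) (k mod q))"
    using False bound
    by (intro sum.reindex_bij_witness[where j = "\<lambda>(i, j). i * q + j" and i = "\<lambda>k. (k div q, k mod q)"])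
       (auto simp: less_mult_imp_div_less)
  finally show ?thesis by simp
qed simp

lemma kronecker_carrier:
  "A \<in> carrier_mat m n \<Longrightarrow> B \<in> carrier_mat p q \<Longrightarrow> kronecker A B \<in> carrier_mat (m * p) (n * q)"
  by (auto simp: kronecker_def)

lemma kronecker_entry:
  assumes "A \<in> carrier_mat m n" "B \<in> carrier_mat p q" "i < m * p" "j < n * q"
  shows "kronecker A B $$ (i, j) = A $$ (i div p, j div q) * B $$ (i mod p, j mod q)"
  using assms by (auto simp: kronecker_def)

lemma kronecker_mult:
  assumes A: "A \<in> carrier_mat m n" and C: "C \<in> carrier_mat n r"
    and B: "B \<in> carrier_mat p q" and D: "D \<in> carrier_mat q s"
  shows "kronecker (A * C) (B * D) = kronecker A B * kronecker C D"
proof (rule eq_matI)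
  fix i j assume "i < dim_row (kronecker A B * kronecker C D)" "j < dim_col (kronecker A B * kronecker C D)"
  then have ij: "i < m * p" "j < r * s" using A B C D by (auto simp: kronecker_def)
  then have idx: "i div p < m" "i mod p < p" "j div s < r" "j mod s < s"
    by (auto simp: less_mult_imp_div_less) (metis mod_less_divisor mult_0_right not_gr_zero not_less_zero)+
  have "(kronecker A B * kronecker C D) $$ (i, j) =
      (\<Sum>k<n * q. (A $$ (i div p, k div q) * C $$ (k div q, j div s)) * (B $$ (i mod p, k mod q) * D $$ (k mod q, j mod s)))"
    unfolding mult_mat_entry[OF kronecker_carrier[OF A B] kronecker_carrier[OF C D] ij]
    using ij by (intro sum.cong) (auto simp: kronecker_entry[OF A B] kronecker_entry[OF C D])
  also have "\<dots> = (\<Sum>k<n. \<Sum>l<q. (A $$ (i div p, k) * C $$ (k, j div s)) * (B $$ (i mod p, l) * D $$ (l, j mod s)))"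
    by (rule sum_div_mod)
  also have "\<dots> = (A * C) $$ (i div p, j div s) * (B * D) $$ (i mod p, j mod s)"
    by (simp only: mult_mat_entry[OF A C idx(1,3)] mult_mat_entry[OF B D idx(2,4)] sum_product)
  also have "\<dots> = kronecker (A * C) (B * D) $$ (i, j)"
    using kronecker_entry[OF mult_carrier_mat[OF A C] mult_carrier_mat[OF B D] ij] by simp
  finally show "kronecker (A * C) (B * D) $$ (i, j) = (kronecker A B * kronecker C D) $$ (i, j)" ..
qed (use assms in \<open>auto simp: kronecker_def\<close>)

lemma kronecker_one: "kronecker (1\<^sub>m m) (1\<^sub>m p) = 1\<^sub>m (m * p)"
proof (rule eq_matI)
  fix i j assume "i < dim_row (1\<^sub>m (m * p) :: complex mat)" "j < dim_col (1\<^sub>m (m * p) :: complex mat)"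
  then have ij: "i < m * p" "j < m * p" by auto
  then have idx: "i div p < m" "i mod p < p" "j div p < m" "j mod p < p"
    by (auto simp: less_mult_imp_div_less) (metis mod_less_divisor mult_0_right not_gr_zero not_less_zero)+
  have "i = j \<longleftrightarrow> i div p = j div p \<and> i mod p = j mod p" by (metis div_mult_mod_eq)
  then show "kronecker (1\<^sub>m m) (1\<^sub>m p) $$ (i, j) = (1\<^sub>m (m * p) :: complex mat) $$ (i, j)"
    using ij idx by (auto simp: kronecker_def)
qed (auto simp: kronecker_def)

definition uniform_dim :: "('g, 'm) monoid_scheme \<Rightarrow> ('g \<Rightarrow> complex mat) \<Rightarrow> bool" where
  "uniform_dim G \<rho> \<longleftrightarrow> (\<forall>g\<in>carrier G. \<rho> g \<in> carrier_mat (rep_dim G \<rho>) (rep_dim G \<rho>))"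

lemma is_rep_uniform_dim: "is_rep G \<rho> \<Longrightarrow> uniform_dim G \<rho>"
  by (simp add: is_rep_def uniform_dim_def)

definition product_span :: "('a \<Rightarrow> complex) set \<Rightarrow> ('a \<Rightarrow> complex) set \<Rightarrow> ('a \<Rightarrow> complex) set" where
  "product_span U V = cfun.span {f * g |f g. f \<in> U \<and> g \<in> V}"

lemma product_span_in: "f \<in> U \<Longrightarrow> g \<in> V \<Longrightarrow> f * g \<in> product_span U V"
  unfolding product_span_def by (rule cfun.span_base) blast

lemma product_span_subspace: "cfun.subspace (product_span U V)"
  by (simp add: product_span_def cfun.subspace_span)

lemma span_bilinear:
  fixes M :: "('a \<Rightarrow> complex) \<Rightarrow> ('b \<Rightarrow> complex) \<Rightarrow> ('c \<Rightarrow> complex)"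
  assumes J: "cfun.subspace J" and gen: "\<And>f g. f \<in> A \<Longrightarrow> g \<in> B \<Longrightarrow> M f g \<in> J"
    and lin: "\<And>f f' g. M (f + f') g = M f g + M f' g" "\<And>c f g. M (\<lambda>x. c * f x) g = (\<lambda>x. c * M f g x)"
      "\<And>f g g'. M f (g + g') = M f g + M f g'" "\<And>c f g. M f (\<lambda>x. c * g x) = (\<lambda>x. c * M f g x)"
    and f: "f \<in> cfun.span A" and g: "g \<in> cfun.span B"
  shows "M f g \<in> J"
proof -
  have "M a g \<in> J" if "a \<in> A" for a
    by (rule span_linear_image[where L = "M a", OF g J gen[OF that] lin(3,4)])
  then show ?thesis
    by (rule span_linear_image[where L = "\<lambda>f. M f g", OF f J _ lin(1,2)])
qed

lemma product_span_of_spans: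
  assumes J: "cfun.subspace J" and gen: "\<And>f g. f \<in> A \<Longrightarrow> g \<in> B \<Longrightarrow> f * g \<in> J"
  shows "product_span (cfun.span A) (cfun.span B) \<subseteq> J"
  unfolding product_span_def
proof (rule cfun.span_minimal[OF _ J], safe)
  fix f g assume "f \<in> cfun.span A" "g \<in> cfun.span B"
  then show "f * g \<in> J"
    by (intro span_bilinear[where M = "(*)", OF J gen]) (auto simp: fun_eq_iff algebra_simps)
qed

lemma rep_dim_tensor: "rep_dim G (tensor_rep \<rho> \<tau>) = rep_dim G \<rho> * rep_dim G \<tau>"
  by (simp add: rep_dim_def tensor_rep_def kronecker_def)

lemma uniform_dim_tensor:
  "uniform_dim G \<rho> \<Longrightarrow> uniform_dim G \<tau> \<Longrightarrow> uniform_dim G (tensor_rep \<rho> \<tau>)"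
  unfolding uniform_dim_def rep_dim_tensor unfolding tensor_rep_def by (auto intro: kronecker_carrier)

lemma (in group) is_rep_tensor:
  assumes "is_rep G \<rho>" "is_rep G \<tau>"
  shows "is_rep G (tensor_rep \<rho> \<tau>)"
  unfolding is_rep_def
proof (intro conjI ballI)
  let ?d = "rep_dim G \<rho>" and ?e = "rep_dim G \<tau>"
  have \<rho>: "\<And>g. g \<in> carrier G \<Longrightarrow> \<rho> g \<in> carrier_mat ?d ?d" "\<rho> \<one> = 1\<^sub>m ?d"
    "\<And>g h. g \<in> carrier G \<Longrightarrow> h \<in> carrier G \<Longrightarrow> \<rho> (g \<otimes> h) = \<rho> g * \<rho> h"
    using assms(1) by (auto simp: is_rep_def)
  have \<tau>: "\<And>g. g \<in> carrier G \<Longrightarrow> \<tau> g \<in> carrier_mat ?e ?e" "\<tau> \<one> = 1\<^sub>m ?e"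
    "\<And>g h. g \<in> carrier G \<Longrightarrow> h \<in> carrier G \<Longrightarrow> \<tau> (g \<otimes> h) = \<tau> g * \<tau> h"
    using assms(2) by (auto simp: is_rep_def)
  show "tensor_rep \<rho> \<tau> \<one> = 1\<^sub>m (rep_dim G (tensor_rep \<rho> \<tau>))"
    unfolding rep_dim_tensor by (simp only: tensor_rep_def \<rho>(2) \<tau>(2) kronecker_one)
  fix g assume g: "g \<in> carrier G"
  show "tensor_rep \<rho> \<tau> g \<in> carrier_mat (rep_dim G (tensor_rep \<rho> \<tau>)) (rep_dim G (tensor_rep \<rho> \<tau>))"
    unfolding rep_dim_tensor unfolding tensor_rep_def by (rule kronecker_carrier[OF \<rho>(1)[OF g] \<tau>(1)[OF g]])
  fix h assume h: "h \<in> carrier G"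
  show "tensor_rep \<rho> \<tau> (g \<otimes> h) = tensor_rep \<rho> \<tau> g * tensor_rep \<rho> \<tau> h"
    unfolding tensor_rep_def \<rho>(3)[OF g h] \<tau>(3)[OF g h]
    by (rule kronecker_mult[OF \<rho>(1)[OF g] \<rho>(1)[OF h] \<tau>(1)[OF g] \<tau>(1)[OF h]])
qed

lemma coeffs_tensor:
  assumes "uniform_dim G \<rho>" "uniform_dim G \<tau>"
  shows "coeffs G (tensor_rep \<rho> \<tau>) = product_span (coeffs G \<rho>) (coeffs G \<tau>)"
proof
  let ?d = "rep_dim G \<rho>" and ?e = "rep_dim G \<tau>"
  have entry: "tensor_rep \<rho> \<tau> g $$ (i, j) = \<rho> g $$ (i div ?e, j div ?e) * \<tau> g $$ (i mod ?e, j mod ?e)"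
    if "g \<in> carrier G" "i < ?d * ?e" "j < ?d * ?e" for g i j
    using that assms unfolding tensor_rep_def uniform_dim_def by (intro kronecker_entry) auto
  show "coeffs G (tensor_rep \<rho> \<tau>) \<subseteq> product_span (coeffs G \<rho>) (coeffs G \<tau>)"
    unfolding coeffs_def[of G "tensor_rep \<rho> \<tau>"] rep_dim_tensor
  proof (rule cfun.span_minimal[OF _ product_span_subspace], safe)
    fix i j assume ij: "i < ?d * ?e" "j < ?d * ?e"
    then have "0 < ?e" by (cases ?e) auto
    have "(\<lambda>g. if g \<in> carrier G then tensor_rep \<rho> \<tau> g $$ (i, j) else 0) =
       (\<lambda>g. if g \<in> carrier G then \<rho> g $$ (i div ?e, j div ?e) else 0) *
       (\<lambda>g. if g \<in> carrier G then \<tau> g $$ (i mod ?e, j mod ?e) else 0)"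
      using ij by (auto simp: fun_eq_iff entry)
    also have "\<dots> \<in> product_span (coeffs G \<rho>) (coeffs G \<tau>)"
      using ij \<open>0 < ?e\<close> by (intro product_span_in coeffs_entry) (auto simp: less_mult_imp_div_less)
    finally show "(\<lambda>g. if g \<in> carrier G then tensor_rep \<rho> \<tau> g $$ (i, j) else 0) \<in> product_span (coeffs G \<rho>) (coeffs G \<tau>)" .
  qed
  show "product_span (coeffs G \<rho>) (coeffs G \<tau>) \<subseteq> coeffs G (tensor_rep \<rho> \<tau>)"
    unfolding coeffs_def[of G \<rho>] coeffs_def[of G \<tau>]
  proof (rule product_span_of_spans[OF coeffs_subspace], safe)
    fix i j k l assume ij: "i < ?d" "j < ?d" "k < ?e" "l < ?e"
    have bound: "a * ?e + b < ?d * ?e" if "a < ?d" "b < ?e" for a b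
    proof -
      have "a * ?e + b < Suc a * ?e" using that by simp
      also have "\<dots> \<le> ?d * ?e" using that by (intro mult_le_mono1) simp
      finally show ?thesis .
    qed
    have "(\<lambda>g. if g \<in> carrier G then \<rho> g $$ (i, j) else 0) * (\<lambda>g. if g \<in> carrier G then \<tau> g $$ (k, l) else 0) =
      (\<lambda>g. if g \<in> carrier G then tensor_rep \<rho> \<tau> g $$ (i * ?e + k, j * ?e + l) else 0)"
      using ij bound by (auto simp: fun_eq_iff entry)
    also have "\<dots> \<in> coeffs G (tensor_rep \<rho> \<tau>)"
      using ij bound by (intro coeffs_entry) (auto simp: rep_dim_tensor)
    finally show "(\<lambda>g. if g \<in> carrier G then \<rho> g $$ (i, j) else 0) * (\<lambda>g. if g \<in> carrier G then \<tau> g $$ (k, l) else 0)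
      \<in> coeffs G (tensor_rep \<rho> \<tau>)" .
  qed
qed

lemma direct_sum_list_Cons:
  "direct_sum_list (\<rho> # \<rho>s) g = four_block_mat (\<rho> g) (0\<^sub>m (dim_row (\<rho> g)) (dim_col (direct_sum_list \<rho>s g)))
     (0\<^sub>m (dim_row (direct_sum_list \<rho>s g)) (dim_col (\<rho> g))) (direct_sum_list \<rho>s g)"
  by (simp add: direct_sum_list_def Let_def)

lemma rep_dim_direct_sum_list: "rep_dim G (direct_sum_list \<rho>s) = (\<Sum>\<rho>\<leftarrow>\<rho>s. rep_dim G \<rho>)"
  by (simp add: rep_dim_def direct_sum_list_def dim_diag_block_mat comp_def)

lemma uniform_dim_direct_sum_list:
  assumes "\<forall>\<rho>\<in>set \<rho>s. uniform_dim G \<rho>"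
  shows "uniform_dim G (direct_sum_list \<rho>s)"
  unfolding uniform_dim_def rep_dim_direct_sum_list
proof
  fix g assume "g \<in> carrier G"
  then have "map (\<lambda>\<rho>. dim_row (\<rho> g)) \<rho>s = map (rep_dim G) \<rho>s" "map (\<lambda>\<rho>. dim_col (\<rho> g)) \<rho>s = map (rep_dim G) \<rho>s"
    using assms by (auto simp: uniform_dim_def)
  then show "direct_sum_list \<rho>s g \<in> carrier_mat (\<Sum>\<rho>\<leftarrow>\<rho>s. rep_dim G \<rho>) (\<Sum>\<rho>\<leftarrow>\<rho>s. rep_dim G \<rho>)"
    by (simp only: carrier_mat_def direct_sum_list_def dim_diag_block_mat list.map_comp comp_def mem_Collect_eq)
qed

lemma (in group) is_rep_direct_sum_list:
  assumes "\<forall>\<rho>\<in>set \<rho>s. is_rep G \<rho>"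
  shows "is_rep G (direct_sum_list \<rho>s)"
  using assms
proof (induction \<rho>s)
  case Nil
  then show ?case by (auto simp: is_rep_def direct_sum_list_def rep_dim_def)
next
  case (Cons \<rho> \<rho>s)
  let ?\<tau> = "direct_sum_list \<rho>s"
  let ?d = "rep_dim G \<rho>" and ?e = "rep_dim G ?\<tau>"
  have dim: "rep_dim G (direct_sum_list (\<rho> # \<rho>s)) = ?d + ?e" by (simp add: rep_dim_direct_sum_list)
  have \<rho>: "\<And>g. g \<in> carrier G \<Longrightarrow> \<rho> g \<in> carrier_mat ?d ?d" "\<rho> \<one> = 1\<^sub>m ?d"
    "\<And>g h. g \<in> carrier G \<Longrightarrow> h \<in> carrier G \<Longrightarrow> \<rho> (g \<otimes> h) = \<rho> g * \<rho> h"
    using Cons.prems by (auto simp: is_rep_def)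
  have \<tau>: "\<And>g. g \<in> carrier G \<Longrightarrow> ?\<tau> g \<in> carrier_mat ?e ?e" "?\<tau> \<one> = 1\<^sub>m ?e"
    "\<And>g h. g \<in> carrier G \<Longrightarrow> h \<in> carrier G \<Longrightarrow> ?\<tau> (g \<otimes> h) = ?\<tau> g * ?\<tau> h"
    using Cons by (auto simp: is_rep_def)
  have block: "direct_sum_list (\<rho> # \<rho>s) g = four_block_mat (\<rho> g) (0\<^sub>m ?d ?e) (0\<^sub>m ?e ?d) (?\<tau> g)"
    if "g \<in> carrier G" for g
    using \<rho>(1)[OF that] \<tau>(1)[OF that] by (simp add: direct_sum_list_Cons)
  show ?case
    unfolding is_rep_def dim
  proof (intro conjI ballI)
    show "direct_sum_list (\<rho> # \<rho>s) \<one> = 1\<^sub>m (?d + ?e)"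
      by (simp add: block \<rho>(2) \<tau>(2))
    fix g assume g: "g \<in> carrier G"
    show "direct_sum_list (\<rho> # \<rho>s) g \<in> carrier_mat (?d + ?e) (?d + ?e)"
      unfolding block[OF g] using \<rho>(1)[OF g] \<tau>(1)[OF g] by (rule four_block_carrier_mat)
    fix h assume h: "h \<in> carrier G"
    have "direct_sum_list (\<rho> # \<rho>s) g * direct_sum_list (\<rho> # \<rho>s) h =
      four_block_mat (\<rho> g * \<rho> h + 0\<^sub>m ?d ?e * 0\<^sub>m ?e ?d) (\<rho> g * 0\<^sub>m ?d ?e + 0\<^sub>m ?d ?e * ?\<tau> h)
        (0\<^sub>m ?e ?d * \<rho> h + ?\<tau> g * 0\<^sub>m ?e ?d) (0\<^sub>m ?e ?d * 0\<^sub>m ?d ?e + ?\<tau> g * ?\<tau> h)"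
      unfolding block[OF g] block[OF h]
      using \<rho>(1)[OF g] \<tau>(1)[OF g] \<rho>(1)[OF h] \<tau>(1)[OF h] by (intro mult_four_block_mat) auto
    also have "\<dots> = direct_sum_list (\<rho> # \<rho>s) (g \<otimes> h)"
      using \<rho>(1)[OF g] \<tau>(1)[OF g] \<rho>(1)[OF h] \<tau>(1)[OF h] g h by (simp add: block \<rho>(3) \<tau>(3))
    finally show "direct_sum_list (\<rho> # \<rho>s) (g \<otimes> h) = direct_sum_list (\<rho> # \<rho>s) g * direct_sum_list (\<rho> # \<rho>s) h" ..
  qed
qed

lemma coeffs_direct_sum_list:
  assumes "\<forall>\<rho>\<in>set \<rho>s. uniform_dim G \<rho>"
  shows "coeffs G (direct_sum_list \<rho>s) = cfun.span (\<Union>\<rho>\<in>set \<rho>s. coeffs G \<rho>)"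
  using assms
proof (induction \<rho>s)
  case Nil
  have "rep_dim G (direct_sum_list []) = 0" by (simp add: rep_dim_direct_sum_list)
  then show ?case by (simp add: coeffs_def)
next
  case (Cons \<rho> \<rho>s)
  let ?\<tau> = "direct_sum_list \<rho>s"
  let ?d = "rep_dim G \<rho>" and ?e = "rep_dim G ?\<tau>"
  let ?E = "\<lambda>\<rho> i j g. if g \<in> carrier G then \<rho> g $$ (i, j) else (0::complex)"
  have dim: "rep_dim G (direct_sum_list (\<rho> # \<rho>s)) = ?d + ?e" by (simp add: rep_dim_direct_sum_list)
  have dims: "\<rho> g \<in> carrier_mat ?d ?d" "?\<tau> g \<in> carrier_mat ?e ?e" if "g \<in> carrier G" for g
    using Cons.prems uniform_dim_direct_sum_list[of \<rho>s G] that by (auto simp: uniform_dim_def)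
  have entry: "direct_sum_list (\<rho> # \<rho>s) g $$ (i, j) = (if i < ?d then if j < ?d then \<rho> g $$ (i, j) else 0
      else if j < ?d then 0 else ?\<tau> g $$ (i - ?d, j - ?d))"
    if "g \<in> carrier G" "i < ?d + ?e" "j < ?d + ?e" for g i j
    using dims[OF that(1)] that(2,3) by (auto simp: direct_sum_list_Cons)
  let ?S = "cfun.span (\<Union>\<rho>\<in>set (\<rho> # \<rho>s). coeffs G \<rho>)"
  have IH: "coeffs G ?\<tau> = cfun.span (\<Union>\<rho>\<in>set \<rho>s. coeffs G \<rho>)" using Cons by simp
  have "coeffs G \<rho> \<subseteq> (\<Union>\<rho>\<in>set (\<rho> # \<rho>s). coeffs G \<rho>)" by simp
  then have sub1: "coeffs G \<rho> \<subseteq> ?S" using cfun.span_superset by (rule order_trans)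
  have sub2: "coeffs G ?\<tau> \<subseteq> ?S" unfolding IH by (rule cfun.span_mono) auto
  note sub = sub1 sub2
  have "coeffs G (direct_sum_list (\<rho> # \<rho>s)) \<subseteq> ?S"
    unfolding coeffs_def[of G "direct_sum_list (\<rho> # \<rho>s)"] dim
  proof (rule cfun.span_minimal[OF _ cfun.subspace_span], safe)
    fix i j assume ij: "i < ?d + ?e" "j < ?d + ?e"
    consider "i < ?d" "j < ?d" | "\<not> i < ?d" "\<not> j < ?d" | "(i < ?d) \<noteq> (j < ?d)" by blast
    then show "?E (direct_sum_list (\<rho> # \<rho>s)) i j \<in> ?S"
    proof cases
      case 1
      then have "?E (direct_sum_list (\<rho> # \<rho>s)) i j = ?E \<rho> i j" using ij by (auto simp: entry fun_eq_iff)
      moreover have "?E \<rho> i j \<in> coeffs G \<rho>" using 1 by (intro coeffs_entry) auto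
      ultimately show ?thesis using sub by auto
    next
      case 2
      then have "?E (direct_sum_list (\<rho> # \<rho>s)) i j = ?E ?\<tau> (i - ?d) (j - ?d)"
        using ij by (auto simp: entry fun_eq_iff)
      moreover have "?E ?\<tau> (i - ?d) (j - ?d) \<in> coeffs G ?\<tau>" using 2 ij by (intro coeffs_entry) auto
      ultimately show ?thesis using sub by auto
    next
      case 3
      then have "?E (direct_sum_list (\<rho> # \<rho>s)) i j = 0" using ij by (auto simp: entry fun_eq_iff)
      then show ?thesis using cfun.span_zero by simp
    qed
  qed
  moreover have "coeffs G \<rho> \<subseteq> coeffs G (direct_sum_list (\<rho> # \<rho>s))"
    unfolding coeffs_def[of G \<rho>]
  proof (rule cfun.span_minimal[OF _ coeffs_subspace], safe)
    fix i j assume ij: "i < ?d" "j < ?d"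
    then have "?E \<rho> i j = ?E (direct_sum_list (\<rho> # \<rho>s)) i j" by (auto simp: entry fun_eq_iff)
    then show "?E \<rho> i j \<in> coeffs G (direct_sum_list (\<rho> # \<rho>s))"
      using ij coeffs_entry[of i G "direct_sum_list (\<rho> # \<rho>s)" j] dim by simp
  qed
  moreover have "coeffs G ?\<tau> \<subseteq> coeffs G (direct_sum_list (\<rho> # \<rho>s))"
    unfolding coeffs_def[of G ?\<tau>]
  proof (rule cfun.span_minimal[OF _ coeffs_subspace], safe)
    fix i j assume ij: "i < ?e" "j < ?e"
    then have "?E ?\<tau> i j = ?E (direct_sum_list (\<rho> # \<rho>s)) (?d + i) (?d + j)" by (auto simp: entry fun_eq_iff)
    then show "?E ?\<tau> i j \<in> coeffs G (direct_sum_list (\<rho> # \<rho>s))"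
      using ij coeffs_entry[of "?d + i" G "direct_sum_list (\<rho> # \<rho>s)" "?d + j"] dim by simp
  qed
  then have "(\<Union>\<rho>\<in>set \<rho>s. coeffs G \<rho>) \<subseteq> coeffs G (direct_sum_list (\<rho> # \<rho>s))"
    unfolding IH using cfun.span_superset by (rule order_trans[rotated])
  then have "?S \<subseteq> coeffs G (direct_sum_list (\<rho> # \<rho>s))"
    using \<open>coeffs G \<rho> \<subseteq> coeffs G (direct_sum_list (\<rho> # \<rho>s))\<close>
    by (intro cfun.span_minimal[OF _ coeffs_subspace]) auto
  ultimately show ?case by blast
qed

section \<open>Left ideals of the group algebra\<close>

context fin_group
begin

lemma left_ideal_mult:
  assumes "h \<in> carrier G"
  shows "flip G (translate G \<one> h (group_algebra_mult G x c)) =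
    (\<lambda>g. \<Sum>u\<in>carrier G. x u * translate G (inv h) u (flip G c) g)"
  using assms
  by (auto simp: fun_eq_iff flip_def translate_def group_algebra_mult_def inv_mult_group m_assoc intro!: sum.cong)

lemma left_translate_ideal:
  assumes "y \<in> carrier G" "c \<in> supported_on (carrier G)"
  shows "left_translate G y c = group_algebra_mult G (\<lambda>g. if g = y then 1 else 0) c"
proof
  fix g
  have "(\<Sum>h\<in>carrier G. (if h = y then 1 else 0) * c (inv h \<otimes> g)) = (\<Sum>h\<in>carrier G. if h = y then c (inv h \<otimes> g) else 0)"
    by (intro sum.cong) auto
  then show "left_translate G y c g = group_algebra_mult G (\<lambda>g. if g = y then 1 else 0) c g"
    using assms fin by (simp add: left_translate_def group_algebra_mult_def)
qed

lemma left_invariant_left_ideal: "left_invariant G (range (\<lambda>x. group_algebra_mult G x c))"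
  unfolding left_invariant_def
proof (intro conjI ballI)
  let ?m = "\<lambda>x. group_algebra_mult G x c"
  show "cfun.subspace (range ?m)"
  proof (rule cfun.subspaceI)
    have "?m 0 = 0" by (simp add: fun_eq_iff group_algebra_mult_def)
    then show "0 \<in> range ?m" by (metis rangeI)
  next
    fix f f' assume "f \<in> range ?m" "f' \<in> range ?m"
    then obtain x x' where "f = ?m x" "f' = ?m x'" by blast
    then have "f + f' = ?m (x + x')"
      by (auto simp: fun_eq_iff group_algebra_mult_def sum.distrib algebra_simps)
    then show "f + f' \<in> range ?m" by blast
  next
    fix f k assume "f \<in> range ?m"
    then obtain x where "f = ?m x" by blast
    then have "(\<lambda>g. k * f g) = ?m (\<lambda>g. k * x g)"
      by (auto simp: fun_eq_iff group_algebra_mult_def sum_distrib_left algebra_simps)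
    then show "(\<lambda>g. k * f g) \<in> range ?m" by blast
  qed
  show "range ?m \<subseteq> supported_on (carrier G)"
    by (auto simp: supported_on_def group_algebra_mult_def)
  fix g v assume g: "g \<in> carrier G" and "v \<in> range ?m"
  then obtain x where v: "v = ?m x" by blast
  have "left_translate G g v = ?m (\<lambda>u. x (inv g \<otimes> u))"
  proof
    fix h
    show "left_translate G g v h = ?m (\<lambda>u. x (inv g \<otimes> u)) h"
    proof (cases "h \<in> carrier G")
      case True
      have "(\<Sum>u\<in>carrier G. x u * c (inv u \<otimes> (inv g \<otimes> h))) =
          (\<Sum>u\<in>carrier G. x (inv g \<otimes> u) * c (inv (inv g \<otimes> u) \<otimes> (inv g \<otimes> h)))"
        using g by (intro sum_shift_left[symmetric, where f = "\<lambda>u. x u * c (inv u \<otimes> (inv g \<otimes> h))"]) simp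
      also have "\<dots> = (\<Sum>u\<in>carrier G. x (inv g \<otimes> u) * c (inv u \<otimes> h))"
      proof (rule sum.cong[OF refl])
        fix u assume u: "u \<in> carrier G"
        have "inv (inv g \<otimes> u) \<otimes> (inv g \<otimes> h) = inv u \<otimes> (g \<otimes> (inv g \<otimes> h))"
          using g u True by (simp add: inv_mult_group m_assoc)
        also have "g \<otimes> (inv g \<otimes> h) = h" using g True by (simp add: m_assoc[symmetric])
        finally show "x (inv g \<otimes> u) * c (inv (inv g \<otimes> u) \<otimes> (inv g \<otimes> h)) = x (inv g \<otimes> u) * c (inv u \<otimes> h)" by simp
      qed
      finally show ?thesis using True g by (simp add: v left_translate_def group_algebra_mult_def)
    qed (simp add: left_translate_def group_algebra_mult_def)
  qed
  then show "left_translate G g v \<in> range ?m" by blast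
qed

text \<open>The coefficients come from the two-sided ideal generated by \<open>c\<close>: left translations sweep out the
left ideal, and evaluation at an arbitrary point acts as a right translation.\<close>

lemma coeffs_left_ideal:
  assumes c: "c \<in> supported_on (carrier G)"
    and \<rho>: "matrix_form_of_ideal G (range (\<lambda>x. group_algebra_mult G x c)) \<rho>"
  shows "coeffs G \<rho> = two_sided_span G (flip G c)"
  unfolding coeffs_matrix_form[OF left_invariant_left_ideal \<rho>]
proof
  show "cfun.span {flip G (translate G \<one> h v) |v h. v \<in> range (\<lambda>x. group_algebra_mult G x c) \<and> h \<in> carrier G}
      \<subseteq> two_sided_span G (flip G c)"
  proof (rule cfun.span_minimal, safe)
    fix h x assume h: "h \<in> carrier G"
    show "flip G (translate G \<one> h (group_algebra_mult G x c)) \<in> two_sided_span G (flip G c)"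
      unfolding left_ideal_mult[OF h] two_sided_span_def
    proof (intro subspace_sum_scaled cfun.subspace_span cfun.span_base CollectI exI conjI)
      show "translate G (inv h) u (flip G c) = translate G (inv h) u (flip G c)" for u ..
    qed (use h in auto)
  qed (simp add: two_sided_span_def)
  show "two_sided_span G (flip G c) \<subseteq>
      cfun.span {flip G (translate G \<one> h v) |v h. v \<in> range (\<lambda>x. group_algebra_mult G x c) \<and> h \<in> carrier G}"
    unfolding two_sided_span_def
  proof (rule cfun.span_minimal[OF _ cfun.subspace_span], safe)
    fix x y assume xy: "x \<in> carrier G" "y \<in> carrier G"
    have "translate G x y (flip G c) = flip G (translate G \<one> (inv x) (left_translate G y c))"
      using xy by (auto simp: fun_eq_iff translate_def flip_def left_translate_def inv_mult_group m_assoc)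
    moreover have "left_translate G y c \<in> range (\<lambda>x. group_algebra_mult G x c)"
      unfolding left_translate_ideal[OF xy(2) c] by (rule rangeI)
    ultimately show "translate G x y (flip G c) \<in>
        cfun.span {flip G (translate G \<one> h v) |v h. v \<in> range (\<lambda>x. group_algebra_mult G x c) \<and> h \<in> carrier G}"
      using xy(1) by (intro cfun.span_base CollectI exI[of _ "left_translate G y c"] exI[of _ "inv x"]) auto
  qed
qed

end

section \<open>Young symmetrizers of tableaux\<close>

(* Keeps {1..n} from being rewritten to {Suc 0..n}. *)
declare One_nat_def [simp del]

lemma sym_group_fin: "fin_group (sym_group n)"
proof -
  interpret group "sym_group n" by (rule sym_group_is_group)
  show ?thesis
    by unfold_locales (simp add: sym_group_def finite_permutations)
qed

lemma sym_group_simps: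
  "p \<in> carrier (sym_group n) \<longleftrightarrow> p permutes {1..n}" "\<one>\<^bsub>sym_group n\<^esub> = id"
  "p \<otimes>\<^bsub>sym_group n\<^esub> q = p \<circ> q" "p permutes {1..n} \<Longrightarrow> inv\<^bsub>sym_group n\<^esub> p = inv' p"
  by (simp_all add: sym_group_carrier sym_group_mult sym_group_one)

lemma sym_group_carrier_eq: "carrier (sym_group n) = {p. p permutes {1..n}}"
  by (simp add: sym_group_def)

lemma translate_sym: "g permutes {1..n} \<Longrightarrow> translate (sym_group n) x y f g = f (x \<circ> g \<circ> y)"
  by (simp add: translate_def sym_group_simps)

lemma flip_sym: "g permutes {1..n} \<Longrightarrow> flip (sym_group n) f g = f (inv' g)"
  by (simp add: flip_def sym_group_simps)

text \<open>A tableau with entries \<open>1, \<dots>, n\<close> is given by two functions, the row and the column of each entry.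
Its row group and its column group are the groups of permutations that preserve these functions.\<close>

definition fiber_perms :: "nat \<Rightarrow> (nat \<Rightarrow> 'a) \<Rightarrow> (nat \<Rightarrow> nat) set" where
  "fiber_perms n r = {p. p permutes {1..n} \<and> (\<forall>i\<in>{1..n}. r (p i) = r i)}"

definition fiber_sign :: "nat \<Rightarrow> (nat \<Rightarrow> 'a) \<Rightarrow> (nat \<Rightarrow> nat) \<Rightarrow> complex" where
  "fiber_sign n s q = (if q \<in> fiber_perms n s then of_int (sign q) else 0)"

text \<open>The Young symmetrizer of the tableau with rows \<open>r\<close> and columns \<open>s\<close>: the factor from the column
group is forced to be \<open>p\<inverse> \<circ> g\<close>, and the sum over the row group is invariant under \<open>p \<mapsto> p\<inverse>\<close>.\<close>

definition tableau_symmetrizer :: "nat \<Rightarrow> (nat \<Rightarrow> 'a) \<Rightarrow> (nat \<Rightarrow> 'b) \<Rightarrow> (nat \<Rightarrow> nat) \<Rightarrow> complex" where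
  "tableau_symmetrizer n r s g = (\<Sum>p\<in>fiber_perms n r. fiber_sign n s (p \<circ> g))"

definition tableau_space :: "nat \<Rightarrow> (nat \<Rightarrow> 'a) \<Rightarrow> (nat \<Rightarrow> 'b) \<Rightarrow> ((nat \<Rightarrow> nat) \<Rightarrow> complex) set" where
  "tableau_space n r s = two_sided_span (sym_group n) (tableau_symmetrizer n r s)"

lemma fiber_perms_permutes: "p \<in> fiber_perms n r \<Longrightarrow> p permutes {1..n}"
  by (simp add: fiber_perms_def)

lemma finite_fiber_perms [simp]: "finite (fiber_perms n r)"
  by (rule finite_subset[of _ "{p. p permutes {1..n}}"]) (auto simp: fiber_perms_def finite_permutations)

lemma fiber_perms_id [simp]: "id \<in> fiber_perms n r"
  by (simp add: fiber_perms_def permutes_id)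

lemma fiber_perms_comp: "p \<in> fiber_perms n r \<Longrightarrow> q \<in> fiber_perms n r \<Longrightarrow> p \<circ> q \<in> fiber_perms n r"
  using permutes_in_image[of q "{1..n}"] by (auto simp: fiber_perms_def permutes_compose)

lemma fiber_perms_inv: "p \<in> fiber_perms n r \<Longrightarrow> inv' p \<in> fiber_perms n r"
proof -
  assume p: "p \<in> fiber_perms n r"
  then have perm: "p permutes {1..n}" by (simp add: fiber_perms_def)
  have "r (inv' p i) = r i" if "i \<in> {1..n}" for i
  proof -
    have "inv' p i \<in> {1..n}" using permutes_inv[OF perm] that by (simp only: permutes_in_image)
    then have "r (p (inv' p i)) = r (inv' p i)" using p by (simp add: fiber_perms_def)
    then show ?thesis using permutes_inverses(1)[OF perm] by simp
  qed
  then show ?thesis using permutes_inv[OF perm] by (simp add: fiber_perms_def)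
qed

lemma fiber_perms_comp_right_iff:
  assumes "q \<in> fiber_perms n r" "g permutes {1..n}"
  shows "g \<circ> q \<in> fiber_perms n r \<longleftrightarrow> g \<in> fiber_perms n r"
proof
  assume "g \<circ> q \<in> fiber_perms n r"
  then have "(g \<circ> q) \<circ> inv' q \<in> fiber_perms n r" using assms(1) by (intro fiber_perms_comp[of "g \<circ> q"] fiber_perms_inv)
  also have "(g \<circ> q) \<circ> inv' q = g"
    unfolding comp_assoc permutes_inv_o(1)[OF fiber_perms_permutes[OF assms(1)]] by simp
  finally show "g \<in> fiber_perms n r" .
qed (use assms fiber_perms_comp in blast)

lemma perm_sign_comp:
  "p permutes {1..n::nat} \<Longrightarrow> q permutes {1..n} \<Longrightarrow> sign (p \<circ> q) = sign p * sign q"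
  by (intro sign_compose permutes_imp_permutation[of "{1..n}"]) auto

lemma perm_sign_inv: "p permutes {1..n::nat} \<Longrightarrow> sign (inv' p) = sign p"
  by (intro sign_inverse permutes_imp_permutation[of "{1..n}"]) auto

lemma sign_sq: "of_int (sign p) * of_int (sign p) = (1 :: complex)"
  by (simp add: sign_def)

lemma sum_fiber_perms_inv: "(\<Sum>p\<in>fiber_perms n r. f (inv' p)) = (\<Sum>p\<in>fiber_perms n r. f p)"
  by (rule sum.reindex_bij_witness[where i = "\<lambda>p. inv' p" and j = "\<lambda>p. inv' p"])
     (auto simp: fiber_perms_inv inv_inv_eq permutes_bij[OF fiber_perms_permutes])

lemma fiber_sign_supported: "\<not> g permutes {1..n} \<Longrightarrow> fiber_sign n s g = 0"
  by (simp add: fiber_sign_def fiber_perms_def)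

lemma fiber_sign_inv: "g permutes {1..n} \<Longrightarrow> fiber_sign n s (inv' g) = fiber_sign n s g"
  using fiber_perms_inv[of g n s] fiber_perms_inv[of "inv' g" n s]
  by (auto simp: fiber_sign_def perm_sign_inv inv_inv_eq permutes_bij)

lemma fiber_sign_comp_right:
  assumes "q \<in> fiber_perms n s" "g permutes {1..n}"
  shows "fiber_sign n s (g \<circ> q) = fiber_sign n s g * of_int (sign q)"
  unfolding fiber_sign_def fiber_perms_comp_right_iff[OF assms]
    perm_sign_comp[OF assms(2) fiber_perms_permutes[OF assms(1)]] by simp

lemma perm_comp_left_iff: "p permutes {1..n::nat} \<Longrightarrow> p \<circ> g permutes {1..n} \<longleftrightarrow> g permutes {1..n}"
proof
  assume p: "p permutes {1..n}" and pg: "p \<circ> g permutes {1..n}"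
  have "inv' p \<circ> (p \<circ> g) permutes {1..n}" using permutes_compose[OF pg permutes_inv[OF p]] .
  then show "g permutes {1..n}" using permutes_inv_o(2)[OF p] by (simp add: comp_assoc[symmetric])
qed (auto intro: permutes_compose)

lemma symmetrizer_supported: "tableau_symmetrizer n r s \<in> supported_on (carrier (sym_group n))"
proof -
  have "tableau_symmetrizer n r s g = 0" if "\<not> g permutes {1..n}" for g
    unfolding tableau_symmetrizer_def
  proof (rule sum.neutral, rule ballI)
    fix p assume "p \<in> fiber_perms n r"
    then have "\<not> (p \<circ> g) permutes {1..n}" using that perm_comp_left_iff fiber_perms_permutes by blast
    then show "fiber_sign n s (p \<circ> g) = 0" by (rule fiber_sign_supported)
  qed
  then show ?thesis by (auto simp: supported_on_def sym_group_simps)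
qed

lemma symmetrizer_comp_right:
  assumes "q \<in> fiber_perms n s" "g permutes {1..n}"
  shows "tableau_symmetrizer n r s (g \<circ> q) = tableau_symmetrizer n r s g * of_int (sign q)"
  unfolding tableau_symmetrizer_def sum_distrib_right
proof (rule sum.cong[OF refl])
  fix p assume "p \<in> fiber_perms n r"
  then show "fiber_sign n s (p \<circ> (g \<circ> q)) = fiber_sign n s (p \<circ> g) * of_int (sign q)"
    using fiber_sign_comp_right[OF assms(1), of "p \<circ> g"] assms(2)
    by (simp add: comp_assoc permutes_compose fiber_perms_permutes)
qed

lemma flip_symmetrizer:
  assumes "g permutes {1..n}"
  shows "flip (sym_group n) (tableau_symmetrizer n r s) g = (\<Sum>p\<in>fiber_perms n r. fiber_sign n s (g \<circ> p))"
proof -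
  have "tableau_symmetrizer n r s (inv' g) = (\<Sum>p\<in>fiber_perms n r. fiber_sign n s (inv' p \<circ> inv' g))"
    unfolding tableau_symmetrizer_def by (rule sum_fiber_perms_inv[symmetric])
  also have "\<dots> = (\<Sum>p\<in>fiber_perms n r. fiber_sign n s (g \<circ> p))"
  proof (rule sum.cong[OF refl])
    fix p assume "p \<in> fiber_perms n r"
    then have p: "p permutes {1..n}" by (rule fiber_perms_permutes)
    have "inv' p \<circ> inv' g = inv' (g \<circ> p)"
      using p assms by (simp add: o_inv_distrib permutes_bij)
    then show "fiber_sign n s (inv' p \<circ> inv' g) = fiber_sign n s (g \<circ> p)"
      using p assms by (simp add: fiber_sign_inv permutes_compose)
  qed
  finally show ?thesis using assms by (simp add: flip_sym)
qed

lemma sum_perms_shift: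
  assumes "p permutes {1..n::nat}"
  shows "(\<Sum>h | h permutes {1..n}. f (p \<circ> h)) = (\<Sum>h | h permutes {1..n}. f h)"
  using fin_group.sum_shift_left[OF sym_group_fin, of p n f] assms
  by (simp add: sym_group_def)

lemma sum_fiber_sign:
  "(\<Sum>h | h permutes {1..n}. fiber_sign n s h * f h) = (\<Sum>q\<in>fiber_perms n s. of_int (sign q) * f q)"
proof -
  have "(\<Sum>h | h permutes {1..n}. fiber_sign n s h * f h) = (\<Sum>q\<in>fiber_perms n s. fiber_sign n s q * f q)"
    by (rule sum.mono_neutral_right) (auto simp: finite_permutations fiber_sign_def fiber_perms_def)
  then show ?thesis by (simp add: fiber_sign_def)
qed

lemma symmetrizer_real: "cnj (tableau_symmetrizer n r s g) = tableau_symmetrizer n r s g"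
  by (simp add: tableau_symmetrizer_def fiber_sign_def if_distrib cong: if_cong)

text \<open>Write \<open>a\<close> for the row sum and \<open>b\<close> for the signed column sum, so that the symmetrizer is \<open>x = a b\<close> and
its flip is \<open>b a\<close>. As \<open>a\<^sup>* = a\<close>, \<open>b\<^sup>* = b\<close> and \<open>b b\<close> is a multiple of \<open>b\<close>, the product \<open>x x\<^sup>* = a b b a\<close> is
a multiple of \<open>a (b a)\<close>, which lies in the two-sided ideal of the flip.\<close>

lemma symmetrizer_in_flip_span: "tableau_symmetrizer n r s \<in> two_sided_span (sym_group n) (flip (sym_group n) (tableau_symmetrizer n r s))"
proof -
  interpret fin_group "sym_group n" by (rule sym_group_fin)
  let ?G = "sym_group n" and ?R = "fiber_perms n r" and ?C = "fiber_perms n s" and ?x = "tableau_symmetrizer n r s"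
  let ?J = "two_sided_span ?G (flip ?G ?x)"
  have J: "two_sided ?G ?J" by (rule two_sided_span_two_sided)
  show ?thesis
  proof (rule in_two_sided_if_star_square[OF J symmetrizer_supported])
    have "(\<lambda>g. if g \<in> carrier ?G then \<Sum>h\<in>carrier ?G. cnj (?x h) * ?x (g \<otimes>\<^bsub>?G\<^esub> h) else 0) =
       (\<lambda>g. \<Sum>p\<in>?R. of_nat (card ?C) * translate ?G p id (flip ?G ?x) g)"
    proof
      fix g
      show "(if g \<in> carrier ?G then \<Sum>h\<in>carrier ?G. cnj (?x h) * ?x (g \<otimes>\<^bsub>?G\<^esub> h) else 0) =
       (\<Sum>p\<in>?R. of_nat (card ?C) * translate ?G p id (flip ?G ?x) g)"
      proof (cases "g permutes {1..n}")
        case g: True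
        have "(\<Sum>h | h permutes {1..n}. ?x h * ?x (g \<circ> h)) =
            (\<Sum>p\<in>?R. \<Sum>h | h permutes {1..n}. fiber_sign n s (p \<circ> h) * ?x (g \<circ> h))"
        proof -
          have "?x h * y = (\<Sum>p\<in>?R. fiber_sign n s (p \<circ> h) * y)" for h y
            by (simp only: tableau_symmetrizer_def sum_distrib_right)
          then show ?thesis by (subst sum.swap) (rule sum.cong[OF refl])
        qed
        also have "\<dots> = (\<Sum>p\<in>?R. of_nat (card ?C) * ?x (g \<circ> inv' p))"
        proof (rule sum.cong[OF refl])
          fix p assume "p \<in> ?R"
          then have p: "p permutes {1..n}" by (rule fiber_perms_permutes)
          have "(\<Sum>h | h permutes {1..n}. fiber_sign n s (p \<circ> h) * ?x (g \<circ> h)) =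
             (\<Sum>h | h permutes {1..n}. fiber_sign n s (p \<circ> h) * ?x ((g \<circ> inv' p) \<circ> (p \<circ> h)))"
            using permutes_inv_o(2)[OF p] by (metis comp_assoc comp_id)
          also have "\<dots> = (\<Sum>h | h permutes {1..n}. fiber_sign n s h * ?x ((g \<circ> inv' p) \<circ> h))"
            by (rule sum_perms_shift[OF p, of "\<lambda>h. fiber_sign n s h * ?x ((g \<circ> inv' p) \<circ> h)"])
          also have "\<dots> = (\<Sum>q\<in>?C. of_int (sign q) * ?x ((g \<circ> inv' p) \<circ> q))"
            by (rule sum_fiber_sign)
          also have "\<dots> = (\<Sum>q\<in>?C. ?x (g \<circ> inv' p))"
            using g p by (intro sum.cong[OF refl])
              (simp add: symmetrizer_comp_right permutes_compose permutes_inv mult.left_commute sign_sq)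
          finally show "(\<Sum>h | h permutes {1..n}. fiber_sign n s (p \<circ> h) * ?x (g \<circ> h)) = of_nat (card ?C) * ?x (g \<circ> inv' p)"
            by simp
        qed
        also have "\<dots> = of_nat (card ?C) * (\<Sum>p\<in>?R. ?x (g \<circ> p))"
          unfolding sum_distrib_left[symmetric] sum_fiber_perms_inv[of "\<lambda>p. ?x (g \<circ> p)" n r] ..
        also have "(\<Sum>p\<in>?R. ?x (g \<circ> p)) = (\<Sum>p\<in>?R. \<Sum>p'\<in>?R. fiber_sign n s (p' \<circ> (g \<circ> p)))"
          by (simp add: tableau_symmetrizer_def)
        also have "\<dots> = (\<Sum>p\<in>?R. translate ?G p id (flip ?G ?x) g)"
          using g by (subst sum.swap, intro sum.cong[OF refl])
            (simp add: translate_sym flip_symmetrizer permutes_compose fiber_perms_permutes comp_assoc)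
        finally show ?thesis using g
          by (simp add: sym_group_simps sum_distrib_left symmetrizer_real sym_group_carrier_eq comp_def)
      next
        case False
        then show ?thesis by (simp add: translate_def sym_group_simps)
      qed
    qed
    also have "\<dots> \<in> ?J"
    proof (rule subspace_sum_scaled)
      show "cfun.subspace ?J" using J by (simp add: two_sided_def)
      have "flip ?G ?x \<in> ?J" by (rule in_two_sided_span) (simp add: flip_def supported_on_def)
      then show "translate ?G p id (flip ?G ?x) \<in> ?J" if "p \<in> ?R" for p
        using that fiber_perms_permutes[OF that]
        by (intro two_sided_translate[OF J]) (simp_all add: sym_group_simps(1) permutes_id)
    qed
    finally show "(\<lambda>g. if g \<in> carrier ?G then \<Sum>h\<in>carrier ?G. cnj (?x h) * ?x (g \<otimes>\<^bsub>?G\<^esub> h) else 0) \<in> ?J" .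
  qed
qed

text \<open>One inclusion is \<open>symmetrizer_in_flip_span\<close>, and the other is its image under inversion.\<close>

lemma two_sided_span_flip_symmetrizer: "two_sided_span (sym_group n) (flip (sym_group n) (tableau_symmetrizer n r s)) = tableau_space n r s"
proof
  interpret fin_group "sym_group n" by (rule sym_group_fin)
  let ?G = "sym_group n" and ?x = "tableau_symmetrizer n r s"
  have supp: "flip ?G ?x \<in> supported_on (carrier ?G)" by (simp add: flip_def supported_on_def)
  have ff: "flip ?G (flip ?G ?x) = ?x"
    using symmetrizer_supported[of n r s]
    by (auto simp: flip_def supported_on_def fun_eq_iff simp del: sym_group_inv_equality)
  show sub: "tableau_space n r s \<subseteq> two_sided_span ?G (flip ?G ?x)"
    unfolding tableau_space_def by (intro two_sided_span_minimal two_sided_span_two_sided symmetrizer_in_flip_span)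
  have "two_sided ?G {f \<in> supported_on (carrier ?G). flip ?G f \<in> tableau_space n r s}"
    unfolding tableau_space_def by (intro flip_two_sided two_sided_span_two_sided)
  moreover have "flip ?G ?x \<in> {f \<in> supported_on (carrier ?G). flip ?G f \<in> tableau_space n r s}"
    using supp ff in_two_sided_span[OF symmetrizer_supported] by (simp add: tableau_space_def)
  ultimately have "two_sided_span ?G (flip ?G ?x) \<subseteq> {f \<in> supported_on (carrier ?G). flip ?G f \<in> tableau_space n r s}"
    by (rule two_sided_span_minimal)
  then have "?x \<in> {f \<in> supported_on (carrier ?G). flip ?G f \<in> tableau_space n r s}"
    using symmetrizer_in_flip_span by blast
  then show "two_sided_span ?G (flip ?G ?x) \<subseteq> tableau_space n r s"
    unfolding tableau_space_def by (intro two_sided_span_minimal two_sided_span_two_sided) auto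
qed

lemma tableau_space_two_sided: "two_sided (sym_group n) (tableau_space n r s)"
  unfolding tableau_space_def by (rule fin_group.two_sided_span_two_sided[OF sym_group_fin])

lemma symmetrizer_in_tableau_space: "tableau_symmetrizer n r s \<in> tableau_space n r s"
  unfolding tableau_space_def by (rule fin_group.in_two_sided_span[OF sym_group_fin symmetrizer_supported])

text \<open>Multiplication by the sign moves the signs from the column group to the row group, which turns
\<open>a b\<close> into the product for the transposed tableau in the opposite order.\<close>

lemma sign_times_symmetrizer:
  assumes g: "g permutes {1..n}"
  shows "of_int (sign g) * tableau_symmetrizer n r s g = flip (sym_group n) (tableau_symmetrizer n s r) g"
proof -
  let ?R = "fiber_perms n r" and ?C = "fiber_perms n s"
  have "of_int (sign g) * tableau_symmetrizer n r s g = (\<Sum>p\<in>{p \<in> ?R. p \<circ> g \<in> ?C}. of_int (sign p))"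
  proof -
    have "of_int (sign g) * tableau_symmetrizer n r s g = (\<Sum>p\<in>?R. if p \<circ> g \<in> ?C then of_int (sign p) else 0)"
      unfolding tableau_symmetrizer_def sum_distrib_left
    proof (rule sum.cong[OF refl])
      fix p assume "p \<in> ?R"
      then have "of_int (sign (p \<circ> g)) = (of_int (sign p) * of_int (sign g) :: complex)"
        using perm_sign_comp[OF fiber_perms_permutes g, of p r] by simp
      then show "of_int (sign g) * fiber_sign n s (p \<circ> g) = (if p \<circ> g \<in> ?C then of_int (sign p) else 0)"
        using sign_sq[of g] by (simp add: fiber_sign_def algebra_simps)
    qed
    then show ?thesis by (simp add: sum.inter_filter)
  qed
  also have "\<dots> = (\<Sum>q\<in>{q \<in> ?C. g \<circ> q \<in> ?R}. of_int (sign (g \<circ> q)))"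
  proof (rule sum.reindex_bij_witness[where j = "\<lambda>p. inv' (p \<circ> g)" and i = "\<lambda>q. inv' (g \<circ> q)"])
    note gi = permutes_inv_o[OF g] permutes_bij[OF g]
    have inv_pg: "inv' (p \<circ> g) = inv' g \<circ> inv' p" "inv' (g \<circ> p) = inv' p \<circ> inv' g" if "p permutes {1..n}" for p
      using that gi by (simp_all add: o_inv_distrib permutes_bij)
    have canc: "g \<circ> (inv' g \<circ> h) = h" "h \<circ> inv' g \<circ> g = h" for h
      using gi by (simp_all add: comp_assoc[symmetric], simp add: comp_assoc)
    fix p
    { assume p: "p \<in> {p \<in> ?R. p \<circ> g \<in> ?C}"
      then have pp: "p permutes {1..n}" using fiber_perms_permutes by blast
      have "g \<circ> inv' (p \<circ> g) = inv' p" using inv_pg[OF pp] canc by simp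
      then show "inv' (p \<circ> g) \<in> {q \<in> ?C. g \<circ> q \<in> ?R}" "inv' (g \<circ> inv' (p \<circ> g)) = p"
        "of_int (sign (g \<circ> inv' (p \<circ> g))) = (of_int (sign p) :: complex)"
        using p pp by (auto intro!: fiber_perms_inv simp: inv_inv_eq permutes_bij perm_sign_inv) }
    { assume p: "p \<in> {q \<in> ?C. g \<circ> q \<in> ?R}"
      then have pp: "p permutes {1..n}" using fiber_perms_permutes by blast
      have "inv' (g \<circ> p) \<circ> g = inv' p" using inv_pg[OF pp] canc by simp
      then show "inv' (g \<circ> p) \<in> {p \<in> ?R. p \<circ> g \<in> ?C}" "inv' (inv' (g \<circ> p) \<circ> g) = p"
        using p pp by (auto intro!: fiber_perms_inv simp: inv_inv_eq permutes_bij) }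
  qed
  also have "\<dots> = (\<Sum>q\<in>?C. fiber_sign n r (g \<circ> q))"
    by (simp add: sum.inter_filter fiber_sign_def)
  finally show ?thesis using g by (simp add: flip_symmetrizer)
qed

text \<open>On coefficient spaces, tensoring with the sign transposes the diagram.\<close>

lemma sign_times_tableau_space:
  assumes "f \<in> tableau_space n r s"
  shows "(\<lambda>g. of_int (sign g) * f g) \<in> tableau_space n s r"
proof -
  interpret fin_group "sym_group n" by (rule sym_group_fin)
  let ?G = "sym_group n"
  define L where "L f = (\<lambda>g. of_int (sign g) * f g)" for f :: "(nat \<Rightarrow> nat) \<Rightarrow> complex"
  have lin: "L (f + f') = L f + L f'" "L (\<lambda>g. c * f g) = (\<lambda>g. c * L f g)" for f f' c
    by (auto simp: L_def fun_eq_iff algebra_simps)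
  have T: "two_sided ?G (tableau_space n s r)" by (rule tableau_space_two_sided)
  have L_ysym: "L (tableau_symmetrizer n r s) = flip ?G (tableau_symmetrizer n s r)"
    using symmetrizer_supported[of n r s] sign_times_symmetrizer[of _ n r s]
    by (auto simp: L_def fun_eq_iff flip_def supported_on_def sym_group_simps)
  have "L f \<in> tableau_space n s r"
    using assms unfolding tableau_space_def[of n r s] two_sided_span_def
  proof (rule span_linear_image[where L = L and f = f, OF _ _ _ lin])
    show "cfun.subspace (tableau_space n s r)" using T by (simp add: two_sided_def)
    fix t assume "t \<in> {translate ?G x y (tableau_symmetrizer n r s) |x y. x \<in> carrier ?G \<and> y \<in> carrier ?G}"
    then obtain x y where t: "t = translate ?G x y (tableau_symmetrizer n r s)" and xy: "x permutes {1..n}" "y permutes {1..n}"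
      by (auto simp: sym_group_simps)
    have "L t = (\<lambda>g. of_int (sign x * sign y) * translate ?G x y (L (tableau_symmetrizer n r s)) g)"
    proof
      fix g
      show "L t g = of_int (sign x * sign y) * translate ?G x y (L (tableau_symmetrizer n r s)) g"
      proof (cases "g permutes {1..n}")
        case True
        have "of_int (sign (x \<circ> g \<circ> y)) = (of_int (sign x) * of_int (sign g) * of_int (sign y) :: complex)"
          using True xy by (simp add: perm_sign_comp[of _ n] permutes_compose)
        then show ?thesis
          using True xy sign_sq[of x] sign_sq[of y] by (simp add: L_def t translate_sym algebra_simps)
      qed (simp add: L_def t translate_def sym_group_simps)
    qed
    moreover have "L (tableau_symmetrizer n r s) \<in> tableau_space n s r"
      unfolding L_ysym two_sided_span_flip_symmetrizer[symmetric] by (rule in_two_sided_span) (simp add: flip_def supported_on_def)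
    ultimately show "L t \<in> tableau_space n s r"
      using T xy by (auto simp: two_sided_def sym_group_simps cfun.subspace_scale)
  qed
  then show ?thesis by (simp add: L_def)
qed

lemma fiber_perms_cong:
  assumes "\<And>i j. i \<in> {1..n} \<Longrightarrow> j \<in> {1..n} \<Longrightarrow> r i = r j \<longleftrightarrow> r' i = r' j"
  shows "fiber_perms n r = fiber_perms n r'"
proof -
  have "(r (p i) = r i) = (r' (p i) = r' i)" if "p permutes {1..n}" "i \<in> {1..n}" for p i
    using permutes_in_image[OF that(1), of i] that(2) by (intro assms) auto
  then show ?thesis by (auto simp: fiber_perms_def)
qed

lemma tableau_space_cong:
  assumes "\<And>i j. i \<in> {1..n} \<Longrightarrow> j \<in> {1..n} \<Longrightarrow> r i = r j \<longleftrightarrow> r' i = r' j"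
    and "\<And>i j. i \<in> {1..n} \<Longrightarrow> j \<in> {1..n} \<Longrightarrow> s i = s j \<longleftrightarrow> s' i = s' j"
  shows "tableau_symmetrizer n r s = tableau_symmetrizer n r' s'" "tableau_space n r s = tableau_space n r' s'"
proof -
  have "fiber_perms n r = fiber_perms n r'" "fiber_perms n s = fiber_perms n s'"
    using assms by (intro fiber_perms_cong; blast)+
  then show "tableau_symmetrizer n r s = tableau_symmetrizer n r' s'" by (simp add: tableau_symmetrizer_def fiber_sign_def fun_eq_iff)
  then show "tableau_space n r s = tableau_space n r' s'" by (simp add: tableau_space_def)
qed

lemma fiber_perms_conj:
  assumes t: "t permutes {1..n}"
  shows "p \<in> fiber_perms n (r \<circ> t) \<longleftrightarrow> t \<circ> p \<circ> inv' t \<in> fiber_perms n r"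
proof -
  have "(\<forall>i\<in>{1..n}. r (t (p i)) = r (t i)) \<longleftrightarrow> (\<forall>i\<in>{1..n}. r (t (p (inv' t i))) = r i)"
  proof safe
    fix i assume *: "\<forall>i\<in>{1..n}. r (t (p i)) = r (t i)" "i \<in> {1..n}"
    have "inv' t i \<in> {1..n}" using permutes_inv[OF t] *(2) by (simp only: permutes_in_image)
    then show "r (t (p (inv' t i))) = r i" using *(1) permutes_inverses(1)[OF t] by force
  next
    fix i assume *: "\<forall>i\<in>{1..n}. r (t (p (inv' t i))) = r i" "i \<in> {1..n}"
    have "t i \<in> {1..n}" using t *(2) by (simp only: permutes_in_image)
    then have "r (t (p (inv' t (t i)))) = r (t i)" using *(1) by blast
    then show "r (t (p i)) = r (t i)" using permutes_inverses(2)[OF t] by simp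
  qed
  moreover have "t \<circ> p \<circ> inv' t permutes {1..n} \<longleftrightarrow> p permutes {1..n}"
  proof
    assume "t \<circ> p \<circ> inv' t permutes {1..n}"
    then have "inv' t \<circ> (t \<circ> p \<circ> inv' t) \<circ> t permutes {1..n}"
      using t by (intro permutes_compose[of t] permutes_compose[of "t \<circ> p \<circ> inv' t"] permutes_inv)
    then show "p permutes {1..n}" using permutes_inv_o(2)[OF t] by (metis comp_assoc comp_id id_comp)
  qed (use t in \<open>auto intro: permutes_compose permutes_inv\<close>)
  ultimately show ?thesis by (auto simp: fiber_perms_def)
qed

lemma symmetrizer_conj:
  assumes t: "t permutes {1..n}" and g: "g permutes {1..n}"
  shows "tableau_symmetrizer n (r \<circ> t) (s \<circ> t) g = tableau_symmetrizer n r s (t \<circ> g \<circ> inv' t)"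
proof -
  note ti = permutes_inv_o[OF t]
  have c1: "inv' t \<circ> (t \<circ> h) = h" "t \<circ> (inv' t \<circ> h) = h" for h
    using ti by (simp_all add: comp_assoc[symmetric])
  have fs: "fiber_sign n (s \<circ> t) q = fiber_sign n s (t \<circ> q \<circ> inv' t)" if q: "q permutes {1..n}" for q
  proof -
    have "sign (t \<circ> q \<circ> inv' t) = sign q"
      using t q by (simp add: perm_sign_comp[of _ n] permutes_compose permutes_inv perm_sign_inv mult.commute)
    then show ?thesis by (simp add: fiber_sign_def fiber_perms_conj[OF t])
  qed
  show ?thesis
    unfolding tableau_symmetrizer_def
  proof (rule sum.reindex_bij_witness[where j = "\<lambda>p. t \<circ> p \<circ> inv' t" and i = "\<lambda>p. inv' t \<circ> p \<circ> t"])
    fix p assume p: "p \<in> fiber_perms n (r \<circ> t)"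
    show "inv' t \<circ> (t \<circ> p \<circ> inv' t) \<circ> t = p" using ti c1 by (simp add: comp_assoc)
    show "t \<circ> p \<circ> inv' t \<in> fiber_perms n r" using p by (simp add: fiber_perms_conj[OF t])
    have "t \<circ> p \<circ> inv' t \<circ> (t \<circ> g \<circ> inv' t) = t \<circ> (p \<circ> g) \<circ> inv' t" by (simp add: comp_assoc c1)
    then show "fiber_sign n s (t \<circ> p \<circ> inv' t \<circ> (t \<circ> g \<circ> inv' t)) = fiber_sign n (s \<circ> t) (p \<circ> g)"
      using fs[of "p \<circ> g"] p g by (simp add: permutes_compose fiber_perms_permutes)
  next
    fix p assume p: "p \<in> fiber_perms n r"
    show eq: "t \<circ> (inv' t \<circ> p \<circ> t) \<circ> inv' t = p" using ti c1 by (simp add: comp_assoc)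
    show "inv' t \<circ> p \<circ> t \<in> fiber_perms n (r \<circ> t)"
      unfolding fiber_perms_conj[OF t] eq by (rule p)
  qed
qed

lemma tableau_space_conj:
  assumes t: "t permutes {1..n}"
  shows "tableau_space n (r \<circ> t) (s \<circ> t) \<subseteq> tableau_space n r s"
  unfolding tableau_space_def[of n "r \<circ> t"]
proof (rule fin_group.two_sided_span_minimal[OF sym_group_fin tableau_space_two_sided])
  have "tableau_symmetrizer n (r \<circ> t) (s \<circ> t) = translate (sym_group n) t (inv' t) (tableau_symmetrizer n r s)"
    using symmetrizer_supported[of n "r \<circ> t" "s \<circ> t"]
    by (auto simp: fun_eq_iff translate_def sym_group_simps supported_on_def symmetrizer_conj[OF t])
  then show "tableau_symmetrizer n (r \<circ> t) (s \<circ> t) \<in> tableau_space n r s"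
    using fin_group.two_sided_translate[OF sym_group_fin tableau_space_two_sided symmetrizer_in_tableau_space, of t n "inv' t" r s] t
    by (simp add: sym_group_simps permutes_inv)
qed

text \<open>Two fillings of one set of cells differ by a permutation of the entries, which conjugates the
symmetrizers.\<close>

lemma tableau_space_same_cells:
  assumes "bij_betw (\<lambda>i. (r i, s i)) {1..n} X" "bij_betw (\<lambda>i. (r' i, s' i)) {1..n} X"
  shows "tableau_space n r s = tableau_space n r' s'"
proof -
  have "tableau_space n r s \<subseteq> tableau_space n r' s'"
    if b: "bij_betw (\<lambda>i. (r i, s i)) {1..n} X" "bij_betw (\<lambda>i. (r' i, s' i)) {1..n} X" for r s r' s'
  proof -
    define t where "t i = (if i \<in> {1..n} then inv_into {1..n} (\<lambda>i. (r' i, s' i)) (r i, s i) else i)" for i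
    have inX: "(r i, s i) \<in> (\<lambda>i. (r' i, s' i)) ` {1..n}" if "i \<in> {1..n}" for i
      using b that by (metis bij_betwE bij_betw_imp_surj_on)
    have t: "(r' (t i), s' (t i)) = (r i, s i)" if "i \<in> {1..n}" for i
      using f_inv_into_f[OF inX[OF that]] that by (simp add: t_def)
    have "bij_betw (inv_into {1..n} (\<lambda>i. (r' i, s' i)) \<circ> (\<lambda>i. (r i, s i))) {1..n} {1..n}"
      by (rule bij_betw_trans[OF b(1) bij_betw_inv_into[OF b(2)]])
    then have "bij_betw t {1..n} {1..n}"
      by (rule bij_betw_cong[THEN iffD1, rotated]) (simp add: t_def)
    then have perm: "t permutes {1..n}" by (rule bij_imp_permutes) (auto simp: t_def)
    have "tableau_space n r s = tableau_space n (r' \<circ> t) (s' \<circ> t)"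
      using t by (intro tableau_space_cong) auto
    then show ?thesis using tableau_space_conj[OF perm] by simp
  qed
  then show ?thesis using assms by blast
qed

section \<open>Coefficients of the irreducible representations of the symmetric group\<close>

definition diagram :: "nat list \<Rightarrow> (nat \<times> nat) set" where
  "diagram lam = {(i, j). i < length lam \<and> j < lam ! i}"

definition cell_label :: "nat list \<Rightarrow> nat \<times> nat \<Rightarrow> nat" where
  "cell_label lam = (\<lambda>(i, j). sum_list (take i lam) + j + 1)"

lemma diagram_Sigma: "diagram lam = (SIGMA i:{..<length lam}. {..<lam ! i})"
  by (auto simp: diagram_def)

lemma card_diagram: "card (diagram lam) = sum_list lam"
  by (simp add: diagram_Sigma card_SigmaI sum_list_sum_nth lessThan_atLeast0)

lemma sum_list_take_mono: "i \<le> j \<Longrightarrow> sum_list (take i lam) \<le> sum_list (take j lam :: nat list)"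
proof -
  assume "i \<le> j"
  then have "take j lam = take i lam @ take (j - i) (drop i lam)"
    by (metis le_add_diff_inverse take_add)
  then show ?thesis by simp
qed

lemma cell_label_less:
  assumes "(i, j) \<in> diagram lam" "i < i'"
  shows "cell_label lam (i, j) \<le> sum_list (take i' lam)"
proof -
  have "cell_label lam (i, j) \<le> sum_list (take (Suc i) lam)"
    using assms(1) by (auto simp: cell_label_def diagram_def take_Suc_conv_app_nth)
  also have "\<dots> \<le> sum_list (take i' lam)" using assms(2) by (intro sum_list_take_mono) simp
  finally show ?thesis .
qed

lemma bij_betw_cell_label: "bij_betw (cell_label lam) (diagram lam) {1..sum_list lam}"
proof -
  have inj: "inj_on (cell_label lam) (diagram lam)"
  proof (rule inj_onI, clarsimp)
    fix i j i' j' assume *: "(i, j) \<in> diagram lam" "(i', j') \<in> diagram lam"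
      "cell_label lam (i, j) = cell_label lam (i', j')"
    have "\<not> i < i'" "\<not> i' < i"
      using cell_label_less[OF *(1), of i'] cell_label_less[OF *(2), of i] *(3)
      by (auto simp: cell_label_def)
    then have "i = i'" by simp
    then show "i = i' \<and> j = j'" using *(3) by (simp add: cell_label_def)
  qed
  have "cell_label lam ` diagram lam \<subseteq> {1..sum_list lam}"
  proof safe
    fix i j assume *: "(i, j) \<in> diagram lam"
    then have "i < length lam" by (auto simp: diagram_def)
    then show "cell_label lam (i, j) \<in> {1..sum_list lam}"
      using cell_label_less[OF *, of "length lam"] by (simp add: cell_label_def)
  qed
  moreover have "card (cell_label lam ` diagram lam) = card {1..sum_list lam}"
    using inj by (simp add: card_image card_diagram)
  ultimately have "cell_label lam ` diagram lam = {1..sum_list lam}" by (intro card_subset_eq) auto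
  with inj show ?thesis by (simp add: bij_betw_def)
qed

text \<open>The cell of an entry in the standard filling of the diagram row by row.\<close>

definition std_cell :: "nat list \<Rightarrow> nat \<Rightarrow> nat \<times> nat" where
  "std_cell lam = inv_into (diagram lam) (cell_label lam)"

lemma bij_betw_std_cell: "bij_betw (std_cell lam) {1..sum_list lam} (diagram lam)"
  unfolding std_cell_def by (rule bij_betw_inv_into[OF bij_betw_cell_label])

lemma std_cell_label: "c \<in> diagram lam \<Longrightarrow> std_cell lam (cell_label lam c) = c"
  unfolding std_cell_def using bij_betw_cell_label[of lam] by (simp add: bij_betw_def)

lemma label_std_cell: "x \<in> {1..sum_list lam} \<Longrightarrow> cell_label lam (std_cell lam x) = x"
  unfolding std_cell_def using bij_betw_cell_label[of lam] by (simp add: bij_betw_def f_inv_into_f)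

lemma tableau_row_std:
  assumes "i < length lam"
  shows "tableau_row lam i = {x \<in> {1..sum_list lam}. fst (std_cell lam x) = i}"
proof -
  have "tableau_row lam i = {cell_label lam (i, c) |c. (i, c) \<in> diagram lam}"
    using assms by (simp add: tableau_row_def cell_label_def diagram_def)
  also have "\<dots> = {x \<in> {1..sum_list lam}. fst (std_cell lam x) = i}"
  proof safe
    fix x assume x: "x \<in> {1..sum_list lam}"
    then have "std_cell lam x \<in> diagram lam" using bij_betw_std_cell bij_betwE by blast
    then show "\<exists>c. x = cell_label lam (fst (std_cell lam x), c) \<and> (fst (std_cell lam x), c) \<in> diagram lam"
      using label_std_cell[OF x] by (intro exI[of _ "snd (std_cell lam x)"]) simp
  qed (use std_cell_label bij_betwE[OF bij_betw_cell_label[of lam]] in auto)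
  finally show ?thesis .
qed

lemma tableau_col_std:
  "tableau_col lam j = {x \<in> {1..sum_list lam}. snd (std_cell lam x) = j}"
proof -
  have "tableau_col lam j = {cell_label lam (i, j) |i. (i, j) \<in> diagram lam}"
    by (simp add: tableau_col_def cell_label_def diagram_def)
  also have "\<dots> = {x \<in> {1..sum_list lam}. snd (std_cell lam x) = j}"
  proof safe
    fix x assume x: "x \<in> {1..sum_list lam}"
    then have "std_cell lam x \<in> diagram lam" using bij_betw_std_cell bij_betwE by blast
    then show "\<exists>i. x = cell_label lam (i, snd (std_cell lam x)) \<and> (i, snd (std_cell lam x)) \<in> diagram lam"
      using label_std_cell[OF x] by (intro exI[of _ "fst (std_cell lam x)"]) simp
  qed (use std_cell_label bij_betwE[OF bij_betw_cell_label[of lam]] in auto)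
  finally show ?thesis .
qed

text \<open>Any set \<open>V\<close> of values that contains the range will do, which covers rows, indexed up to the
number of parts, as well as columns, indexed by all numbers.\<close>

lemma fiber_perms_setwise:
  assumes V: "f ` {1..n} \<subseteq> V"
  shows "fiber_perms n f = {p. p permutes {1..n} \<and> (\<forall>v\<in>V. p ` {x \<in> {1..n}. f x = v} = {x \<in> {1..n}. f x = v})}"
proof (intro equalityI subsetI)
  fix p assume p: "p \<in> fiber_perms n f"
  then have perm: "p permutes {1..n}" by (rule fiber_perms_permutes)
  have "p ` {x \<in> {1..n}. f x = v} = {x \<in> {1..n}. f x = v}" for v
  proof (rule card_subset_eq)
    show "p ` {x \<in> {1..n}. f x = v} \<subseteq> {x \<in> {1..n}. f x = v}"
      using p permutes_in_image[OF perm] by (auto simp: fiber_perms_def)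
    show "card (p ` {x \<in> {1..n}. f x = v}) = card {x \<in> {1..n}. f x = v}"
      using permutes_inj[OF perm] by (simp add: card_image inj_on_def inj_def)
  qed simp
  then show "p \<in> {p. p permutes {1..n} \<and> (\<forall>v\<in>V. p ` {x \<in> {1..n}. f x = v} = {x \<in> {1..n}. f x = v})}"
    using perm by blast
next
  fix p assume p: "p \<in> {p. p permutes {1..n} \<and> (\<forall>v\<in>V. p ` {x \<in> {1..n}. f x = v} = {x \<in> {1..n}. f x = v})}"
  have "f (p i) = f i" if "i \<in> {1..n}" for i
  proof -
    have "p ` {x \<in> {1..n}. f x = f i} = {x \<in> {1..n}. f x = f i}" using p V that by blast
    moreover have "p i \<in> p ` {x \<in> {1..n}. f x = f i}" using that by blast
    ultimately show ?thesis by blast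
  qed
  then show "p \<in> fiber_perms n f" using p by (simp add: fiber_perms_def)
qed

lemma row_group_std: "row_group lam = fiber_perms (sum_list lam) (fst \<circ> std_cell lam)"
proof -
  have "(fst \<circ> std_cell lam) ` {1..sum_list lam} \<subseteq> {..<length lam}"
    using bij_betwE[OF bij_betw_std_cell[of lam]] by (fastforce simp: diagram_def)
  then show ?thesis
    unfolding row_group_def by (subst fiber_perms_setwise) (assumption, simp add: tableau_row_std Ball_def)
qed

lemma col_group_std: "col_group lam = fiber_perms (sum_list lam) (snd \<circ> std_cell lam)"
  unfolding col_group_def by (subst fiber_perms_setwise[of _ _ UNIV]) (auto simp: tableau_col_std)

lemma young_symmetrizer_eq_tableau_symmetrizer:
  "young_symmetrizer lam = tableau_symmetrizer (sum_list lam) (fst \<circ> std_cell lam) (snd \<circ> std_cell lam)"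
proof
  fix g
  let ?n = "sum_list lam"
  let ?R = "fiber_perms ?n (fst \<circ> std_cell lam)" and ?C = "fiber_perms ?n (snd \<circ> std_cell lam)"
  have "young_symmetrizer lam g = (\<Sum>p\<in>?R. \<Sum>q\<in>?C. if p \<circ> q = g then of_int (sign q) else 0)"
    by (simp add: young_symmetrizer_def row_group_std col_group_std sum.cartesian_product)
  also have "\<dots> = (\<Sum>p\<in>?R. fiber_sign ?n (snd \<circ> std_cell lam) (inv' p \<circ> g))"
  proof (rule sum.cong[OF refl])
    fix p assume "p \<in> ?R"
    then have p: "p permutes {1..?n}" by (rule fiber_perms_permutes)
    have "p \<circ> q = g \<longleftrightarrow> q = inv' p \<circ> g" for q
      using permutes_inv_o[OF p] by (metis comp_assoc id_comp)
    then show "(\<Sum>q\<in>?C. if p \<circ> q = g then of_int (sign q) else 0) = fiber_sign ?n (snd \<circ> std_cell lam) (inv' p \<circ> g)"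
      by (simp add: fiber_sign_def)
  qed
  also have "\<dots> = tableau_symmetrizer ?n (fst \<circ> std_cell lam) (snd \<circ> std_cell lam) g"
    unfolding tableau_symmetrizer_def by (rule sum_fiber_perms_inv)
  finally show "young_symmetrizer lam g = tableau_symmetrizer ?n (fst \<circ> std_cell lam) (snd \<circ> std_cell lam) g" .
qed

lemma sigma_matrix_form:
  "matrix_form_of_ideal (sym_group (sum_list lam)) (specht_module lam) (sigma lam)"
proof -
  have "\<exists>\<rho>. matrix_form_of_ideal (sym_group (sum_list lam)) (specht_module lam) \<rho>"
    unfolding specht_module_def
    by (intro fin_group.ex_matrix_form fin_group.left_invariant_left_ideal sym_group_fin)
  then show ?thesis unfolding sigma_def by (rule someI_ex)
qed

lemma sigma_is_rep: "is_rep (sym_group (sum_list lam)) (sigma lam)"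
  using sigma_matrix_form by (simp add: matrix_form_of_ideal_def)

theorem coeffs_sigma_std:
  "coeffs (sym_group (sum_list lam)) (sigma lam) =
     tableau_space (sum_list lam) (fst \<circ> std_cell lam) (snd \<circ> std_cell lam)"
proof -
  have "coeffs (sym_group (sum_list lam)) (sigma lam) =
      two_sided_span (sym_group (sum_list lam)) (flip (sym_group (sum_list lam)) (young_symmetrizer lam))"
    using sigma_matrix_form[of lam] unfolding specht_module_def
    by (intro fin_group.coeffs_left_ideal sym_group_fin) (simp_all add: young_symmetrizer_eq_tableau_symmetrizer symmetrizer_supported)
  then show ?thesis by (simp add: young_symmetrizer_eq_tableau_symmetrizer two_sided_span_flip_symmetrizer)
qed

text \<open>Only the incidence of cells in rows and columns matters: a set of cells that becomes the diagram of
\<open>lam\<close> after injective renumberings \<open>\<phi>\<close> of the rows and \<open>\<psi>\<close> of the columns may replace it.\<close>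

theorem coeffs_sigma:
  assumes X: "bij_betw (\<lambda>i. (r i, s i)) {1..n} X"
    and inj: "inj_on \<phi> (fst ` X)" "inj_on \<psi> (snd ` X)"
    and img: "(\<lambda>(i, j). (\<phi> i, \<psi> j)) ` X = diagram lam"
  shows "sum_list lam = n" "coeffs (sym_group n) (sigma lam) = tableau_space n r s"
proof -
  have injX: "inj_on (\<lambda>(i, j). (\<phi> i, \<psi> j)) X"
    using inj by (fastforce simp: inj_on_def)
  have "sum_list lam = card X"
    using card_image[OF injX] by (simp add: img card_diagram)
  also have "\<dots> = n" using bij_betw_same_card[OF X] by simp
  finally show n: "sum_list lam = n" .
  have rs: "(r i, s i) \<in> X" if "i \<in> {1..n}" for i using that bij_betwE[OF X] by blast
  have "tableau_space n r s = tableau_space n (\<phi> \<circ> r) (\<psi> \<circ> s)"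
  proof (rule tableau_space_cong)
    fix i j assume "i \<in> {1..n}" "j \<in> {1..n}"
    then have "r i \<in> fst ` X" "r j \<in> fst ` X" "s i \<in> snd ` X" "s j \<in> snd ` X" using image_eqI[OF _ rs] by (metis fst_conv snd_conv)+
    then show "r i = r j \<longleftrightarrow> (\<phi> \<circ> r) i = (\<phi> \<circ> r) j" "s i = s j \<longleftrightarrow> (\<psi> \<circ> s) i = (\<psi> \<circ> s) j"
      using inj_on_eq_iff[OF inj(1)] inj_on_eq_iff[OF inj(2)] by simp_all
  qed
  also have "\<dots> = tableau_space n (fst \<circ> std_cell lam) (snd \<circ> std_cell lam)"
  proof (rule tableau_space_same_cells)
    have "bij_betw ((\<lambda>(i, j). (\<phi> i, \<psi> j)) \<circ> (\<lambda>i. (r i, s i))) {1..n} (diagram lam)"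
      using injX img by (intro bij_betw_trans[OF X]) (simp add: bij_betw_def)
    then show "bij_betw (\<lambda>i. ((\<phi> \<circ> r) i, (\<psi> \<circ> s) i)) {1..n} (diagram lam)" by (simp add: comp_def)
    show "bij_betw (\<lambda>i. ((fst \<circ> std_cell lam) i, (snd \<circ> std_cell lam) i)) {1..n} (diagram lam)"
      using bij_betw_std_cell[of lam] by (simp add: n)
  qed
  also have "\<dots> = coeffs (sym_group n) (sigma lam)" using coeffs_sigma_std[of lam] by (simp add: n)
  finally show "coeffs (sym_group n) (sigma lam) = tableau_space n r s" ..
qed

section \<open>Restriction to a Young subgroup\<close>

definition block_perms :: "nat \<Rightarrow> nat \<Rightarrow> (nat \<Rightarrow> nat) set" where
  "block_perms a b = {g. g permutes {1..a + b} \<and> g ` {1..a} = {1..a}}"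

definition left_part :: "nat \<Rightarrow> (nat \<Rightarrow> nat) \<Rightarrow> nat \<Rightarrow> nat" where
  "left_part a p = (\<lambda>i. if i \<in> {1..a} then p i else i)"

definition right_part :: "nat \<Rightarrow> nat \<Rightarrow> (nat \<Rightarrow> nat) \<Rightarrow> nat \<Rightarrow> nat" where
  "right_part a b p = (\<lambda>i. if i \<in> {1..b} then p (a + i) - a else i)"

text \<open>The element of \<open>S\<^sub>a \<times> S\<^sub>b\<close> inside \<open>S\<^sub>a\<^sub>+\<^sub>b\<close>, with the second factor acting on \<open>{a+1..a+b}\<close>.\<close>

definition join_perms :: "nat \<Rightarrow> (nat \<Rightarrow> nat) \<Rightarrow> (nat \<Rightarrow> nat) \<Rightarrow> nat \<Rightarrow> nat" where
  "join_perms a p q = (\<lambda>i. if i \<le> a then p i else q (i - a) + a)"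

lemma permutes_le_iff: "p permutes {1..a::nat} \<Longrightarrow> p i \<le> a \<longleftrightarrow> i \<le> a"
  using permutes_in_image[of p "{1..a}" i] permutes_not_in[of p "{1..a}" i]
    permutes_not_in[of p "{1..a}" 0] inj_eq[OF permutes_inj[of p "{1..a}"], of i 0]
  by (cases "i = 0") (auto simp: Suc_le_eq)

lemma permutes_zero: "p permutes {1..a::nat} \<Longrightarrow> p 0 = 0"
  by (rule permutes_not_in) auto

lemma join_comp:
  assumes "p' permutes {1..a}" "q' permutes {1..b}"
  shows "join_perms a p q \<circ> join_perms a p' q' = join_perms a (p \<circ> p') (q \<circ> q')"
proof
  fix i
  have "i > a \<Longrightarrow> q' (i - a) \<noteq> 0"
    using inj_eq[OF permutes_inj[OF assms(2)], of "i - a" 0] permutes_zero[OF assms(2)] by auto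
  then show "(join_perms a p q \<circ> join_perms a p' q') i = join_perms a (p \<circ> p') (q \<circ> q') i"
    using permutes_le_iff[OF assms(1), of i] by (auto simp: join_perms_def)
qed

lemma join_id: "join_perms a id id = id"
  by (auto simp: join_perms_def fun_eq_iff)

lemma join_permutes:
  assumes "p permutes {1..a}" "q permutes {1..b}"
  shows "join_perms a p q permutes {1..a + b}"
proof -
  have "join_perms a p q \<circ> join_perms a (inv' p) (inv' q) = id" "join_perms a (inv' p) (inv' q) \<circ> join_perms a p q = id"
    using assms by (simp_all add: join_comp[of _ a _ b] permutes_inv permutes_inv_o join_id)
  then have "bij (join_perms a p q)" using o_bij by blast
  moreover have "join_perms a p q i = i" if "i \<notin> {1..a + b}" for i
  proof -
    have "i = 0 \<or> i > a + b" using that unfolding atLeastAtMost_iff by arith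
    then consider "i = 0" | "i > a + b" by blast
    then show ?thesis
    proof cases
      case 2
      then have "i - a \<notin> {1..b}" by auto
      then show ?thesis using permutes_not_in[OF assms(2)] 2 by (simp add: join_perms_def)
    qed (simp add: join_perms_def permutes_zero[OF assms(1)])
  qed
  ultimately show ?thesis unfolding permutes_def by (metis bij_pointE)
qed

lemma join_block:
  assumes "p permutes {1..a}" "q permutes {1..b}"
  shows "join_perms a p q \<in> block_perms a b"
proof -
  have "join_perms a p q ` {1..a} = p ` {1..a}" by (rule image_cong) (auto simp: join_perms_def)
  then show ?thesis using join_permutes[OF assms] permutes_image[OF assms(1)] by (simp add: block_perms_def)
qed

lemma left_join: "p permutes {1..a} \<Longrightarrow> left_part a (join_perms a p q) = p"
  by (auto simp: left_part_def join_perms_def fun_eq_iff permutes_not_in)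

lemma right_join: "q permutes {1..b} \<Longrightarrow> right_part a b (join_perms a p q) = q"
  by (auto simp: right_part_def join_perms_def fun_eq_iff permutes_not_in)

lemma left_part_permutes:
  assumes "g \<in> block_perms a b"
  shows "left_part a g permutes {1..a}"
proof (rule bij_imp_permutes)
  have "bij_betw g {1..a} {1..a}"
    using assms permutes_inj_on[of g "{1..a+b}" "{1..a}"] by (auto simp: block_perms_def bij_betw_def)
  then show "bij_betw (left_part a g) {1..a} {1..a}"
    by (rule bij_betw_cong[THEN iffD1, rotated]) (simp add: left_part_def)
qed (auto simp: left_part_def)

lemma block_perms_right:
  assumes g: "g \<in> block_perms a b" and i: "i \<in> {a + 1..a + b}"
  shows "g i \<in> {a + 1..a + b}"
proof -
  have perm: "g permutes {1..a + b}" using g by (simp add: block_perms_def)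
  have "g i \<in> {1..a + b}" unfolding permutes_in_image[OF perm] using i by auto
  moreover have "g i \<notin> {1..a}"
  proof
    assume "g i \<in> {1..a}"
    then have "g i \<in> g ` {1..a}" using g by (simp add: block_perms_def)
    then obtain j where "j \<in> {1..a}" "g i = g j" by blast
    then show False using inj_eq[OF permutes_inj[OF perm]] i by auto
  qed
  ultimately show ?thesis by auto
qed

lemma right_part_permutes:
  assumes g: "g \<in> block_perms a b"
  shows "right_part a b g permutes {1..b}"
proof (rule bij_imp_permutes)
  have perm: "g permutes {1..a + b}" using g by (simp add: block_perms_def)
  have val: "right_part a b g i + a = g (a + i)" "right_part a b g i \<in> {1..b}" if "i \<in> {1..b}" for i
    using block_perms_right[OF g, of "a + i"] that by (auto simp: right_part_def)
  have inj: "inj_on (right_part a b g) {1..b}"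
  proof (rule inj_onI)
    fix i j assume ij: "i \<in> {1..b}" "j \<in> {1..b}" "right_part a b g i = right_part a b g j"
    then have "g (a + i) = g (a + j)" using val by metis
    then show "i = j" using inj_eq[OF permutes_inj[OF perm]] by simp
  qed
  then have "right_part a b g ` {1..b} = {1..b}"
    using val(2) by (intro endo_inj_surj) auto
  then show "bij_betw (right_part a b g) {1..b} {1..b}" using inj by (simp add: bij_betw_def)
qed (auto simp: right_part_def)

lemma join_parts:
  assumes g: "g \<in> block_perms a b"
  shows "join_perms a (left_part a g) (right_part a b g) = g"
proof
  fix i
  have perm: "g permutes {1..a + b}" using g by (simp add: block_perms_def)
  consider "i = 0" | "i \<in> {1..a}" | "i \<in> {a + 1..a + b}" | "i > a + b" by force
  then show "join_perms a (left_part a g) (right_part a b g) i = g i"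
  proof cases
    case 3
    then show ?thesis using block_perms_right[OF g 3] by (auto simp: join_perms_def right_part_def)
  qed (use permutes_not_in[OF perm, of i] in \<open>auto simp: join_perms_def left_part_def right_part_def\<close>)
qed

lemma parts_comp:
  assumes "g \<in> block_perms a b" "h \<in> block_perms a b"
  shows "left_part a (g \<circ> h) = left_part a g \<circ> left_part a h"
    "right_part a b (g \<circ> h) = right_part a b g \<circ> right_part a b h"
proof -
  note g = left_part_permutes[OF assms(1)] right_part_permutes[OF assms(1)]
  note h = left_part_permutes[OF assms(2)] right_part_permutes[OF assms(2)]
  have "g \<circ> h = join_perms a (left_part a g \<circ> left_part a h) (right_part a b g \<circ> right_part a b h)"
    using join_comp[OF h, of "left_part a g" "right_part a b g"] join_parts[OF assms(1)] join_parts[OF assms(2)] by simp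
  then show "left_part a (g \<circ> h) = left_part a g \<circ> left_part a h"
    "right_part a b (g \<circ> h) = right_part a b g \<circ> right_part a b h"
    using g h by (simp_all add: left_join right_join permutes_compose)
qed

lemma block_perms_comp: "g \<in> block_perms a b \<Longrightarrow> h \<in> block_perms a b \<Longrightarrow> g \<circ> h \<in> block_perms a b"
proof -
  assume *: "g \<in> block_perms a b" "h \<in> block_perms a b"
  have "(g \<circ> h) ` {1..a} = g ` (h ` {1..a})" by (simp only: image_comp)
  then show ?thesis using * unfolding block_perms_def by (simp only: permutes_compose mem_Collect_eq)
qed

text \<open>Rotating \<open>{1..a+b}\<close> conjugates the second factor to \<open>q\<close> itself, acting on \<open>{1..b}\<close>.\<close>

lemma sign_join:
  assumes p: "p permutes {1..a}" and q: "q permutes {1..b}"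
  shows "sign (join_perms a p q) = sign p * sign q"
proof -
  \<comment> \<open>the rotation that takes the second block to \<open>{1..b}\<close>\<close>
  define t where "t i = (if i \<in> {1..a + b} then if i \<le> a then i + b else i - a else i)" for i
  have "bij_betw t {1..a + b} {1..a + b}"
    by (rule bij_betw_byWitness[where f' = "\<lambda>i. if i \<le> b then i + a else i - b"]) (auto simp: t_def)
  then have t: "t permutes {1..a + b}" by (rule bij_imp_permutes) (auto simp: t_def)
  have "t \<circ> join_perms a id q = q \<circ> t"
  proof
    fix i
    have fix_q: "q j = j" if "j > b" for j using permutes_not_in[OF q, of j] that by simp
    have q_range: "q j \<in> {1..b}" if "j \<in> {1..b}" for j using permutes_in_image[OF q, of j] that by simp
    consider "i = 0" | "i \<in> {1..a}" | "i \<in> {a + 1..a + b}" | "i > a + b" by force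
    then show "(t \<circ> join_perms a id q) i = (q \<circ> t) i"
    proof cases
      case 3
      then have "i - a \<in> {1..b}" unfolding atLeastAtMost_iff by arith
      then show ?thesis using 3 q_range[of "i - a"] by (auto simp: t_def join_perms_def)
    qed (use permutes_zero[OF q] fix_q in \<open>auto simp: t_def join_perms_def\<close>)
  qed
  then have "sign t * sign (join_perms a id q) = sign q * sign t"
    using perm_sign_comp[OF t join_permutes[OF permutes_id q]]
      perm_sign_comp[OF permutes_subset[OF q] t] by simp
  then have "sign (join_perms a id q) = sign q" using sign_nz[of t] by (simp add: mult.commute)
  moreover have "join_perms a p id = p"
    using permutes_not_in[OF p] by (auto simp: join_perms_def fun_eq_iff)
  moreover have "join_perms a p q = join_perms a p id \<circ> join_perms a id q"
    using join_comp[OF permutes_id q, where p = p and q = id] by simp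
  ultimately show ?thesis
    using perm_sign_comp[of "join_perms a p id" "a + b" "join_perms a id q"] p q join_permutes[OF p permutes_id, of b]
      join_permutes[OF permutes_id q, of a] by simp
qed

lemma join_fiber_iff:
  assumes "p permutes {1..a}" "q permutes {1..b}"
  shows "join_perms a p q \<in> fiber_perms (a + b) f \<longleftrightarrow>
    p \<in> fiber_perms a f \<and> q \<in> fiber_perms b (\<lambda>i. f (a + i))"
proof -
  have "(\<forall>i\<in>{1..a + b}. f (join_perms a p q i) = f i) \<longleftrightarrow>
      (\<forall>i\<in>{1..a}. f (p i) = f i) \<and> (\<forall>i\<in>{1..b}. f (a + q i) = f (a + i))"
  proof safe
    fix i assume *: "\<forall>i\<in>{1..a + b}. f (join_perms a p q i) = f i"
    { assume "i \<in> {1..a}" then show "f (p i) = f i" using *[rule_format, of i] by (simp add: join_perms_def) }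
    { assume "i \<in> {1..b}" then show "f (a + q i) = f (a + i)"
        using *[rule_format, of "a + i"] by (simp add: join_perms_def add.commute) }
  next
    fix i assume *: "\<forall>i\<in>{1..a}. f (p i) = f i" "\<forall>i\<in>{1..b}. f (a + q i) = f (a + i)" "i \<in> {1..a + b}"
    show "f (join_perms a p q i) = f i"
    proof (cases "i \<le> a")
      case True
      then show ?thesis using * by (simp add: join_perms_def)
    next
      case False
      then have "i - a \<in> {1..b}" using *(3) by auto
      then show ?thesis using *(2)[rule_format, of "i - a"] False by (simp add: join_perms_def add.commute)
    qed
  qed
  then show ?thesis using assms join_permutes[OF assms] by (simp add: fiber_perms_def)
qed

lemma fiber_sign_join:
  assumes "p permutes {1..a}" "q permutes {1..b}"
  shows "fiber_sign (a + b) f (join_perms a p q) = fiber_sign a f p * fiber_sign b (\<lambda>i. f (a + i)) q"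
  by (simp add: fiber_sign_def join_fiber_iff[OF assms] sign_join[OF assms])

text \<open>With each cell, \<open>A\<close> contains the cells above it in the same column.\<close>

definition column_closed :: "nat \<Rightarrow> (nat \<Rightarrow> nat) \<Rightarrow> (nat \<Rightarrow> nat) \<Rightarrow> nat set \<Rightarrow> bool" where
  "column_closed n r s A \<longleftrightarrow> (\<forall>u\<in>A. \<forall>v\<in>{1..n}. s v = s u \<and> r v < r u \<longrightarrow> v \<in> A)"

text \<open>The set \<open>q(A)\<close> has as many cells as \<open>A\<close> in each column, because \<open>q\<close> preserves columns, and in each
row, because \<open>p\<close> preserves rows. Compare them row by row from the top. If they agree above row \<open>i\<close>, a
cell of \<open>q(A)\<close> in row \<open>i\<close> outside \<open>A\<close> would lie in a column where \<open>A\<close> ends above row \<open>i\<close>; that column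
would contain more cells of \<open>q(A)\<close> than of \<open>A\<close>. So row \<open>i\<close> of \<open>q(A)\<close> is part of row \<open>i\<close> of \<open>A\<close>, and
they have the same size.\<close>

lemma block_rigidity:
  assumes inj: "inj_on (\<lambda>i. (r i, s i)) {1..n}" and A: "A \<subseteq> {1..n}" "column_closed n r s A"
    and p: "p \<in> fiber_perms n r" and q: "q \<in> fiber_perms n s" and pq: "p ` q ` A = A"
  shows "q ` A = A"
proof -
  define Z where "Z = q ` A"
  have pp: "p permutes {1..n}" and qp: "q permutes {1..n}" using p q fiber_perms_permutes by auto
  have Zn: "Z \<subseteq> {1..n}" using A permutes_image[OF qp] by (auto simp: Z_def)
  have fin: "finite A" "finite Z" using A Zn finite_subset by auto
  have "{u \<in> Z. s u = j} = q ` {u \<in> A. s u = j}" for j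
    using q A by (auto simp: Z_def fiber_perms_def)
  then have col: "card {u \<in> Z. s u = j} = card {u \<in> A. s u = j}" for j
    using card_image[OF inj_on_subset[OF permutes_inj[OF qp]], of "{u \<in> A. s u = j}"] by simp
  have "{u \<in> A. r u = i} = p ` {u \<in> Z. r u = i}" for i
    using p Zn pq[folded Z_def] by (auto simp: fiber_perms_def)
  then have row: "card {u \<in> A. r u = i} = card {u \<in> Z. r u = i}" for i
    using card_image[OF inj_on_subset[OF permutes_inj[OF pp]], of "{u \<in> Z. r u = i}"] by simp
  have "{u \<in> Z. r u = i} = {u \<in> A. r u = i}" for i
  proof (induction i rule: less_induct)
    case (less i)
    have "{u \<in> Z. r u = i} \<subseteq> {u \<in> A. r u = i}"
    proof (rule ccontr)
      assume "\<not> ?thesis"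
      then obtain u where u: "u \<in> Z" "r u = i" "u \<notin> A" by blast
      \<comment> \<open>the column of \<open>u\<close> would contain more of \<open>Z\<close> than of \<open>A\<close>\<close>
      have "{v \<in> A. s v = s u} \<subset> {v \<in> Z. s v = s u}"
      proof
        show "{v \<in> A. s v = s u} \<subseteq> {v \<in> Z. s v = s u}"
        proof safe
          fix v assume v: "v \<in> A" "s v = s u"
          have "r v < i"
          proof (rule ccontr)
            assume "\<not> r v < i"
            then consider "r u < r v" | "r v = r u" using u by linarith
            then show False
            proof cases
              case 1
              then show ?thesis using A(2) v u Zn by (auto simp: column_closed_def)
            next
              case 2
              have "v = u"
              proof (rule inj_onD[OF inj])
                show "v \<in> {1..n}" "u \<in> {1..n}" using v u A(1) Zn by blast+
              qed (use 2 v in simp)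
              then show ?thesis using u v by simp
            qed
          qed
          then show "v \<in> Z" using less.IH[of "r v"] v by blast
        qed
        show "{v \<in> A. s v = s u} \<noteq> {v \<in> Z. s v = s u}" using u by blast
      qed
      then have "card {v \<in> A. s v = s u} < card {v \<in> Z. s v = s u}"
        using fin by (intro psubset_card_mono) auto
      then show False using col by simp
    qed
    then show ?case using row fin by (intro card_subset_eq) auto
  qed
  then show ?thesis by (auto simp: Z_def[symmetric])
qed

text \<open>By rigidity, only those factorisations of an element of \<open>S\<^sub>a \<times> S\<^sub>b\<close> count in which both factors
are in \<open>S\<^sub>a \<times> S\<^sub>b\<close>, and these are pairs of factorisations of its two components.\<close>

theorem symmetrizer_restricts_to_blocks:
  assumes inj: "inj_on (\<lambda>i. (r i, s i)) {1..a + b}" and closed: "column_closed (a + b) r s {1..a}"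
    and g: "g \<in> block_perms a b"
  shows "tableau_symmetrizer (a + b) r s g =
    tableau_symmetrizer a r s (left_part a g) * tableau_symmetrizer b (\<lambda>i. r (a + i)) (\<lambda>i. s (a + i)) (right_part a b g)"
proof -
  let ?R = "fiber_perms (a + b) r" and ?R1 = "fiber_perms a r" and ?R2 = "fiber_perms b (\<lambda>i. r (a + i))"
  let ?s2 = "\<lambda>i. s (a + i)"
  let ?g1 = "left_part a g" and ?g2 = "right_part a b g"
  have gp: "g permutes {1..a + b}" "g ` {1..a} = {1..a}" using g by (auto simp: block_perms_def)
  note g12 = left_part_permutes[OF g] right_part_permutes[OF g]
  have "tableau_symmetrizer (a + b) r s g = (\<Sum>p\<in>?R \<inter> block_perms a b. fiber_sign (a + b) s (p \<circ> g))"
    unfolding tableau_symmetrizer_def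
  proof (rule sum.mono_neutral_right)
    show "\<forall>p\<in>?R - ?R \<inter> block_perms a b. fiber_sign (a + b) s (p \<circ> g) = 0"
    proof (rule ballI, rule ccontr)
      fix p assume p: "p \<in> ?R - ?R \<inter> block_perms a b" and "fiber_sign (a + b) s (p \<circ> g) \<noteq> 0"
      then have q: "p \<circ> g \<in> fiber_perms (a + b) s" by (auto simp: fiber_sign_def split: if_splits)
      have pp: "p permutes {1..a + b}" using p fiber_perms_permutes by blast
      have "inv' p ` (p \<circ> g) ` {1..a} = (inv' p \<circ> p) ` g ` {1..a}" by (simp add: image_comp comp_assoc)
      then have "inv' p ` (p \<circ> g) ` {1..a} = {1..a}" using permutes_inv_o(2)[OF pp] gp(2) by simp
      then have "(p \<circ> g) ` {1..a} = {1..a}"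
        using p q by (intro block_rigidity[OF inj _ closed fiber_perms_inv]) auto
      moreover have "(p \<circ> g) ` {1..a} = p ` (g ` {1..a})" by (simp only: image_comp)
      ultimately have "p ` {1..a} = {1..a}" using gp(2) by simp
      then show False using p pp by (auto simp: block_perms_def)
    qed
  qed auto
  also have "\<dots> = (\<Sum>(p1, p2)\<in>?R1 \<times> ?R2. fiber_sign a s (p1 \<circ> ?g1) * fiber_sign b ?s2 (p2 \<circ> ?g2))"
  proof (rule sum.reindex_bij_witness[where j = "\<lambda>p. (left_part a p, right_part a b p)" and i = "\<lambda>(p1, p2). join_perms a p1 p2"])
    fix p assume p: "p \<in> ?R \<inter> block_perms a b"
    then have pb: "p \<in> block_perms a b" by simp
    note parts = left_part_permutes[OF pb] right_part_permutes[OF pb]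
    show "(case (left_part a p, right_part a b p) of (p1, p2) \<Rightarrow> join_perms a p1 p2) = p"
      using join_parts[OF pb] by simp
    show "(left_part a p, right_part a b p) \<in> ?R1 \<times> ?R2"
      using p join_fiber_iff[OF parts, of r] join_parts[OF pb] by simp
    have "p \<circ> g = join_perms a (left_part a p \<circ> ?g1) (right_part a b p \<circ> ?g2)"
      using join_comp[OF g12, of "left_part a p" "right_part a b p"] join_parts[OF pb] join_parts[OF g] by simp
    then show "(case (left_part a p, right_part a b p) of (p1, p2) \<Rightarrow>
        fiber_sign a s (p1 \<circ> ?g1) * fiber_sign b ?s2 (p2 \<circ> ?g2)) = fiber_sign (a + b) s (p \<circ> g)"
      using parts g12 by (simp add: fiber_sign_join permutes_compose)
  next
    fix pq assume "pq \<in> ?R1 \<times> ?R2"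
    then obtain p1 p2 where pq: "pq = (p1, p2)" "p1 \<in> ?R1" "p2 \<in> ?R2" by blast
    then have perms: "p1 permutes {1..a}" "p2 permutes {1..b}" using fiber_perms_permutes by blast+
    show "(\<lambda>p. (left_part a p, right_part a b p)) (case pq of (p1, p2) \<Rightarrow> join_perms a p1 p2) = pq"
      using pq perms by (simp add: left_join right_join)
    show "(case pq of (p1, p2) \<Rightarrow> join_perms a p1 p2) \<in> ?R \<inter> block_perms a b"
      using pq join_fiber_iff[OF perms, of r] join_block[OF perms] by simp
  qed
  also have "\<dots> = tableau_symmetrizer a r s ?g1 * tableau_symmetrizer b (\<lambda>i. r (a + i)) ?s2 ?g2"
    by (simp add: tableau_symmetrizer_def sum_product sum.cartesian_product)
  finally show ?thesis .
qed

text \<open>The outer tensor product of two functions, extended by zero to \<open>S\<^sub>a\<^sub>+\<^sub>b\<close>.\<close>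

definition block_prod ::
    "nat \<Rightarrow> nat \<Rightarrow> ((nat \<Rightarrow> nat) \<Rightarrow> complex) \<Rightarrow> ((nat \<Rightarrow> nat) \<Rightarrow> complex) \<Rightarrow> (nat \<Rightarrow> nat) \<Rightarrow> complex" where
  "block_prod a b f g = (\<lambda>h. if h \<in> block_perms a b then f (left_part a h) * g (right_part a b h) else 0)"

definition restrict_to :: "'a set \<Rightarrow> ('a \<Rightarrow> complex) \<Rightarrow> 'a \<Rightarrow> complex" where
  "restrict_to H f = (\<lambda>h. if h \<in> H then f h else 0)"

lemma subspace_restrict_to: "cfun.subspace V \<Longrightarrow> cfun.subspace (restrict_to H ` V)"
proof (rule cfun.subspaceI)
  assume V: "cfun.subspace V"
  have "restrict_to H 0 = 0" by (simp add: restrict_to_def fun_eq_iff)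
  then show "0 \<in> restrict_to H ` V" using cfun.subspace_0[OF V] by (metis imageI)
  show "f + g \<in> restrict_to H ` V" if "f \<in> restrict_to H ` V" "g \<in> restrict_to H ` V" for f g
  proof -
    from that obtain f' g' where "f = restrict_to H f'" "g = restrict_to H g'" "f' \<in> V" "g' \<in> V" by blast
    then have "f + g = restrict_to H (f' + g')" "f' + g' \<in> V"
      using cfun.subspace_add[OF V] by (auto simp: restrict_to_def fun_eq_iff)
    then show ?thesis by blast
  qed
  have "(\<lambda>x. c * restrict_to H f x) = restrict_to H (\<lambda>x. c * f x)" for f c by (auto simp: restrict_to_def fun_eq_iff)
  then show "(\<lambda>x. c * f x) \<in> restrict_to H ` V" if "f \<in> restrict_to H ` V" for c f
    using that cfun.subspace_scale[OF V] by auto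
qed

lemma block_prod_linear:
  "block_prod a b (f + f') g = block_prod a b f g + block_prod a b f' g"
  "block_prod a b (\<lambda>x. c * f x) g = (\<lambda>x. c * block_prod a b f g x)"
  "block_prod a b f (g + g') = block_prod a b f g + block_prod a b f g'"
  "block_prod a b f (\<lambda>x. c * g x) = (\<lambda>x. c * block_prod a b f g x)"
  by (auto simp: block_prod_def fun_eq_iff algebra_simps)

theorem block_prod_tableau_space:
  assumes inj: "inj_on (\<lambda>i. (r i, s i)) {1..a + b}" and closed: "column_closed (a + b) r s {1..a}"
    and f: "f \<in> tableau_space a r s" and g: "g \<in> tableau_space b (\<lambda>i. r (a + i)) (\<lambda>i. s (a + i))"
  shows "block_prod a b f g \<in> restrict_to (block_perms a b) ` tableau_space (a + b) r s"
proof (rule span_bilinear[where M = "block_prod a b", OF subspace_restrict_to _ block_prod_linear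
      f[unfolded tableau_space_def two_sided_span_def] g[unfolded tableau_space_def two_sided_span_def]])
  show "cfun.subspace (tableau_space (a + b) r s)" using tableau_space_two_sided by (auto simp: two_sided_def)
  fix f g
  assume "f \<in> {translate (sym_group a) x y (tableau_symmetrizer a r s) |x y. x \<in> carrier (sym_group a) \<and> y \<in> carrier (sym_group a)}"
    and "g \<in> {translate (sym_group b) x y (tableau_symmetrizer b (\<lambda>i. r (a + i)) (\<lambda>i. s (a + i))) |x y.
      x \<in> carrier (sym_group b) \<and> y \<in> carrier (sym_group b)}"
  then obtain x1 y1 x2 y2 where f: "f = translate (sym_group a) x1 y1 (tableau_symmetrizer a r s)"
    and g: "g = translate (sym_group b) x2 y2 (tableau_symmetrizer b (\<lambda>i. r (a + i)) (\<lambda>i. s (a + i)))"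
    and perms: "x1 permutes {1..a}" "y1 permutes {1..a}" "x2 permutes {1..b}" "y2 permutes {1..b}"
    by (auto simp: sym_group_simps)
  let ?x = "join_perms a x1 x2" and ?y = "join_perms a y1 y2"
  have xy: "?x \<in> block_perms a b" "?y \<in> block_perms a b" using perms by (auto intro: join_block)
  have "block_prod a b f g h = restrict_to (block_perms a b) (translate (sym_group (a + b)) ?x ?y (tableau_symmetrizer (a + b) r s)) h" for h
  proof (cases "h \<in> block_perms a b")
    case True
    have "?x \<circ> h \<circ> ?y \<in> block_perms a b" using True xy by (intro block_perms_comp)
    moreover have "left_part a (?x \<circ> h \<circ> ?y) = x1 \<circ> left_part a h \<circ> y1"
      "right_part a b (?x \<circ> h \<circ> ?y) = x2 \<circ> right_part a b h \<circ> y2"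
      using True xy perms by (simp_all add: parts_comp[of _ a b] block_perms_comp left_join right_join)
    moreover have "h permutes {1..a + b}" using True by (simp add: block_perms_def)
    ultimately show ?thesis
      using True left_part_permutes[OF True] right_part_permutes[OF True]
      by (simp add: restrict_to_def block_prod_def translate_sym symmetrizer_restricts_to_blocks[OF inj closed] f g)
  qed (simp add: restrict_to_def block_prod_def)
  then have eq: "block_prod a b f g = restrict_to (block_perms a b) (translate (sym_group (a + b)) ?x ?y (tableau_symmetrizer (a + b) r s))" ..
  show "block_prod a b f g \<in> restrict_to (block_perms a b) ` tableau_space (a + b) r s"
    unfolding eq using xy
    by (intro imageI fin_group.two_sided_translate[OF sym_group_fin tableau_space_two_sided symmetrizer_in_tableau_space])
       (auto simp: sym_group_simps block_perms_def)
qed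

lemma block_prod_product_span:
  assumes V: "\<And>f g. f \<in> U1 \<Longrightarrow> g \<in> U2 \<Longrightarrow> block_prod a b f g \<in> restrict_to (block_perms a b) ` V"
    and f: "f \<in> product_span U1 U1" and g: "g \<in> product_span U2 U2"
  shows "block_prod a b f g \<in> restrict_to (block_perms a b) ` product_span V V"
proof (rule span_bilinear[where M = "block_prod a b", OF subspace_restrict_to[OF product_span_subspace] _ block_prod_linear
      f[unfolded product_span_def] g[unfolded product_span_def]])
  fix f g assume "f \<in> {f * g |f g. f \<in> U1 \<and> g \<in> U1}" "g \<in> {f * g |f g. f \<in> U2 \<and> g \<in> U2}"
  then obtain f1 f2 g1 g2 where fg: "f = f1 * f2" "g = g1 * g2" "f1 \<in> U1" "f2 \<in> U1" "g1 \<in> U2" "g2 \<in> U2" by blast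
  obtain F1 F2 where F: "F1 \<in> V" "F2 \<in> V" "block_prod a b f1 g1 = restrict_to (block_perms a b) F1"
    "block_prod a b f2 g2 = restrict_to (block_perms a b) F2"
    using V[OF fg(3,5)] V[OF fg(4,6)] by blast
  have "block_prod a b f g = block_prod a b f1 g1 * block_prod a b f2 g2"
    by (auto simp: fg block_prod_def fun_eq_iff)
  also have "\<dots> = restrict_to (block_perms a b) (F1 * F2)"
    unfolding F(3,4) by (auto simp: restrict_to_def fun_eq_iff)
  finally show "block_prod a b f g \<in> restrict_to (block_perms a b) ` product_span V V"
    using product_span_in[OF F(1,2)] by blast
qed

section \<open>Two-row representations\<close>

lemma ex_permutes_image:
  assumes U: "finite U" "P \<subseteq> U" "Q \<subseteq> U" "card P = card Q"
  shows "\<exists>h. h permutes U \<and> h ` P = Q"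
proof -
  have fin: "finite P" "finite Q" using U finite_subset by auto
  obtain f where f: "bij_betw f P Q" using finite_same_card_bij[OF fin U(4)] by blast
  have "card (U - P) = card (U - Q)" using U fin by (simp add: card_Diff_subset)
  then obtain g where g: "bij_betw g (U - P) (U - Q)"
    using finite_same_card_bij[of "U - P" "U - Q"] U(1) by auto
  define h where "h x = (if x \<in> P then f x else if x \<in> U then g x else x)" for x
  have "bij_betw h P Q" using f by (rule bij_betw_cong[THEN iffD1, rotated]) (simp add: h_def)
  moreover have "bij_betw h (U - P) (U - Q)"
    using g by (rule bij_betw_cong[THEN iffD1, rotated]) (simp add: h_def)
  ultimately have "bij_betw h (P \<union> (U - P)) (Q \<union> (U - Q))" by (rule bij_betw_combine) auto
  moreover have "P \<union> (U - P) = U" "Q \<union> (U - Q) = U" using U by auto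
  ultimately have "bij_betw h U U" by simp
  then have "h permutes U" by (rule bij_imp_permutes) (use U in \<open>auto simp: h_def\<close>)
  moreover have "h ` P = Q" using \<open>bij_betw h P Q\<close> by (simp add: bij_betw_def)
  ultimately show ?thesis by blast
qed

text \<open>\<open>S \<inter> B\<close> is moved by a permutation of \<open>B\<close> and \<open>S - B\<close> by one of the complement.\<close>

lemma ex_permutes_two_images:
  assumes U: "finite U" "B \<subseteq> U" "S \<subseteq> U" "S' \<subseteq> U" "card S = card S'" "card (S \<inter> B) = card (S' \<inter> B)"
  shows "\<exists>h. h permutes U \<and> h ` B = B \<and> h ` S = S'"
proof -
  note fin = finite_subset[OF U(3,1)] finite_subset[OF U(4,1)] finite_subset[OF U(2,1)]
  obtain h1 where h1: "h1 permutes B" "h1 ` (S \<inter> B) = S' \<inter> B"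
    using ex_permutes_image[of B "S \<inter> B" "S' \<inter> B"] fin U by auto
  have "card (S - B) = card (S' - B)"
    using U fin by (simp add: card_Diff_subset_Int)
  then obtain h2 where h2: "h2 permutes (U - B)" "h2 ` (S - B) = S' - B"
    using ex_permutes_image[OF finite_Diff[OF U(1)] Diff_mono[OF U(3) subset_refl] Diff_mono[OF U(4) subset_refl]]
    by blast
  have "h1 \<circ> h2 permutes U"
    using permutes_compose[OF permutes_subset[OF h2(1)] permutes_subset[OF h1(1)]] U by auto
  moreover have id1: "h1 ` X = X" if "X \<subseteq> U - B" for X
    using permutes_not_in[OF h1(1)] that by force
  have id2: "h2 ` X = X" if "X \<subseteq> B" for X
    using permutes_not_in[OF h2(1)] that by force
  have comp: "(h1 \<circ> h2) ` X = h1 ` (h2 ` X)" for X by (simp only: image_comp)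
  have "(h1 \<circ> h2) ` B = B" unfolding comp using id2[of B] permutes_image[OF h1(1)] by simp
  moreover have "(h1 \<circ> h2) ` S = S'"
  proof -
    have "(h1 \<circ> h2) ` (S \<inter> B) = S' \<inter> B" unfolding comp using id2[of "S \<inter> B"] h1(2) by simp
    moreover have "(h1 \<circ> h2) ` (S - B) = S' - B" unfolding comp h2(2) using U(4) by (intro id1) blast
    moreover have "S = (S \<inter> B) \<union> (S - B)" "S' = (S' \<inter> B) \<union> (S' - B)" by auto
    ultimately show ?thesis by (metis image_Un)
  qed
  ultimately show ?thesis by blast
qed

lemma permutes_same_image:
  assumes "p permutes U" "q permutes U" "p ` B = q ` B"
  obtains h where "h permutes U" "h ` B = B" "p = q \<circ> h"
proof
  show "inv' q \<circ> p permutes U" using assms by (intro permutes_compose permutes_inv)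
  have "(inv' q \<circ> p) ` B = inv' q ` (q ` B)" using assms(3) by (simp only: image_comp[symmetric])
  also have "\<dots> = (inv' q \<circ> q) ` B" by (simp only: image_comp)
  finally show "(inv' q \<circ> p) ` B = B" using permutes_inv_o(2)[OF assms(2)] by simp
  show "p = q \<circ> (inv' q \<circ> p)"
    unfolding comp_assoc[symmetric] permutes_inv_o(1)[OF assms(2)] by simp
qed

text \<open>The entries of the second row in the standard filling of the diagram \<open>(n - b, b)\<close>.\<close>

definition last_block :: "nat \<Rightarrow> nat \<Rightarrow> nat set" where
  "last_block n b = {n - b + 1..n}"

definition two_row_row :: "nat \<Rightarrow> nat \<Rightarrow> nat \<Rightarrow> nat" where
  "two_row_row n b x = (if x \<in> last_block n b then 1 else 0)"

definition two_row_col :: "nat \<Rightarrow> nat \<Rightarrow> nat \<Rightarrow> nat" where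
  "two_row_col n b x = (if x \<in> last_block n b then x - (n - b) else x)"

definition two_row_symmetrizer :: "nat \<Rightarrow> nat \<Rightarrow> (nat \<Rightarrow> nat) \<Rightarrow> complex" where
  "two_row_symmetrizer n b = tableau_symmetrizer n (two_row_row n b) (two_row_col n b)"

lemma card_last_block: "b \<le> n \<Longrightarrow> card (last_block n b) = b"
  by (simp add: last_block_def)

lemma last_block_subset: "last_block n b \<subseteq> {1..n}"
  by (auto simp: last_block_def)

text \<open>An element of the column group is a product of the transpositions of the two entries of some of the
columns, one for each entry of the second row that it moves.\<close>

lemma sign_two_row_col:
  assumes b: "2 * b \<le> n" and q: "q \<in> fiber_perms n (two_row_col n b)"
  shows "sign q = (-1) ^ card {x \<in> last_block n b. q x \<notin> last_block n b}"
  using q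
proof (induction "card {x \<in> last_block n b. q x \<notin> last_block n b}" arbitrary: q)
  let ?B = "last_block n b"
  have fin: "finite {x \<in> ?B. q x \<notin> ?B}" for q by (simp add: last_block_def)
  have col_inj: "x = y" if "two_row_col n b x = two_row_col n b y" "x \<in> ?B \<longleftrightarrow> y \<in> ?B" for x y
    using that by (auto simp: two_row_col_def last_block_def split: if_splits)
  {
    case (0 q)
    have qp: "q permutes {1..n}" using 0(2) by (rule fiber_perms_permutes)
    have "{x \<in> ?B. q x \<notin> ?B} = {}" using 0(1) fin by (metis card_eq_0_iff)
    then have into: "q ` ?B \<subseteq> ?B" by auto
    then have "q ` ?B = ?B"
      using permutes_inj[OF qp] by (intro endo_inj_surj) (auto simp: last_block_def inj_on_def inj_def)
    then have iff: "q x \<in> ?B \<longleftrightarrow> x \<in> ?B" for x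
      using inj_image_mem_iff[OF permutes_inj[OF qp], of x ?B] by simp
    have "q x = x" for x
    proof (cases "x \<in> {1..n}")
      case True
      then have "two_row_col n b (q x) = two_row_col n b x" using 0(2) unfolding fiber_perms_def by blast
      then show ?thesis using iff by (rule col_inj)
    qed (rule permutes_not_in[OF qp])
    then have "q = id" by auto
    then show ?case by simp
  next
    case (Suc m q)
    have qp: "q permutes {1..n}" using Suc(3) by (rule fiber_perms_permutes)
    have col: "two_row_col n b (q x) = two_row_col n b x" if "x \<in> {1..n}" for x
      using Suc(3) that by (simp add: fiber_perms_def)
    have "{x \<in> ?B. q x \<notin> ?B} \<noteq> {}" using Suc(2) by (metis card.empty nat.distinct(1))
    then obtain y where y: "y \<in> ?B" "q y \<notin> ?B" by blast
    define z where "z = y - (n - b)"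
    have yn: "y \<in> {1..n}" and zn: "z \<in> {1..n}" and zB: "z \<notin> ?B" and yz: "y \<noteq> z" and zcol: "two_row_col n b z = z"
      using y b by (auto simp: z_def last_block_def two_row_col_def)
    have ycol: "two_row_col n b y = z" using y by (simp add: two_row_col_def z_def)
    have qy: "q y = z"
      using col[OF yn] y by (simp add: two_row_col_def z_def)
    have "q z \<noteq> q y" using inj_eq[OF permutes_inj[OF qp]] yz by auto
    then have qzz: "q z \<noteq> z" using qy by simp
    have qzB: "q z \<in> ?B" using col[OF zn] zB qzz by (auto simp: two_row_col_def split: if_splits)
    have "q z - (n - b) = y - (n - b)"
      using col[OF zn] zcol qzB by (simp add: two_row_col_def z_def)
    then have qz: "q z = y"
      using qzB y(1) unfolding last_block_def atLeastAtMost_iff by arith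
    define q' where "q' = q \<circ> transpose y z"
    have tp: "transpose y z permutes {1..n}" using yn zn by (rule permutes_swap_id)
    have "transpose y z \<in> fiber_perms n (two_row_col n b)"
      using tp zcol ycol by (auto simp: fiber_perms_def transpose_def)
    then have q'C: "q' \<in> fiber_perms n (two_row_col n b)" unfolding q'_def using Suc(3) by (intro fiber_perms_comp)
    have q'_val: "q' x = (if x = y then y else if x = z then z else q x)" for x
      using qy qz by (simp add: q'_def transpose_def)
    have "{x \<in> ?B. q' x \<notin> ?B} = {x \<in> ?B. q x \<notin> ?B} - {y}"
      using y zB by (auto simp: q'_val)
    then have "card {x \<in> ?B. q' x \<notin> ?B} = m"
      using Suc(2) y fin[of q] by (simp add: card_Diff_singleton)
    then have "sign q' = (-1) ^ m" using Suc(1)[of q'] q'C by simp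
    moreover have "sign q' = - sign q"
      unfolding q'_def using perm_sign_comp[OF qp tp] yz by (simp add: sign_swap_id)
    ultimately have "sign q = (-1) ^ Suc m" by simp
    then show ?case using Suc(2) by simp
  }
qed

lemma card_fiber_perms: "card (fiber_perms n r) \<noteq> 0"
  by (metis card_0_eq empty_iff fiber_perms_id finite_fiber_perms)

text \<open>The symmetrizer is a sum of left translates of the signed column sum by the row group, and \<open>v\<close> is
invariant under these translations.\<close>

lemma inner_two_row_symmetrizer:
  assumes v: "\<And>g h. g permutes {1..n} \<Longrightarrow> h permutes {1..n} \<Longrightarrow> h ` last_block n b = last_block n b \<Longrightarrow> v (h \<circ> g) = v g"
  shows "inner_on (carrier (sym_group n)) v (two_row_symmetrizer n b) =
    of_nat (card (fiber_perms n (two_row_row n b))) * (\<Sum>q\<in>fiber_perms n (two_row_col n b). of_int (sign q) * v q)"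
proof -
  let ?R = "fiber_perms n (two_row_row n b)"
  have R_block: "p ` last_block n b = last_block n b" if p: "p \<in> ?R" for p
  proof -
    have "{x \<in> {1..n}. two_row_row n b x = 1} = last_block n b"
      using last_block_subset[of n b] by (auto simp: two_row_row_def split: if_splits)
    moreover have "p ` {x \<in> {1..n}. two_row_row n b x = 1} = {x \<in> {1..n}. two_row_row n b x = 1}"
      using p fiber_perms_setwise[of "two_row_row n b" n UNIV] by blast
    ultimately show ?thesis by simp
  qed
  have "inner_on (carrier (sym_group n)) v (two_row_symmetrizer n b) =
      (\<Sum>g | g permutes {1..n}. \<Sum>p\<in>?R. fiber_sign n (two_row_col n b) (p \<circ> g) * v g)"
    unfolding inner_on_def sym_group_carrier_eq two_row_symmetrizer_def symmetrizer_real
    by (simp add: tableau_symmetrizer_def sum_distrib_left mult.commute)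
  also have "\<dots> = (\<Sum>p\<in>?R. \<Sum>g | g permutes {1..n}. fiber_sign n (two_row_col n b) (p \<circ> g) * v g)"
    by (rule sum.swap)
  also have "\<dots> = (\<Sum>p\<in>?R. \<Sum>g | g permutes {1..n}. fiber_sign n (two_row_col n b) g * v g)"
  proof (rule sum.cong[OF refl])
    fix p assume p: "p \<in> ?R"
    then have pp: "p permutes {1..n}" by (rule fiber_perms_permutes)
    have "(\<Sum>g | g permutes {1..n}. fiber_sign n (two_row_col n b) (p \<circ> g) * v g) =
        (\<Sum>g | g permutes {1..n}. fiber_sign n (two_row_col n b) (p \<circ> g) * v (p \<circ> g))"
      using v[OF _ pp R_block[OF p]] by (intro sum.cong) auto
    also have "\<dots> = (\<Sum>g | g permutes {1..n}. fiber_sign n (two_row_col n b) g * v g)"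
      by (rule sum_perms_shift[OF pp, of "\<lambda>g. fiber_sign n (two_row_col n b) g * v g"])
    finally show "(\<Sum>g | g permutes {1..n}. fiber_sign n (two_row_col n b) (p \<circ> g) * v g) =
      (\<Sum>g | g permutes {1..n}. fiber_sign n (two_row_col n b) g * v g)" .
  qed
  finally show ?thesis by (simp add: sum_fiber_sign)
qed

text \<open>A function invariant on both sides under the stabiliser of \<open>B\<close> depends only on \<open>m = |g(B) \<inter> B|\<close>; let
\<open>F m\<close> be its value. The hypothesis \<open>down\<close> says that summing over all ways to enlarge a set of size
\<open>b'\<close> by one element gives \<open>0\<close>. For a set that meets \<open>B\<close> in \<open>m\<close> elements, there are \<open>b - m\<close> ways to
enlarge it inside \<open>B\<close> and \<open>n - b - (b' - m)\<close> outside, where \<open>b = Suc b'\<close>. Hence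
\<open>(b - m) F(m + 1) + (n - b - (b' - m)) F(m) = 0\<close>. Both factors are positive because \<open>2 b \<le> n\<close>, so the
values of \<open>F\<close> alternate in sign.\<close>

lemma alternating_values:
  fixes v :: "(nat \<Rightarrow> nat) \<Rightarrow> complex"
  assumes b: "2 * Suc b' \<le> n"
  defines "B \<equiv> last_block n (Suc b')"
  assumes left: "\<And>g h. g permutes {1..n} \<Longrightarrow> h permutes {1..n} \<Longrightarrow> h ` B = B \<Longrightarrow> v (h \<circ> g) = v g"
    and right: "\<And>g h. g permutes {1..n} \<Longrightarrow> h permutes {1..n} \<Longrightarrow> h ` B = B \<Longrightarrow> v (g \<circ> h) = v g"
    and down: "\<And>g. g permutes {1..n} \<Longrightarrow> (\<Sum>i\<in>{1..n - b'}. v (g \<circ> transpose i (n - b'))) = 0"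
    and i: "i \<le> Suc b'"
  shows "\<exists>c>0. \<forall>g. g permutes {1..n} \<and> card (g ` B \<inter> B) = Suc b' - i \<longrightarrow> v g = (-1) ^ i * of_real c * v id"
proof -
  define D where "D = last_block n b'"
  have B_D: "B = insert (n - b') D" "n - b' \<notin> D" using b by (auto simp: B_def D_def last_block_def)
  have subB: "B \<subseteq> {1..n}" and subD: "D \<subseteq> {1..n}" by (simp_all add: B_def D_def last_block_subset)
  have finB: "finite B" "finite D" using subB subD finite_subset by auto
  have cardB: "card B = Suc b'" and cardD: "card D = b'" using b by (simp_all add: B_def D_def card_last_block)
  have compD: "{1..n - b'} = {1..n} - D" using b by (auto simp: D_def last_block_def)
  \<comment> \<open>two sets of the same size that meet \<open>B\<close> equally are conjugate under the stabiliser of \<open>B\<close>\<close>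
  have same: "v g = v g'" if gg: "g permutes {1..n}" "g' permutes {1..n}" "card (g ` B \<inter> B) = card (g' ` B \<inter> B)" for g g'
  proof -
    have sub: "g ` B \<subseteq> {1..n}" "g' ` B \<subseteq> {1..n}"
      using subB permutes_image[OF gg(1)] permutes_image[OF gg(2)] by auto
    have "card (g ` B) = card (g' ` B)"
      using card_image[OF inj_on_subset[OF permutes_inj[OF gg(1)] subset_UNIV], of B]
        card_image[OF inj_on_subset[OF permutes_inj[OF gg(2)] subset_UNIV], of B] by simp
    then obtain h where h: "h permutes {1..n}" "h ` B = B" "h ` g ` B = g' ` B"
      using ex_permutes_two_images[OF finite_atLeastAtMost subB sub _ gg(3)] by blast
    have "(h \<circ> g) ` B = g' ` B" using h(3) by (simp only: image_comp)
    then obtain k where "k permutes {1..n}" "k ` B = B" "h \<circ> g = g' \<circ> k"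
      using permutes_same_image[OF permutes_compose[OF gg(1) h(1)] gg(2)] by metis
    then show ?thesis using left[OF gg(1) h(1,2)] right[OF gg(2)] by metis
  qed
  define F where "F m = v (SOME g. g permutes {1..n} \<and> card (g ` B \<inter> B) = m)" for m
  have v_F: "v g = F (card (g ` B \<inter> B))" if g: "g permutes {1..n}" for g
  proof -
    define g' where "g' = (SOME g'. g' permutes {1..n} \<and> card (g' ` B \<inter> B) = card (g ` B \<inter> B))"
    have "g' permutes {1..n} \<and> card (g' ` B \<inter> B) = card (g ` B \<inter> B)"
      unfolding g'_def by (rule someI[of _ g]) (simp add: g)
    then have "v g = v g'" using g by (intro same) auto
    then show ?thesis by (simp add: F_def g'_def)
  qed
  have rec: "of_nat (Suc b' - m) * F (Suc m) + of_nat (n - Suc b' - (b' - m)) * F m = 0" if m: "m \<le> b'" for m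
  proof -
    \<comment> \<open>a set \<open>T\<close> of size \<open>b'\<close> that meets \<open>B\<close> in \<open>m\<close> elements exists because \<open>b' - m \<le> n - b\<close>\<close>
    obtain T1 where T1: "T1 \<subseteq> B" "card T1 = m" using obtain_subset_with_card_n[of m B] cardB m by auto
    have "b' - m \<le> card ({1..n} - B)" using subB finB cardB b by (simp add: card_Diff_subset)
    then obtain T2 where T2: "T2 \<subseteq> {1..n} - B" "card T2 = b' - m"
      using obtain_subset_with_card_n by metis
    define T where "T = T1 \<union> T2"
    have finT: "finite T1" "finite T2" using T1 T2 finB finite_subset by blast+
    have "T1 \<inter> T2 = {}" using T1 T2 by blast
    then have "card T = b'" using T1 T2 finT m by (simp add: T_def card_Un_disjoint)
    moreover have subT: "T \<subseteq> {1..n}" using T1 T2 subB by (auto simp: T_def)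
    ultimately obtain g where g: "g permutes {1..n}" "g ` D = T"
      using ex_permutes_image[of "{1..n}" D T] subD cardD by auto
    have TB: "T \<inter> B = T1" using T1 T2 by (auto simp: T_def)
    have "(\<Sum>i\<in>{1..n - b'}. v (g \<circ> transpose i (n - b'))) = (\<Sum>i\<in>{1..n} - D. F (card (insert (g i) T \<inter> B)))"
      unfolding compD[symmetric]
    proof (rule sum.cong[OF refl])
      fix i assume i: "i \<in> {1..n - b'}"
      then have iD: "i \<notin> D" "i \<in> {1..n}" using compD by auto
      have tp: "transpose i (n - b') permutes {1..n}" using iD b by (intro permutes_swap_id) auto
      have "transpose i (n - b') ` B = insert i D"
        unfolding B_D(1) using iD(1) B_D(2) by (auto simp: transpose_def image_iff)
      then have "(g \<circ> transpose i (n - b')) ` B = insert (g i) T"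
        using g(2) by (metis image_comp image_insert)
      then show "v (g \<circ> transpose i (n - b')) = F (card (insert (g i) T \<inter> B))"
        using v_F[OF permutes_compose[OF tp g(1)]] by simp
    qed
    also have "\<dots> = (\<Sum>x\<in>{1..n} - T. F (card (insert x T \<inter> B)))"
    proof -
      have "bij_betw g ({1..n} - D) ({1..n} - T)"
        using permutes_inj[OF g(1)] permutes_image[OF g(1)] g(2)
        by (auto simp: bij_betw_def inj_on_def inj_def image_set_diff)
      then show ?thesis by (rule sum.reindex_bij_betw[where g = "\<lambda>x. F (card (insert x T \<inter> B))"])
    qed
    also have "\<dots> = (\<Sum>x\<in>(B - T1) \<union> ({1..n} - B - T2). F (card (insert x T \<inter> B)))"
      using T1 T2 subB by (intro sum.cong) (auto simp: T_def)
    also have "\<dots> = (\<Sum>x\<in>B - T1. F (card (insert x T \<inter> B))) + (\<Sum>x\<in>{1..n} - B - T2. F (card (insert x T \<inter> B)))"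
      using finB by (intro sum.union_disjoint) auto
    also have "(\<Sum>x\<in>B - T1. F (card (insert x T \<inter> B))) = (\<Sum>x\<in>B - T1. F (Suc m))"
    proof (rule sum.cong[OF refl])
      fix x assume x: "x \<in> B - T1"
      then have "insert x T \<inter> B = insert x T1" using TB by auto
      then show "F (card (insert x T \<inter> B)) = F (Suc m)" using x T1 finT by simp
    qed
    also have "(\<Sum>x\<in>{1..n} - B - T2. F (card (insert x T \<inter> B))) = (\<Sum>x\<in>{1..n} - B - T2. F m)"
      using TB T1 by (intro sum.cong) (auto simp: Int_insert_left)
    finally show ?thesis
      using down[OF g(1)] T1 T2 finT finB subB cardB by (simp add: card_Diff_subset comp_def)
  qed
  have "\<exists>c>0. F (Suc b' - i) = (-1) ^ i * of_real c * F (Suc b')"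
    using i
  proof (induction i)
    case 0
    then show ?case by (intro exI[of _ 1]) simp
  next
    case (Suc i)
    then obtain c where c: "c > 0" "F (Suc b' - i) = (-1) ^ i * of_real c * F (Suc b')" by auto
    define m where "m = b' - i"
    have m: "m \<le> b'" "Suc m = Suc b' - i" "m = Suc b' - Suc i" using Suc.prems by (auto simp: m_def)
    define x y where "x = real (Suc b' - m)" and "y = real (n - Suc b' - (b' - m))"
    have xy: "x > 0" "y > 0" using m b by (auto simp: x_def y_def)
    have "of_real y * F m = - (of_real x * F (Suc m))"
      using rec[OF m(1)] by (simp add: x_def y_def add_eq_0_iff)
    then have "F m = - (of_real (x / y) * F (Suc m))" using xy by (simp add: field_simps)
    also have "\<dots> = (-1) ^ Suc i * of_real (x / y * c) * F (Suc b')" using c m by simp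
    finally show ?case using xy c(1) m by (intro exI[of _ "x / y * c"]) simp
  qed
  moreover have "v id = F (Suc b')" using v_F[OF permutes_id] cardB by simp
  ultimately show ?thesis using v_F by metis
qed

text \<open>The functions \<open>u\<close> are those on the subsets of size \<open>b\<close>. The down operator, which sums over the
supersets of a set of size \<open>b - 1\<close>, is a combination of right translations and hence preserves \<open>M\<close>;
its result is zero by induction. If \<open>u\<close> were not zero, translating it and averaging on the left would
give a function \<open>v\<close> in \<open>M\<close> that is invariant on both sides, is killed by the down operator and does not
vanish at the identity. Its values alternate in the same way as the signs in the column sum, so there is
no cancellation in the pairing with the symmetrizer, contrary to orthogonality.\<close>

lemma right_invariant_zero:
  assumes M: "two_sided (sym_group n) M"
    and ortho: "\<And>m j. m \<in> M \<Longrightarrow> j \<le> b \<Longrightarrow> inner_on (carrier (sym_group n)) m (two_row_symmetrizer n j) = 0"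
    and b: "2 * b \<le> n" and u: "u \<in> M"
    and right: "\<And>g h. g permutes {1..n} \<Longrightarrow> h permutes {1..n} \<Longrightarrow> h ` last_block n b = last_block n b \<Longrightarrow> u (g \<circ> h) = u g"
  shows "u = 0"
  using ortho b u right
proof (induction b arbitrary: u)
  case (0 u)
  interpret fin_group "sym_group n" by (rule sym_group_fin)
  have const: "u g = u id" if "g permutes {1..n}" for g
  proof -
    have "g ` last_block n 0 = last_block n 0" by (simp add: last_block_def)
    from 0(4)[OF permutes_id that this] show ?thesis by (simp only: id_o)
  qed
  have "inner_on (carrier (sym_group n)) u (two_row_symmetrizer n 0) =
    of_nat (card (fiber_perms n (two_row_row n 0))) * (\<Sum>q\<in>fiber_perms n (two_row_col n 0). of_int (sign q) * u q)"
    by (intro inner_two_row_symmetrizer) (simp only: const permutes_compose)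
  also have "fiber_perms n (two_row_col n 0) = {id}"
  proof -
    have "q = id" if "q \<in> fiber_perms n (two_row_col n 0)" for q
    proof
      fix x
      show "q x = id x"
        using that permutes_not_in[OF fiber_perms_permutes[OF that], of x]
        by (cases "x \<in> {1..n}") (simp_all add: fiber_perms_def two_row_col_def last_block_def)
    qed
    then show ?thesis using fiber_perms_id by blast
  qed
  also have "(\<Sum>q\<in>{id}. of_int (sign q) * u q) = u id" by simp
  finally have "of_nat (card (fiber_perms n (two_row_row n 0))) * u id = 0" using 0(1)[OF 0(3), of 0] by simp
  moreover have "card (fiber_perms n (two_row_row n 0)) \<noteq> 0" by (rule card_fiber_perms)
  ultimately have "u id = 0" by simp
  have "u g = 0" for g
  proof (cases "g permutes {1..n}")
    case True
    then show ?thesis using const[OF True] \<open>u id = 0\<close> by simp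
  next
    case False
    then show ?thesis using 0(3) M by (auto simp: two_sided_def supported_on_def sym_group_simps)
  qed
  then show ?case by (simp add: fun_eq_iff)
next
  case (Suc b' u)
  interpret fin_group "sym_group n" by (rule sym_group_fin)
  let ?G = "sym_group n"
  let ?B = "last_block n (Suc b')" and ?D = "last_block n b'"
  define c where "c = n - b'"
  have B_D: "?B = insert c ?D" "c \<notin> ?D" and cn: "c \<in> {1..n}" using Suc(3) by (auto simp: c_def last_block_def)
  have compD: "{1..c} = {1..n} - ?D" using Suc(3) by (auto simp: c_def last_block_def)
  have subM: "cfun.subspace M" using M by (simp add: two_sided_def)
  have tr: "translate ?G x y m \<in> M" if "m \<in> M" "x permutes {1..n}" "y permutes {1..n}" for m x y
    using two_sided_translate[OF M] that by (simp add: sym_group_simps)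
  have swap: "transpose i c permutes {1..n}" if "i \<in> {1..c}" for i
    using that cn compD by (intro permutes_swap_id) auto
  have swap_B: "transpose i c ` ?B = insert i ?D" if "i \<in> {1..c}" for i
    unfolding B_D(1) using that compD B_D(2) by (auto simp: transpose_def image_iff)
  have down0: "(\<Sum>i\<in>{1..c}. u (g \<circ> transpose i c)) = 0" if g: "g permutes {1..n}" for g
  proof -
    \<comment> \<open>the down operator applied to \<open>u\<close>; the factor \<open>1\<close> makes \<open>subspace_sum_scaled\<close> applicable\<close>
    define d where "d = (\<lambda>g. \<Sum>i\<in>{1..c}. 1 * translate ?G id (transpose i c) u g)"
    have d_val: "d g = (\<Sum>i\<in>{1..c}. u (g \<circ> transpose i c))" if "g permutes {1..n}" for g
      using that by (simp add: d_def translate_sym)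
    have "d = 0"
    proof (rule Suc.IH)
      show "inner_on (carrier ?G) m (two_row_symmetrizer n j) = 0" if "m \<in> M" "j \<le> b'" for m j using Suc(2) that by simp
      show "2 * b' \<le> n" using Suc(3) by simp
      show "d \<in> M" unfolding d_def using swap Suc(4) by (intro subspace_sum_scaled subM tr permutes_id)
      fix g h assume g: "g permutes {1..n}" and h: "h permutes {1..n}" and hD: "h ` ?D = ?D"
      have hc: "h ` {1..c} = {1..c}"
        unfolding compD using permutes_inj[OF h] permutes_image[OF h] hD by (simp add: image_set_diff)
      have "d (g \<circ> h) = (\<Sum>i\<in>{1..c}. u (g \<circ> transpose (h i) c))"
        unfolding d_val[OF permutes_compose[OF h g]]
      proof (rule sum.cong[OF refl])
        fix i assume i: "i \<in> {1..c}"
        then have hi: "h i \<in> {1..c}" using hc by blast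
        have "(h \<circ> transpose i c) ` ?B = h ` (insert i ?D)" using swap_B[OF i] by (simp only: image_comp[symmetric])
        also have "\<dots> = transpose (h i) c ` ?B" using swap_B[OF hi] hD by simp
        finally obtain k where k: "k permutes {1..n}" "k ` ?B = ?B" "h \<circ> transpose i c = transpose (h i) c \<circ> k"
          using permutes_same_image[OF permutes_compose[OF swap[OF i] h] swap[OF hi]] by metis
        have "g \<circ> h \<circ> transpose i c = (g \<circ> transpose (h i) c) \<circ> k" using k(3) by (simp add: comp_assoc)
        then show "u (g \<circ> h \<circ> transpose i c) = u (g \<circ> transpose (h i) c)"
          using Suc(5)[OF permutes_compose[OF swap[OF hi] g] k(1,2)] by (simp only:)
      qed
      also have "\<dots> = d g"
        unfolding d_val[OF g]
        using sum.reindex[of h "{1..c}" "\<lambda>i. u (g \<circ> transpose i c)"] hc permutes_inj[OF h]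
        by (simp add: inj_on_def inj_def)
      finally show "d (g \<circ> h) = d g" .
    qed
    then show ?thesis using d_val[OF g] by simp
  qed
  show "u = 0"
  proof (rule ccontr)
    assume "u \<noteq> 0"
    then obtain g0 where g0: "u g0 \<noteq> 0" by (auto simp: fun_eq_iff)
    then have g0p: "g0 permutes {1..n}" using Suc(4) M by (auto simp: two_sided_def supported_on_def sym_group_simps)
    define H where "H = {h. h permutes {1..n} \<and> h ` ?B = ?B}"
    have finH: "finite H" by (rule finite_subset[OF _ finite_permutations[of "{1..n}"]]) (auto simp: H_def)
    have Hp: "h permutes {1..n}" if "h \<in> H" for h using that by (simp add: H_def)
    \<comment> \<open>translated by \<open>g0\<close>, so that the average does not vanish at the identity\<close>
    define v where "v = (\<lambda>g. \<Sum>h\<in>H. 1 * translate ?G (g0 \<circ> h) id u g)"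
    have v_val: "v g = (\<Sum>h\<in>H. u (g0 \<circ> h \<circ> g))" if "g permutes {1..n}" for g
      using that by (simp add: v_def translate_sym)
    have vM: "v \<in> M" unfolding v_def
      using Suc(4) Hp g0p by (intro subspace_sum_scaled subM tr permutes_id permutes_compose) auto
    have left: "v (h \<circ> g) = v g" if g: "g permutes {1..n}" and h: "h permutes {1..n}" "h ` ?B = ?B" for g h
    proof -
      have "v (h \<circ> g) = (\<Sum>k\<in>H. u (g0 \<circ> (k \<circ> h) \<circ> g))"
        using v_val[OF permutes_compose[OF g h(1)]] by (simp add: comp_assoc)
      also have "\<dots> = (\<Sum>k\<in>H. u (g0 \<circ> k \<circ> g))"
      proof (rule sum.reindex_bij_witness[where j = "\<lambda>k. k \<circ> h" and i = "\<lambda>k. k \<circ> inv' h"])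
        fix k assume k: "k \<in> H"
        have "inv' h ` ?B = inv' h ` (h ` ?B)" using h(2) by simp
        also have "\<dots> = (inv' h \<circ> h) ` ?B" by (simp only: image_comp)
        finally have "inv' h ` ?B = ?B" using permutes_inv_o(2)[OF h(1)] by simp
        moreover have "(k \<circ> inv' h) ` ?B = k ` (inv' h ` ?B)" "(k \<circ> h) ` ?B = k ` (h ` ?B)" by (simp_all only: image_comp)
        ultimately show "k \<circ> inv' h \<in> H" "k \<circ> h \<in> H"
          using k h by (auto simp: H_def permutes_compose permutes_inv)
      qed (use permutes_inv_o[OF h(1)] in \<open>simp_all add: comp_assoc\<close>)
      also have "\<dots> = v g" using v_val[OF g] by simp
      finally show ?thesis .
    qed
    have right: "v (g \<circ> h) = v g" if g: "g permutes {1..n}" and h: "h permutes {1..n}" "h ` ?B = ?B" for g h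
    proof -
      have "u (g0 \<circ> k \<circ> (g \<circ> h)) = u (g0 \<circ> k \<circ> g)" if "k \<in> H" for k
        using Suc(5)[OF permutes_compose[OF g permutes_compose[OF Hp[OF that] g0p]] h] by (simp only: comp_assoc)
      then show ?thesis using v_val[OF g] v_val[OF permutes_compose[OF h(1) g]] by simp
    qed
    have down: "(\<Sum>i\<in>{1..n - b'}. v (g \<circ> transpose i (n - b'))) = 0" if g: "g permutes {1..n}" for g
    proof -
      have "(\<Sum>i\<in>{1..c}. v (g \<circ> transpose i c)) = (\<Sum>i\<in>{1..c}. \<Sum>h\<in>H. u (g0 \<circ> h \<circ> g \<circ> transpose i c))"
        using swap g by (intro sum.cong[OF refl]) (simp add: v_val permutes_compose comp_assoc)
      also have "\<dots> = (\<Sum>h\<in>H. \<Sum>i\<in>{1..c}. u (g0 \<circ> h \<circ> g \<circ> transpose i c))" by (rule sum.swap)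
      also have "\<dots> = 0"
        using down0[of "g0 \<circ> h \<circ> g" for h] Hp g g0p by (simp add: permutes_compose)
      finally show ?thesis by (simp add: c_def)
    qed
    have vid: "v id \<noteq> 0"
    proof -
      have "u (g0 \<circ> h) = u g0" if "h \<in> H" for h using Suc(5)[OF g0p, of h] that unfolding H_def by blast
      then have "v id = of_nat (card H) * u g0" using v_val[OF permutes_id] by simp
      moreover have "id \<in> H" by (simp add: H_def permutes_id)
      then have "card H \<noteq> 0" using finH by auto
      ultimately show ?thesis using g0 by simp
    qed
    have "\<exists>e>0. of_int (sign q) * v q = of_real e * v id" if q: "q \<in> fiber_perms n (two_row_col n (Suc b'))" for q
    proof -
      have qp: "q permutes {1..n}" using q by (rule fiber_perms_permutes)
      define K where "K = {x \<in> ?B. q x \<notin> ?B}"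
      have finB: "finite ?B" by (simp add: last_block_def)
      have "q ` ?B \<inter> ?B = q ` (?B - K)" by (auto simp: K_def)
      then have "card (q ` ?B \<inter> ?B) = card (?B - K)"
        using card_image[OF inj_on_subset[OF permutes_inj[OF qp] subset_UNIV], of "?B - K"] by simp
      also have "\<dots> = Suc b' - card K"
        using finB Suc(3) by (subst card_Diff_subset) (auto simp: K_def card_last_block)
      finally have card_q: "card (q ` ?B \<inter> ?B) = Suc b' - card K" .
      have "card K \<le> card ?B" using finB by (intro card_mono) (auto simp: K_def)
      then have Kb: "card K \<le> Suc b'" using Suc(3) by (simp add: card_last_block)
      obtain e where e: "e > 0" "v q = (-1) ^ card K * of_real e * v id"
        using alternating_values[OF Suc(3) left right down Kb] card_q qp by blast
      have "of_int (sign q) * v q = of_real e * v id"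
        unfolding e(2) sign_two_row_col[OF Suc(3) q] K_def[symmetric]
        by (simp add: power_mult_distrib[symmetric] mult.assoc[symmetric])
      then show ?thesis using e(1) by blast
    qed
    then obtain e where e: "\<And>q. q \<in> fiber_perms n (two_row_col n (Suc b')) \<Longrightarrow> e q > 0"
      "\<And>q. q \<in> fiber_perms n (two_row_col n (Suc b')) \<Longrightarrow> of_int (sign q) * v q = of_real (e q) * v id"
      by metis
    define E where "E = (\<Sum>q\<in>fiber_perms n (two_row_col n (Suc b')). e q)"
    have E: "E > 0" unfolding E_def
      by (rule sum_pos[OF finite_fiber_perms _ e(1)]) (use fiber_perms_id in blast)
    have sumE: "(\<Sum>q\<in>fiber_perms n (two_row_col n (Suc b')). of_int (sign q) * v q) = of_real E * v id"
      using e(2) by (simp add: sum_distrib_right E_def)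
    have "inner_on (carrier ?G) v (two_row_symmetrizer n (Suc b')) =
        of_nat (card (fiber_perms n (two_row_row n (Suc b')))) * (of_real E * v id)"
      unfolding sumE[symmetric] by (rule inner_two_row_symmetrizer) (rule left)
    then have "inner_on (carrier ?G) v (two_row_symmetrizer n (Suc b')) \<noteq> 0"
      using E vid card_fiber_perms[of n "two_row_row n (Suc b')"]
      by (simp only: mult_eq_0_iff of_nat_eq_0_iff of_real_eq_0_iff) simp
    then show False using Suc(2)[OF vM] by simp
  qed
qed

lemma span_Union_two_sided:
  assumes "\<And>i. i \<in> I \<Longrightarrow> two_sided G (J i)"
  shows "two_sided G (cfun.span (\<Union>i\<in>I. J i))"
  unfolding two_sided_def
proof (intro conjI ballI)
  show "cfun.span (\<Union>i\<in>I. J i) \<subseteq> supported_on (carrier G)"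
    using assms by (intro cfun.span_minimal supported_on_subspace) (auto simp: two_sided_def)
  fix f x y assume f: "f \<in> cfun.span (\<Union>i\<in>I. J i)" and xy: "x \<in> carrier G" "y \<in> carrier G"
  show "translate G x y f \<in> cfun.span (\<Union>i\<in>I. J i)"
    by (rule span_linear_image[where L = "translate G x y" and f = f, OF f cfun.subspace_span _ translate_linear])
       (use assms xy in \<open>auto simp: two_sided_def intro!: cfun.span_base\<close>)
qed (rule cfun.subspace_span)

definition two_row_space :: "nat \<Rightarrow> ((nat \<Rightarrow> nat) \<Rightarrow> complex) set" where
  "two_row_space n = cfun.span (\<Union>j\<in>{..n div 2}. tableau_space n (two_row_row n j) (two_row_col n j))"

lemma two_row_space_two_sided: "two_sided (sym_group n) (two_row_space n)"
  unfolding two_row_space_def by (intro span_Union_two_sided tableau_space_two_sided)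

text \<open>The inner product of the indicator of a subgroup with \<open>m\<close> is conjugate to the value at the identity of
the average of \<open>m\<close> over the subgroup, up to a factor. For \<open>m\<close> orthogonal to all two-row coefficients,
that average is zero by \<open>right_invariant_zero\<close>.\<close>

lemma last_block_indicator:
  assumes b: "2 * b \<le> n"
  shows "(\<lambda>p. if p permutes {1..n} \<and> p ` last_block n b = last_block n b then 1 else 0) \<in> two_row_space n"
    (is "?f \<in> _")
proof -
  interpret fin_group "sym_group n" by (rule sym_group_fin)
  let ?G = "sym_group n" and ?J = "two_row_space n" and ?B = "last_block n b"
  have J: "two_sided ?G ?J" by (rule two_row_space_two_sided)
  define M where "M = {m \<in> supported_on (carrier ?G). \<forall>v\<in>?J. inner_on (carrier ?G) m v = 0}"
  have M: "two_sided ?G M" unfolding M_def by (rule orthogonal_two_sided[OF J])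
  define H where "H = {h. h permutes {1..n} \<and> h ` ?B = ?B}"
  have sym_J: "two_row_symmetrizer n j \<in> ?J" if "j \<le> b" for j
    unfolding two_row_space_def two_row_symmetrizer_def using that b symmetrizer_in_tableau_space
    by (intro cfun.span_base) force
  show ?thesis
  proof (rule in_subspace_if_ortho[OF fin])
    show "cfun.subspace ?J" "?J \<subseteq> supported_on (carrier ?G)" using J by (auto simp: two_sided_def)
    show "?f \<in> supported_on (carrier ?G)" by (simp add: supported_on_def sym_group_simps)
    fix m assume m: "m \<in> supported_on (carrier ?G)" "\<And>v. v \<in> ?J \<Longrightarrow> inner_on (carrier ?G) m v = 0"
    then have mM: "m \<in> M" by (simp add: M_def)
    define w where "w = (\<lambda>g. \<Sum>h\<in>H. 1 * translate ?G id h m g)"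
    have w_val: "w g = (\<Sum>h\<in>H. m (g \<circ> h))" if "g permutes {1..n}" for g
      using that by (simp add: w_def translate_sym)
    have "w = 0"
    proof (rule right_invariant_zero[OF M _ b])
      show "inner_on (carrier ?G) m (two_row_symmetrizer n j) = 0" if "m \<in> M" "j \<le> b" for m j
        using that sym_J by (simp add: M_def)
      show "w \<in> M" unfolding w_def
        using two_sided_translate[OF M mM] M
        by (intro subspace_sum_scaled) (auto simp: two_sided_def H_def sym_group_simps permutes_id)
      fix g h assume g: "g permutes {1..n}" and h: "h permutes {1..n}" "h ` ?B = ?B"
      have "w (g \<circ> h) = (\<Sum>k\<in>H. m (g \<circ> (h \<circ> k)))"
        using w_val[OF permutes_compose[OF h(1) g]] by (simp add: comp_assoc)
      also have "\<dots> = (\<Sum>k\<in>H. m (g \<circ> k))"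
      proof (rule sum.reindex_bij_witness[where j = "\<lambda>k. h \<circ> k" and i = "\<lambda>k. inv' h \<circ> k"])
        fix k assume k: "k \<in> H"
        have "inv' h ` ?B = inv' h ` (h ` ?B)" using h(2) by simp
        also have "\<dots> = (inv' h \<circ> h) ` ?B" by (simp only: image_comp)
        finally have "inv' h ` ?B = ?B" using permutes_inv_o(2)[OF h(1)] by simp
        moreover have "(inv' h \<circ> k) ` ?B = inv' h ` (k ` ?B)" "(h \<circ> k) ` ?B = h ` (k ` ?B)" by (simp_all only: image_comp)
        ultimately show "inv' h \<circ> k \<in> H" "h \<circ> k \<in> H"
          using k h by (auto simp: H_def permutes_compose permutes_inv)
      qed (use permutes_inv_o[OF h(1)] in \<open>simp_all add: comp_assoc[symmetric]\<close>)
      finally show "w (g \<circ> h) = w g" using w_val[OF g] by simp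
    qed
    then have "(\<Sum>h\<in>H. m h) = 0" using w_val[OF permutes_id] by simp
    moreover have "inner_on (carrier ?G) ?f m = cnj (\<Sum>h\<in>H. m h)"
    proof -
      have "inner_on (carrier ?G) ?f m = (\<Sum>h\<in>carrier ?G. if h \<in> H then cnj (m h) else 0)"
        unfolding inner_on_def by (intro sum.cong) (auto simp: H_def sym_group_simps)
      also have "\<dots> = (\<Sum>h\<in>H. cnj (m h))"
        using fin by (simp add: sum.inter_filter[symmetric]) (rule sum.cong, auto simp: H_def sym_group_simps)
      finally show ?thesis by simp
    qed
    ultimately show "inner_on (carrier ?G) ?f m = 0" by simp
  qed
qed

text \<open>Translates of the indicator of a stabiliser settle sets of at most half the size; larger sets are
replaced by their complements.\<close>

theorem set_transport_indicator:
  assumes B: "B0 \<subseteq> {1..n}" "B1 \<subseteq> {1..n}" "card B0 = card B1"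
  shows "(\<lambda>p. if p permutes {1..n} \<and> p ` B0 = B1 then 1 else 0) \<in> two_row_space n"
proof -
  have small: "(\<lambda>p. if p permutes {1..n} \<and> p ` C0 = C1 then 1 else 0) \<in> two_row_space n"
    if C: "C0 \<subseteq> {1..n}" "C1 \<subseteq> {1..n}" "card C0 = card C1" "2 * card C0 \<le> n" for C0 C1
  proof -
    let ?B = "last_block n (card C0)"
    have cB: "card ?B = card C0" using C(4) by (simp add: card_last_block)
    obtain y where y: "y permutes {1..n}" "y ` ?B = C0"
      using ex_permutes_image[OF finite_atLeastAtMost last_block_subset C(1) cB] by blast
    have "card C1 = card ?B" using cB C(3) by simp
    then obtain x where x: "x permutes {1..n}" "x ` C1 = ?B"
      using ex_permutes_image[OF finite_atLeastAtMost C(2) last_block_subset] by blast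
    have "(\<lambda>p. if p permutes {1..n} \<and> p ` C0 = C1 then 1 else 0) =
        translate (sym_group n) x y (\<lambda>p. if p permutes {1..n} \<and> p ` ?B = ?B then 1 else 0)"
    proof
      fix p
      show "(if p permutes {1..n} \<and> p ` C0 = C1 then 1 else 0) =
        translate (sym_group n) x y (\<lambda>p. if p permutes {1..n} \<and> p ` ?B = ?B then 1 else 0) p"
      proof (cases "p permutes {1..n}")
        case True
        have "(x \<circ> p \<circ> y) ` ?B = x ` (p ` C0)" using y(2) by (simp only: image_comp[symmetric])
        moreover have "x ` (p ` C0) = ?B \<longleftrightarrow> p ` C0 = C1"
          using x(2) inj_image_eq_iff[OF permutes_inj[OF x(1)]] by metis
        moreover have "x \<circ> p \<circ> y permutes {1..n}" using True x y by (simp add: permutes_compose)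
        ultimately show ?thesis using True by (simp add: translate_sym)
      qed (simp add: translate_def sym_group_simps)
    qed
    also have "\<dots> \<in> two_row_space n"
      using fin_group.two_sided_translate[OF sym_group_fin two_row_space_two_sided last_block_indicator[OF C(4)]] x(1) y(1)
      by (simp add: sym_group_simps)
    finally show ?thesis .
  qed
  show ?thesis
  proof (cases "2 * card B0 \<le> n")
    case False
    have fin: "finite B0" "finite B1" using B finite_subset by auto
    have "card ({1..n} - B0) = card ({1..n} - B1)" "2 * card ({1..n} - B0) \<le> n"
      using False B fin by (auto simp: card_Diff_subset)
    then have "(\<lambda>p. if p permutes {1..n} \<and> p ` ({1..n} - B0) = {1..n} - B1 then 1 else 0) \<in> two_row_space n"
      by (intro small) auto
    moreover have "p ` ({1..n} - B0) = {1..n} - B1 \<longleftrightarrow> p ` B0 = B1" if p: "p permutes {1..n}" for p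
    proof -
      have "p ` ({1..n} - B0) = {1..n} - p ` B0"
        using permutes_image[OF p] permutes_inj[OF p] by (simp add: image_set_diff)
      moreover have "p ` B0 \<subseteq> {1..n}" using B(1) permutes_image[OF p] by auto
      ultimately show ?thesis using double_diff[OF _ subset_refl] B(2) by metis
    qed
    then have "(\<lambda>p. if p permutes {1..n} \<and> p ` ({1..n} - B0) = {1..n} - B1 then 1 else 0 :: complex) =
      (\<lambda>p. if p permutes {1..n} \<and> p ` B0 = B1 then 1 else 0)" by (auto simp: fun_eq_iff)
    ultimately show ?thesis by simp
  qed (use small B in blast)
qed

text \<open>For \<open>j = 0\<close> the zero part is dropped and the partition is \<open>(n)\<close>, or empty if \<open>n = 0\<close>.\<close>

lemma coeffs_two_row:
  assumes j: "j \<le> n div 2"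
  shows "sum_list (partition_of [j, n - j]) = n"
    "coeffs (sym_group n) (sigma (partition_of [j, n - j])) = tableau_space n (two_row_row n j) (two_row_col n j)"
proof -
  define X :: "(nat \<times> nat) set" where "X = {0} \<times> {1..n - j} \<union> {1} \<times> {1..j}"
  have bij: "bij_betw (\<lambda>i. (two_row_row n j i, two_row_col n j i)) {1..n} X"
    by (rule bij_betw_byWitness[where f' = "\<lambda>(r, c). if r = 0 then c else c + (n - j)"])
       (use j in \<open>auto simp: X_def two_row_row_def two_row_col_def last_block_def\<close>)
  have inj: "inj_on id (fst ` X)" "inj_on (\<lambda>c. c - 1) (snd ` X)"
    by (auto simp: X_def inj_on_def)
  have shift: "(\<lambda>c. c - 1) ` {1..m} = {..<m}" for m :: nat
    by (force simp: image_iff intro: bexI[of _ "Suc _"])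
  have times: "(\<lambda>(i, c). (id i, c - 1)) ` ({a} \<times> S) = {a} \<times> ((\<lambda>c. c - 1) ` S)" for a and S :: "nat set"
    by auto
  have "(\<lambda>(i, c). (id i, c - 1)) ` X = {(i, c). i = 0 \<and> c < n - j \<or> i = 1 \<and> c < j}"
    unfolding X_def image_Un times shift by auto
  also have "\<dots> = diagram (partition_of [j, n - j])"
  proof -
    have "2 * j \<le> n" using j by simp
    then show ?thesis
      by (cases "j = 0"; cases "n = 0") (auto simp: diagram_def partition_of_def less_Suc_eq One_nat_def)
  qed
  finally have img: "(\<lambda>(i, c). (id i, c - 1)) ` X = diagram (partition_of [j, n - j])" .
  show "sum_list (partition_of [j, n - j]) = n"
    "coeffs (sym_group n) (sigma (partition_of [j, n - j])) = tableau_space n (two_row_row n j) (two_row_col n j)"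
    using coeffs_sigma[OF bij inj img] by auto
qed

section \<open>Cutting a diagram out of a rectangle\<close>

definition delta_id :: "(nat \<Rightarrow> nat) \<Rightarrow> complex" where
  "delta_id g = (if g = id then 1 else 0)"

text \<open>The size of the partition determines the group.\<close>

definition sigma_coeffs :: "nat list \<Rightarrow> ((nat \<Rightarrow> nat) \<Rightarrow> complex) set" where
  "sigma_coeffs lam = coeffs (sym_group (sum_list lam)) (sigma lam)"

lemma sum_list_partition_of: "sum_list (partition_of xs) = sum_list xs"
  by (induction xs) (auto simp: partition_of_def)

lemma diagram_filter_pos:
  assumes "sorted_wrt (\<ge>) ys"
  shows "diagram (filter (\<lambda>x. 0 < x) ys) = diagram ys"
  using assms
proof (induction ys)
  case (Cons y ys)
  show ?case
  proof (cases "0 < y")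
    case True
    have shift: "diagram (z # zs) = {0} \<times> {..<z} \<union> (\<lambda>(i, j). (Suc i, j)) ` diagram zs" for z zs
      by (auto simp: diagram_def image_iff nth_Cons less_Suc_eq_0_disj split: nat.splits)
    show ?thesis using True Cons by (simp add: shift)
  next
    case False
    then have zero: "\<forall>x\<in>set (y # ys). x = 0" using Cons.prems by auto
    then have "(y # ys) ! i = 0" if "i < length (y # ys)" for i using that nth_mem by blast
    then have "diagram (y # ys) = {}" unfolding diagram_def by force
    moreover have "filter (\<lambda>x. 0 < x) (y # ys) = []" using zero by (auto simp: filter_empty_conv)
    ultimately show ?thesis by (simp only: diagram_def) auto
  qed
qed (simp add: diagram_def)

lemma diagram_partition_of:
  assumes "sorted xs"
  shows "diagram (partition_of xs) = {(i, j). i < length xs \<and> j < rev xs ! i}"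
proof -
  have "sorted_wrt (\<ge>) (rev xs)" using assms by (simp add: sorted_wrt_rev)
  from diagram_filter_pos[OF this] show ?thesis by (simp add: partition_of_def rev_filter diagram_def)
qed

text \<open>The lists in the families are increasing, so the diagram of the partition has the rows of \<open>rev xs\<close>.\<close>

definition co_diagram :: "nat \<Rightarrow> nat list \<Rightarrow> (nat \<times> nat) set" where
  "co_diagram l xs = {(i, j). i < length xs \<and> rev xs ! i \<le> j \<and> j < l}"

text \<open>The diagram of the partition is closed upwards in the columns of the rectangle. The tableau \<open>(r, s)\<close>
is an arbitrary filling of the complement.\<close>

theorem rectangle_restriction:
  assumes xs: "sorted xs" "\<forall>x\<in>set xs. x \<le> l"
    and bij: "bij_betw (\<lambda>i. (r i, s i)) {1..b} (co_diagram l xs)"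
    and f: "f \<in> sigma_coeffs (partition_of xs)" and g: "g \<in> tableau_space b r s"
  shows "sum_list xs + b = length xs * l"
    "block_prod (sum_list xs) b f g \<in> restrict_to (block_perms (sum_list xs) b) ` sigma_coeffs (replicate (length xs) l)"
proof -
  let ?m = "length xs" and ?a = "sum_list xs"
  let ?D = "diagram (partition_of xs)"
  have D: "?D = {(i, j). i < ?m \<and> j < rev xs ! i}" by (rule diagram_partition_of[OF xs(1)])
  have rev_le: "rev xs ! i \<le> l" if "i < ?m" for i
    using xs(2) that nth_mem[of i "rev xs"] by auto
  have "card ?D = ?a" by (simp add: card_diagram sum_list_partition_of)
  moreover have "finite ?D" by (simp add: diagram_Sigma)
  ultimately obtain h where h: "bij_betw h {1..?a} ?D" using ex_bij_betw_nat_finite_1 by metis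
  define r' where "r' i = (if i \<le> ?a then fst (h i) else r (i - ?a))" for i
  define s' where "s' i = (if i \<le> ?a then snd (h i) else s (i - ?a))" for i
  have bij1: "bij_betw (\<lambda>i. (r' i, s' i)) {1..?a} ?D"
    using h by (rule bij_betw_cong[THEN iffD1, rotated]) (simp add: r'_def s'_def)
  have bij2: "bij_betw (\<lambda>i. (r' (?a + i), s' (?a + i))) {1..b} (co_diagram l xs)"
    using bij by (rule bij_betw_cong[THEN iffD1, rotated]) (simp add: r'_def s'_def)
  have "bij_betw (\<lambda>i. i - ?a) {?a + 1..?a + b} {1..b}"
    by (rule bij_betw_byWitness[where f' = "\<lambda>i. i + ?a"]) auto
  from bij_betw_trans[OF this bij] have bij2': "bij_betw (\<lambda>i. (r' i, s' i)) {?a + 1..?a + b} (co_diagram l xs)"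
    by (rule bij_betw_cong[THEN iffD1, rotated]) (auto simp: r'_def s'_def)
  have "?D \<inter> co_diagram l xs = {}" by (auto simp: D co_diagram_def)
  then have "bij_betw (\<lambda>i. (r' i, s' i)) ({1..?a} \<union> {?a + 1..?a + b}) (?D \<union> co_diagram l xs)"
    using bij1 bij2' by (intro bij_betw_combine)
  moreover have "{1..?a} \<union> {?a + 1..?a + b} = {1..?a + b}" by auto
  moreover have "?D \<union> co_diagram l xs = {..<?m} \<times> {..<l}"
    using rev_le by (force simp: D co_diagram_def)
  ultimately have bij3: "bij_betw (\<lambda>i. (r' i, s' i)) {1..?a + b} ({..<?m} \<times> {..<l})" by simp
  from bij_betw_same_card[OF bij3] show sum: "?a + b = ?m * l" by simp
  have rect: "sigma_coeffs (replicate ?m l) = tableau_space (?a + b) r' s'"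
  proof -
    have "(\<lambda>(i, j). (id i, id j)) ` ({..<?m} \<times> {..<l}) = diagram (replicate ?m l)"
      by (auto simp: diagram_def)
    from coeffs_sigma[OF bij3 inj_on_id inj_on_id this] show ?thesis by (simp add: sigma_coeffs_def)
  qed
  have part: "sigma_coeffs (partition_of xs) = tableau_space ?a r' s'"
  proof -
    have "(\<lambda>(i, j). (id i, id j)) ` ?D = diagram (partition_of xs)" by auto
    from coeffs_sigma[OF bij1 inj_on_id inj_on_id this] show ?thesis by (simp add: sigma_coeffs_def)
  qed
  have comp: "tableau_space b r s = tableau_space b (\<lambda>i. r' (?a + i)) (\<lambda>i. s' (?a + i))"
    by (rule tableau_space_same_cells[OF bij bij2])
  have desc: "rev xs ! i' \<ge> rev xs ! i" if "i' < i" "i < ?m" for i i'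
    using xs(1) that sorted_wrt_nth_less[of "(\<ge>)" "rev xs" i' i] by (simp add: sorted_wrt_rev)
  have closed: "column_closed (?a + b) r' s' {1..?a}"
    unfolding column_closed_def
  proof (intro ballI impI)
    fix u v assume u: "u \<in> {1..?a}" and v: "v \<in> {1..?a + b}" and uv: "s' v = s' u \<and> r' v < r' u"
    have "(r' u, s' u) \<in> ?D" using bij_betwE[OF bij1] u by blast
    then have "s' v < rev xs ! r' v" using uv desc[of "r' v" "r' u"] by (auto simp: D)
    then have "(r' v, s' v) \<notin> co_diagram l xs" by (simp add: co_diagram_def)
    then have "v \<notin> {?a + 1..?a + b}" using bij_betwE[OF bij2'] by blast
    then show "v \<in> {1..?a}" using v by auto
  qed
  show "block_prod ?a b f g \<in> restrict_to (block_perms ?a b) ` sigma_coeffs (replicate ?m l)"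
    unfolding rect using f g bij3 unfolding part comp
    by (intro block_prod_tableau_space closed) (auto simp: bij_betw_def)
qed

theorem contains_all_irreps_square_times_two_rows:
  assumes n: "sum_list lam = n"
    and delta: "delta_id \<in> product_span (product_span (sigma_coeffs lam) (sigma_coeffs lam)) (two_row_space n)"
  shows "contains_all_irreps (sym_group n) (square_times_two_rows n lam)"
proof -
  interpret fin_group "sym_group n" by (rule sym_group_fin)
  let ?two = "map (\<lambda>j. sigma (partition_of [j, n - j])) [0..<n div 2 + 1]"
  have two_rep: "is_rep (sym_group n) (sigma (partition_of [j, n - j]))" if "j \<le> n div 2" for j
    using sigma_is_rep[of "partition_of [j, n - j]"] coeffs_two_row(1)[OF that] by simp
  have reps: "\<forall>\<rho>\<in>set ?two. is_rep (sym_group n) \<rho>" using two_rep by auto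
  have lam_rep: "is_rep (sym_group n) (sigma lam)" using sigma_is_rep[of lam] n by simp
  have sq_rep: "is_rep (sym_group n) (tensor_rep (sigma lam) (sigma lam))"
    by (intro is_rep_tensor lam_rep)
  have sum_rep: "is_rep (sym_group n) (direct_sum_list ?two)" by (intro is_rep_direct_sum_list reps)
  have "coeffs (sym_group n) (direct_sum_list ?two) = cfun.span (\<Union>\<rho>\<in>set ?two. coeffs (sym_group n) \<rho>)"
    using reps is_rep_uniform_dim by (intro coeffs_direct_sum_list) blast
  also have "(\<Union>\<rho>\<in>set ?two. coeffs (sym_group n) \<rho>) = (\<Union>j\<in>{..n div 2}. tableau_space n (two_row_row n j) (two_row_col n j))"
  proof -
    have rng: "set [0..<n div 2 + 1] = {..n div 2}" unfolding set_upt by auto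
    show ?thesis
      unfolding set_map rng image_image by (intro SUP_cong refl coeffs_two_row(2)) simp
  qed
  finally have two: "coeffs (sym_group n) (direct_sum_list ?two) = two_row_space n"
    by (simp add: two_row_space_def)
  have "coeffs (sym_group n) (square_times_two_rows n lam) =
      product_span (product_span (sigma_coeffs lam) (sigma_coeffs lam)) (two_row_space n)"
    unfolding square_times_two_rows_def
    using lam_rep sq_rep sum_rep by (simp add: coeffs_tensor is_rep_uniform_dim two sigma_coeffs_def n del: map_append upt_Suc)
  moreover have "is_rep (sym_group n) (square_times_two_rows n lam)"
    unfolding square_times_two_rows_def by (intro is_rep_tensor sq_rep sum_rep)
  moreover have "delta_id = (\<lambda>g. if g = \<one>\<^bsub>sym_group n\<^esub> then 1 else 0)"
    by (simp add: delta_id_def fun_eq_iff sym_group_simps)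
  ultimately show ?thesis using contains_all_irreps_if_delta delta by simp
qed

text \<open>On the trivial group the symmetrizer is already \<open>\<delta>\<close>. This starts the staircases at size \<open>0\<close>, where
Saxl's conjecture says nothing, and settles the square with one cell, where the conjecture of type D says
nothing.\<close>

lemma delta_id_small:
  assumes "sum_list lam \<le> 1"
  shows "delta_id \<in> product_span (sigma_coeffs lam) (sigma_coeffs lam)"
proof -
  let ?n = "sum_list lam"
  let ?y = "tableau_symmetrizer ?n (fst \<circ> std_cell lam) (snd \<circ> std_cell lam)"
  have only_id: "p = id" if "p permutes {1..?n}" for p
  proof (cases "?n = 0")
    case True
    then show ?thesis using that by simp
  next
    case False
    then have "?n = 1" using assms by linarith
    then show ?thesis using that by simp
  qed
  have fib: "fiber_perms ?n f = {id}" for f :: "nat \<Rightarrow> nat"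
    using only_id fiber_perms_permutes fiber_perms_id by blast
  have "?y = delta_id"
    by (rule ext) (simp add: tableau_symmetrizer_def fiber_sign_def fib delta_id_def)
  moreover have "?y \<in> sigma_coeffs lam"
    unfolding sigma_coeffs_def coeffs_sigma_std by (rule symmetrizer_in_tableau_space)
  moreover have "delta_id * delta_id = delta_id" by (auto simp: delta_id_def fun_eq_iff)
  ultimately show ?thesis using product_span_in[of delta_id _ delta_id] by metis
qed

lemma delta_id_saxl:
  assumes "saxl_conjecture"
  shows "delta_id \<in> product_span (sigma_coeffs (rev [1..<p + 1])) (sigma_coeffs (rev [1..<p + 1]))"
proof (cases "p = 0")
  case True
  then show ?thesis by (intro delta_id_small) simp
next
  case False
  interpret fin_group "sym_group (p * (p + 1) div 2)" by (rule sym_group_fin)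
  let ?l = "rev [1..<p + 1]" and ?G = "sym_group (p * (p + 1) div 2)"
  have "sum_list (rev [1..<p + 1]) = p * (p + 1) div 2"
  proof -
    have "2 * sum_list [1..<p + 1] = p * (p + 1)" by (induction p) auto
    then show ?thesis unfolding sum_list_rev by simp
  qed
  then have sum: "sum_list ?l = p * (p + 1) div 2" .
  have rep: "is_rep ?G (sigma ?l)" using sigma_is_rep[of ?l] unfolding sum .
  then have "uniform_dim ?G (tensor_rep (sigma ?l) (sigma ?l))"
    by (intro is_rep_uniform_dim is_rep_tensor)
  moreover have "contains_all_irreps ?G (tensor_rep (sigma ?l) (sigma ?l))"
    using assms False by (simp add: saxl_conjecture_def Let_def)
  ultimately have "coeffs ?G (tensor_rep (sigma ?l) (sigma ?l)) = supported_on (carrier ?G)"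
    by (intro coeffs_if_contains_all_irreps) (auto simp: uniform_dim_def)
  moreover have "delta_id \<in> supported_on (carrier ?G)"
    by (auto simp: supported_on_def delta_id_def sym_group_simps permutes_id)
  ultimately show ?thesis
    using coeffs_tensor[OF is_rep_uniform_dim[OF rep] is_rep_uniform_dim[OF rep]]
    unfolding sigma_coeffs_def sum by simp
qed

text \<open>The complement of the staircase \<open>(m - 1, \<dots>, 1)\<close> is the staircase \<open>(k, \<dots>, 1)\<close> turned by half a turn.\<close>

lemma staircase_co_diagram:
  assumes "m = k \<or> m = Suc k"
  shows "(\<lambda>(i, j). (m - 1 - i, k - 1 - j)) ` co_diagram k [0..<m] = diagram (rev [1..<k + 1])"
proof -
  have A: "co_diagram k [0..<m] = {(i, j). i < m \<and> m - 1 - i \<le> j \<and> j < k}"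
    by (auto simp: co_diagram_def rev_nth)
  have B: "diagram (rev [1..<k + 1]) = {(i, j). i < k \<and> j < k - i}"
    by (auto simp: diagram_def rev_nth)
  show ?thesis
    unfolding A B
  proof (intro equalityI subsetI)
    fix x assume "x \<in> (\<lambda>(i, j). (m - 1 - i, k - 1 - j)) ` {(i, j). i < m \<and> m - 1 - i \<le> j \<and> j < k}"
    then show "x \<in> {(i, j). i < k \<and> j < k - i}" by auto
  next
    fix x :: "nat \<times> nat" assume "x \<in> {(i, j). i < k \<and> j < k - i}"
    then obtain i j where x: "x = (i, j)" "i < k" "j < k - i" by auto
    then have "(m - 1 - i, k - 1 - j) \<in> {(i, j). i < m \<and> m - 1 - i \<le> j \<and> j < k}"
      "m - 1 - (m - 1 - i) = i" "k - 1 - (k - 1 - j) = j" using assms by auto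
    then show "x \<in> (\<lambda>(i, j). (m - 1 - i, k - 1 - j)) ` {(i, j). i < m \<and> m - 1 - i \<le> j \<and> j < k}"
      using x(1) by (intro image_eqI[of _ _ "(m - 1 - i, k - 1 - j)"]) auto
  qed
qed

lemma inj_on_reflect: "(\<And>x. x \<in> S \<Longrightarrow> x < m) \<Longrightarrow> inj_on (\<lambda>x. m - 1 - x :: nat) S"
proof (rule inj_onI)
  fix x y assume lt: "\<And>x. x \<in> S \<Longrightarrow> x < m" and xy: "x \<in> S" "y \<in> S" "m - 1 - x = m - 1 - y"
  have "x < m" "y < m" using lt xy by auto
  then show "x = y" using xy(3) by linarith
qed

lemma block_prod_delta: "block_prod a b delta_id delta_id = delta_id"
proof
  fix g
  show "block_prod a b delta_id delta_id g = delta_id g"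
  proof (cases "g \<in> block_perms a b")
    case True
    have iff: "left_part a g = id \<and> right_part a b g = id \<longleftrightarrow> g = id"
    proof
      assume "left_part a g = id \<and> right_part a b g = id"
      then show "g = id" using join_parts[OF True] join_id by metis
    qed (auto simp: left_part_def right_part_def fun_eq_iff)
    have "block_prod a b delta_id delta_id g = (if left_part a g = id \<and> right_part a b g = id then 1 else 0)"
      using True by (simp add: block_prod_def delta_id_def)
    then show ?thesis by (simp only: iff delta_id_def)
  next
    case False
    moreover have "id \<in> block_perms a b" by (simp add: block_perms_def permutes_id)
    ultimately show ?thesis by (auto simp: block_prod_def delta_id_def)
  qed
qed

text \<open>With \<open>F\<close> agreeing with \<open>\<delta>\<close> on \<open>H = S\<^sub>a \<times> S\<^sub>b\<close>, the product of \<open>F\<close> and the indicator of \<open>H\<close> is \<open>\<delta>\<close>.\<close>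

theorem rectangle_from_staircases:
  assumes m: "m = k \<or> m = Suc k"
    and delta1: "delta_id \<in> product_span (sigma_coeffs (rev [1..<m])) (sigma_coeffs (rev [1..<m]))"
    and delta2: "delta_id \<in> product_span (sigma_coeffs (rev [1..<k + 1])) (sigma_coeffs (rev [1..<k + 1]))"
  shows "contains_all_irreps (sym_group (m * k)) (square_times_two_rows (m * k) (replicate m k))"
proof (rule contains_all_irreps_square_times_two_rows)
  show "sum_list (replicate m k) = m * k" by (simp add: sum_list_replicate)
  let ?xs = "[0..<m]" and ?rho = "rev [1..<k + 1]"
  let ?a = "sum_list ?xs"
  have part: "partition_of ?xs = rev [1..<m]"
  proof (cases m)
    case (Suc m')
    then have "[0..<m] = 0 # [1..<m]" by (simp add: upt_conv_Cons One_nat_def)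
    then show ?thesis by (simp add: partition_of_def filter_id_conv)
  qed (simp add: partition_of_def)
  have fin: "finite (co_diagram k ?xs)"
    by (rule finite_subset[of _ "{..<m} \<times> {..<k}"]) (auto simp: co_diagram_def)
  define b where "b = card (co_diagram k ?xs)"
  obtain h where h: "bij_betw h {1..b} (co_diagram k ?xs)"
    using ex_bij_betw_nat_finite_1[OF fin] unfolding b_def by blast
  define r s where "r i = fst (h i)" and "s i = snd (h i)" for i
  have bij: "bij_betw (\<lambda>i. (r i, s i)) {1..b} (co_diagram k ?xs)" using h by (simp add: r_def s_def)
  have inj: "inj_on (\<lambda>i. m - 1 - i) (fst ` co_diagram k ?xs)" "inj_on (\<lambda>j. k - 1 - j) (snd ` co_diagram k ?xs)"
    by (rule inj_on_reflect, force simp: co_diagram_def)+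
  from coeffs_sigma[OF bij inj staircase_co_diagram[OF m]]
  have comp: "sigma_coeffs ?rho = tableau_space b r s" by (simp add: sigma_coeffs_def del: upt_Suc)
  have sorted: "sorted ?xs" "\<forall>x\<in>set ?xs. x \<le> k" using m by auto
  have lift: "block_prod ?a b f g \<in> restrict_to (block_perms ?a b) ` sigma_coeffs (replicate m k)"
    if "f \<in> sigma_coeffs (rev [1..<m])" "g \<in> sigma_coeffs ?rho" for f g
    using rectangle_restriction(2)[OF sorted bij, of f g] that unfolding part comp by simp
  have sum: "?a + b = m * k"
    using rectangle_restriction(1)[OF sorted bij, of 0 0] cfun.subspace_0[OF coeffs_subspace]
      tableau_space_two_sided[of b r s] cfun.subspace_0
    by (auto simp: sigma_coeffs_def two_sided_def)
  obtain F where F: "F \<in> product_span (sigma_coeffs (replicate m k)) (sigma_coeffs (replicate m k))"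
    "block_prod ?a b delta_id delta_id = restrict_to (block_perms ?a b) F"
    using block_prod_product_span[OF lift delta1 delta2] by blast
  have "delta_id = restrict_to (block_perms ?a b) F"
    using F(2) by (simp only: block_prod_delta)
  also have "\<dots> = F * (\<lambda>p. if p permutes {1..m * k} \<and> p ` {1..?a} = {1..?a} then 1 else 0)"
    unfolding restrict_to_def block_perms_def sum mem_Collect_eq by (rule ext) simp
  also have "\<dots> \<in> product_span (product_span (sigma_coeffs (replicate m k)) (sigma_coeffs (replicate m k))) (two_row_space (m * k))"
    using F(1) sum by (intro product_span_in set_transport_indicator) auto
  finally show "delta_id \<in> product_span (product_span (sigma_coeffs (replicate m k)) (sigma_coeffs (replicate m k))) (two_row_space (m * k))" .
qed

section \<open>Weyl groups of types C and D\<close>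

text \<open>The characters of \<open>(\<int>/2\<int>)\<^sup>n\<close>, indexed by subsets \<open>B\<close>.\<close>

definition parity_char :: "nat set \<Rightarrow> nat set \<Rightarrow> complex" where
  "parity_char B A = (-1) ^ card (A \<inter> B)"

lemma parity_char_sym_diff:
  assumes "finite A" "finite C"
  shows "parity_char B (sym_diff A C) = parity_char B A * parity_char B C"
proof -
  have "sym_diff A C \<inter> B = sym_diff (A \<inter> B) (C \<inter> B)" by auto
  moreover have "(-1) ^ card (sym_diff X Y) = (-1 :: complex) ^ card X * (-1) ^ card Y"
    if "finite X" "finite Y" for X Y :: "nat set"
  proof -
    have split: "card Z = card (Z - Z') + card (Z \<inter> Z')" if "finite Z" for Z Z' :: "nat set"
    proof -
      have "card (Z - Z' \<union> Z \<inter> Z') = card (Z - Z') + card (Z \<inter> Z')"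
        using that by (intro card_Un_disjoint) auto
      then show ?thesis by (simp only: Un_Diff_Int)
    qed
    have "card (sym_diff X Y) = card (X - Y) + card (Y - X)"
      using that by (intro card_Un_disjoint) auto
    moreover have "(-1 :: complex) ^ card (X \<inter> Y) * (-1) ^ card (X \<inter> Y) = 1"
      by (simp add: power_mult_distrib[symmetric])
    ultimately show ?thesis
      using split[OF that(1), of Y] split[OF that(2), of X]
      by (simp add: power_add Int_commute mult.assoc mult.left_commute)
  qed
  ultimately show ?thesis using assms by (simp add: parity_char_def)
qed

lemma parity_char_image:
  assumes "p permutes U"
  shows "parity_char (p ` B) (p ` A) = parity_char B A"
proof -
  have "p ` A \<inter> p ` B = p ` (A \<inter> B)" using permutes_inj[OF assms] by (simp add: image_Int)
  then show ?thesis
    using card_image[OF inj_on_subset[OF permutes_inj[OF assms] subset_UNIV], of "A \<inter> B"] by (simp add: parity_char_def)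
qed

lemma weyl_C_simps:
  "(A, p) \<in> carrier (weyl_C n) \<longleftrightarrow> A \<subseteq> {1..n} \<and> p permutes {1..n}"
  "\<one>\<^bsub>weyl_C n\<^esub> = ({}, id)"
  "(A, p) \<otimes>\<^bsub>weyl_C n\<^esub> (B, q) = (sym_diff A (p ` B), p \<circ> q)"
  by (simp_all add: weyl_C_def)

lemma image_sym_diff:
  assumes "p permutes U"
  shows "p ` (sym_diff A B) = sym_diff (p ` A) (p ` B)"
  using permutes_inj[OF assms] by (simp add: image_Un image_set_diff)

lemma image_permutes_subset: "p permutes U \<Longrightarrow> A \<subseteq> U \<Longrightarrow> p ` A \<subseteq> U"
  using permutes_image by blast

lemma image_inv_permutes:
  assumes "p permutes U"
  shows "p ` inv' p ` A = A" "inv' p ` p ` A = A"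
proof -
  have "p ` inv' p ` A = (p \<circ> inv' p) ` A" "inv' p ` p ` A = (inv' p \<circ> p) ` A" by (simp_all only: image_comp)
  then show "p ` inv' p ` A = A" "inv' p ` p ` A = A" using permutes_inv_o[OF assms] by simp_all
qed

lemma weyl_C_group: "group (weyl_C n)"
proof (rule groupI)
  fix x y assume "x \<in> carrier (weyl_C n)" "y \<in> carrier (weyl_C n)"
  then show "x \<otimes>\<^bsub>weyl_C n\<^esub> y \<in> carrier (weyl_C n)"
    using image_permutes_subset[of "snd x" "{1..n}" "fst y"]
    by (cases x; cases y) (auto simp: weyl_C_simps permutes_compose)
next
  fix x y z assume "x \<in> carrier (weyl_C n)" "y \<in> carrier (weyl_C n)" "z \<in> carrier (weyl_C n)"
  moreover obtain A p B q C r where "x = (A, p)" "y = (B, q)" "z = (C, r)" by (metis prod.exhaust)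
  ultimately show "x \<otimes>\<^bsub>weyl_C n\<^esub> y \<otimes>\<^bsub>weyl_C n\<^esub> z = x \<otimes>\<^bsub>weyl_C n\<^esub> (y \<otimes>\<^bsub>weyl_C n\<^esub> z)"
    by (auto simp: weyl_C_simps image_sym_diff[of p "{1..n}"] image_comp comp_assoc)
next
  fix x assume x: "x \<in> carrier (weyl_C n)"
  obtain A p where Ap: "x = (A, p)" by (cases x)
  then have p: "p permutes {1..n}" "A \<subseteq> {1..n}" using x by (simp_all add: weyl_C_simps)
  show "\<exists>y\<in>carrier (weyl_C n). y \<otimes>\<^bsub>weyl_C n\<^esub> x = \<one>\<^bsub>weyl_C n\<^esub>"
    using p image_permutes_subset[OF permutes_inv[OF p(1)] p(2)]
    by (intro bexI[of _ "(inv' p ` A, inv' p)"]) (simp_all add: Ap weyl_C_simps permutes_inv permutes_inv_o)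
qed (auto simp: weyl_C_simps)

lemma weyl_C_inv:
  assumes "A \<subseteq> {1..n}" "p permutes {1..n}"
  shows "inv\<^bsub>weyl_C n\<^esub> (A, p) = (inv' p ` A, inv' p)"
proof (rule group.inv_equality[OF weyl_C_group])
  show "(inv' p ` A, inv' p) \<otimes>\<^bsub>weyl_C n\<^esub> (A, p) = \<one>\<^bsub>weyl_C n\<^esub>"
    using assms by (simp add: weyl_C_simps permutes_inv_o)
qed (use assms image_permutes_subset[OF permutes_inv[OF assms(2)] assms(1)] in \<open>simp_all add: weyl_C_simps permutes_inv\<close>)

lemma finite_weyl_C: "finite (carrier (weyl_C n))"
proof -
  have "carrier (weyl_C n) \<subseteq> Pow {1..n} \<times> {p. p permutes {1..n}}" by (auto simp: weyl_C_def)
  then show ?thesis by (rule finite_subset) (simp add: finite_permutations)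
qed

lemma weyl_C_fin: "fin_group (weyl_C n)"
  using weyl_C_group finite_weyl_C by (simp add: fin_group_def fin_group_axioms_def)

lemma even_card_parity: "finite A \<Longrightarrow> even (card A) \<longleftrightarrow> parity_char UNIV A = 1"
  by (simp add: parity_char_def minus_one_power_iff)

lemma weyl_D_simps:
  "(A, p) \<in> carrier (weyl_D n) \<longleftrightarrow> A \<subseteq> {1..n} \<and> p permutes {1..n} \<and> even (card A)"
  "\<one>\<^bsub>weyl_D n\<^esub> = ({}, id)"
  "(A, p) \<otimes>\<^bsub>weyl_D n\<^esub> (B, q) = (sym_diff A (p ` B), p \<circ> q)"
  by (auto simp: weyl_D_def weyl_C_def)

lemma weyl_D_fin: "fin_group (weyl_D n)"
proof -
  interpret W: group "weyl_C n" by (rule weyl_C_group)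
  let ?K = "{(A, p) \<in> carrier (weyl_C n). even (card A)}"
  have card_img: "card (p ` A) = card A" if "p permutes {1..n}" for p A
    using card_image[OF inj_on_subset[OF permutes_inj[OF that] subset_UNIV]] .
  have "subgroup ?K (weyl_C n)"
  proof (rule W.subgroupI)
    have "({}, id) \<in> ?K" by (simp add: weyl_C_simps permutes_id)
    then show "?K \<noteq> {}" by blast
    fix x assume x: "x \<in> ?K"
    then obtain A p where Ap: "x = (A, p)" "A \<subseteq> {1..n}" "p permutes {1..n}" "even (card A)"
      by (auto simp: weyl_C_simps)
    show "inv\<^bsub>weyl_C n\<^esub> x \<in> ?K"
      using Ap W.inv_closed[of x] x card_img[OF permutes_inv[OF Ap(3)], of A] by (auto simp: weyl_C_inv)
    fix y assume y: "y \<in> ?K"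
    then obtain B q where Bq: "y = (B, q)" "B \<subseteq> {1..n}" "q permutes {1..n}" "even (card B)"
      by (auto simp: weyl_C_simps)
    have fin: "finite A" "finite (p ` B)" "finite (sym_diff A (p ` B))"
      using Ap Bq finite_subset[of _ "{1..n}"] by auto
    have "even (card (p ` B))" using Bq card_img[OF Ap(3)] by simp
    then have "even (card (sym_diff A (p ` B)))"
      using parity_char_sym_diff[OF fin(1,2), of UNIV] Ap(4) by (simp only: even_card_parity fin) simp
    then show "x \<otimes>\<^bsub>weyl_C n\<^esub> y \<in> ?K"
      using W.m_closed[of x y] x y by (auto simp: Ap(1) Bq(1) weyl_C_simps(3))
  qed auto
  from W.subgroup_imp_group[OF this] have "group (weyl_D n)" by (simp add: weyl_D_def)
  moreover have "finite (carrier (weyl_D n))"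
    by (rule finite_subset[OF _ finite_weyl_C[of n]]) (auto simp: weyl_D_def)
  ultimately show ?thesis by (simp add: fin_group_def fin_group_axioms_def)
qed

text \<open>Choosing the same representative for all elements of a coset shows that a transversal exists, so the
one selected by the definition is made of group elements.\<close>

lemma (in fin_group) left_transversal_subset:
  assumes "subgroup H G"
  shows "set (left_transversal G H) \<subseteq> carrier G"
proof -
  interpret H: subgroup H G by (rule assms)
  have rel: "inv y \<otimes> x \<in> H" if "x \<in> carrier G" "y \<in> carrier G" "inv x \<otimes> y \<in> H" for x y
    using H.m_inv_closed[OF that(3)] that by (simp add: inv_mult_group)
  have trans: "inv x \<otimes> z \<in> H" if "x \<in> carrier G" "y \<in> carrier G" "z \<in> carrier G" "inv x \<otimes> y \<in> H" "inv y \<otimes> z \<in> H" for x y z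
  proof -
    have "(inv x \<otimes> y) \<otimes> (inv y \<otimes> z) = inv x \<otimes> z"
      using that(1-3) by (simp add: m_assoc) (simp add: m_assoc[symmetric])
    then show ?thesis using H.m_closed[OF that(4,5)] by simp
  qed
  define f where "f x = (SOME y. y \<in> carrier G \<and> inv x \<otimes> y \<in> H)" for x
  have f: "f x \<in> carrier G \<and> inv x \<otimes> f x \<in> H" if "x \<in> carrier G" for x
    unfolding f_def by (rule someI[of _ x]) (use that in simp)
  obtain ts where ts: "set ts = f ` carrier G" "distinct ts" using finite_distinct_list[of "f ` carrier G"] fin by blast
  have "\<exists>ts. distinct ts \<and> set ts \<subseteq> carrier G \<and> (\<forall>g\<in>carrier G. \<exists>!t. t \<in> set ts \<and> inv t \<otimes> g \<in> H)"
  proof (intro exI conjI ballI)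
    show "distinct ts" "set ts \<subseteq> carrier G" using ts f by auto
    fix g assume g: "g \<in> carrier G"
    show "\<exists>!t. t \<in> set ts \<and> inv t \<otimes> g \<in> H"
    proof (rule ex1I[of _ "f g"])
      show "f g \<in> set ts \<and> inv (f g) \<otimes> g \<in> H" using ts(1) g f[OF g] rel by blast
      fix t assume t: "t \<in> set ts \<and> inv t \<otimes> g \<in> H"
      then obtain x where x: "x \<in> carrier G" "t = f x" using ts(1) by blast
      have xg: "inv x \<otimes> g \<in> H" using trans[of x t g] f[OF x(1)] x t g by simp
      have "(inv x \<otimes> y \<in> H) = (inv g \<otimes> y \<in> H)" if "y \<in> carrier G" for y
        using trans[of x g y] trans[of g x y] rel[OF x(1) g xg] xg that x g by blast
      then have "(\<lambda>y. y \<in> carrier G \<and> inv x \<otimes> y \<in> H) = (\<lambda>y. y \<in> carrier G \<and> inv g \<otimes> y \<in> H)" by auto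
      then show "t = f g" unfolding x(2) f_def by simp
    qed
  qed
  from someI_ex[OF this] show ?thesis unfolding left_transversal_def by blast
qed

lemma young_subgroup_C_iff:
  "(A, p) \<in> young_subgroup_C a b \<longleftrightarrow> A \<subseteq> {1..a + b} \<and> p \<in> block_perms a b"
  by (auto simp: young_subgroup_C_def weyl_C_simps block_perms_def)

lemma block_perms_inv: "p \<in> block_perms a b \<Longrightarrow> inv' p \<in> block_perms a b"
  using image_inv_permutes(2)[of p "{1..a + b}" "{1..a}"] by (simp add: block_perms_def permutes_inv)

lemma young_subgroup_C_subgroup: "subgroup (young_subgroup_C a b) (weyl_C (a + b))"
proof (rule group.subgroupI[OF weyl_C_group])
  let ?W = "weyl_C (a + b)"
  show "young_subgroup_C a b \<subseteq> carrier ?W" by (auto simp: young_subgroup_C_def)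
  have "({}, id) \<in> young_subgroup_C a b" by (simp add: young_subgroup_C_iff block_perms_def permutes_id)
  then show "young_subgroup_C a b \<noteq> {}" by blast
  fix x assume x: "x \<in> young_subgroup_C a b"
  obtain A p where Ap: "x = (A, p)" by (cases x)
  have A: "A \<subseteq> {1..a + b}" and p: "p \<in> block_perms a b" "p permutes {1..a + b}"
    using x by (auto simp: Ap young_subgroup_C_iff block_perms_def)
  show "inv\<^bsub>?W\<^esub> x \<in> young_subgroup_C a b"
    using image_permutes_subset[OF permutes_inv[OF p(2)] A] block_perms_inv[OF p(1)]
    by (simp add: Ap weyl_C_inv[OF A p(2)] young_subgroup_C_iff)
  fix y assume y: "y \<in> young_subgroup_C a b"
  obtain B q where Bq: "y = (B, q)" by (cases y)
  have B: "B \<subseteq> {1..a + b}" and q: "q \<in> block_perms a b"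
    using y by (auto simp: Bq young_subgroup_C_iff)
  show "x \<otimes>\<^bsub>?W\<^esub> y \<in> young_subgroup_C a b"
    using image_permutes_subset[OF p(2) B] A block_perms_comp[OF p(1) q]
    by (auto simp: Ap Bq weyl_C_simps young_subgroup_C_iff)
qed

section \<open>Matrix coefficients of the representations of the Weyl groups\<close>

text \<open>The sign of \<open>p\<close> on \<open>B\<close>, meant for sets with \<open>p ` B = B\<close>.\<close>

definition sign_within :: "nat set \<Rightarrow> (nat \<Rightarrow> nat) \<Rightarrow> int" where
  "sign_within B p = sign (\<lambda>i. if i \<in> B then p i else i)"

lemma within_permutes:
  assumes "p permutes {1..n::nat}" "B \<subseteq> {1..n}" "p ` B = B"
  shows "(\<lambda>i. if i \<in> B then p i else i) permutes {1..n}"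
proof -
  have "bij_betw p B B" using assms permutes_inj_on[OF assms(1)] by (simp add: bij_betw_def)
  then have "bij_betw (\<lambda>i. if i \<in> B then p i else i) B B"
    by (rule bij_betw_cong[THEN iffD1, rotated]) simp
  then have "(\<lambda>i. if i \<in> B then p i else i) permutes B" by (rule bij_imp_permutes) simp
  then show ?thesis using assms(2) by (rule permutes_subset)
qed

lemma sign_within_comp:
  assumes p: "p permutes {1..n::nat}" "p ` B = B" and q: "q permutes {1..n}" "q ` B = B" and B: "B \<subseteq> {1..n}"
  shows "sign_within B (p \<circ> q) = sign_within B p * sign_within B q"
proof -
  have "(\<lambda>i. if i \<in> B then (p \<circ> q) i else i) = (\<lambda>i. if i \<in> B then p i else i) \<circ> (\<lambda>i. if i \<in> B then q i else i)"
    using q(2) by (auto simp: fun_eq_iff)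
  then show ?thesis
    unfolding sign_within_def by (simp only: perm_sign_comp[OF within_permutes[OF p(1) B p(2)] within_permutes[OF q(1) B q(2)]])
qed

lemma sign_within_compl:
  assumes p: "p permutes {1..n::nat}" "p ` B = B" and B: "B \<subseteq> {1..n}"
  shows "sign_within ({1..n} - B) p = sign p * sign_within B p"
proof -
  have pc: "p ` ({1..n} - B) = {1..n} - B"
    using p permutes_image[OF p(1)] permutes_inj[OF p(1)] by (simp add: image_set_diff)
  have "p = (\<lambda>i. if i \<in> B then p i else i) \<circ> (\<lambda>i. if i \<in> {1..n} - B then p i else i)"
  proof
    fix i
    have "p i \<notin> B" if "i \<in> {1..n} - B" using pc that by blast
    then show "p i = ((\<lambda>i. if i \<in> B then p i else i) \<circ> (\<lambda>i. if i \<in> {1..n} - B then p i else i)) i"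
      using permutes_not_in[OF p(1), of i] B by auto
  qed
  then have "sign p = sign_within B p * sign_within ({1..n} - B) p"
    unfolding sign_within_def
    using perm_sign_comp[OF within_permutes[OF p(1) B p(2)] within_permutes[OF p(1) _ pc]] by simp
  moreover have "sign_within B p * sign_within B p = 1" by (simp add: sign_within_def)
  ultimately show ?thesis by (metis mult.assoc mult.commute mult.left_neutral)
qed

lemma sign_within_conj:
  assumes t: "t permutes {1..n::nat}" and p: "p permutes {1..n}" "p ` B = B" and B: "B \<subseteq> {1..n}"
  shows "sign_within (t ` B) (t \<circ> p \<circ> inv' t) = sign_within B p"
proof -
  let ?w = "\<lambda>i. if i \<in> B then p i else i"
  have "(\<lambda>i. if i \<in> t ` B then (t \<circ> p \<circ> inv' t) i else i) = t \<circ> ?w \<circ> inv' t"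
  proof
    fix i
    have "i \<in> t ` B \<longleftrightarrow> inv' t i \<in> B" using permutes_inverses[OF t] by (metis image_iff)
    then show "(if i \<in> t ` B then (t \<circ> p \<circ> inv' t) i else i) = (t \<circ> ?w \<circ> inv' t) i"
      using permutes_inverses(1)[OF t] by simp
  qed
  moreover have "sign (t \<circ> ?w \<circ> inv' t) = sign ?w"
    using perm_sign_comp[OF permutes_compose[OF within_permutes[OF p(1) B p(2)] t] permutes_inv[OF t]]
      perm_sign_comp[OF t within_permutes[OF p(1) B p(2)]] perm_sign_inv[OF t]
    by (simp add: mult.commute mult.assoc[symmetric])
  ultimately show ?thesis by (simp only: sign_within_def)
qed

lemma sign_within_right:
  assumes q: "q \<in> block_perms a b"
  shows "sign_within {a + 1..a + b} q = sign (right_part a b q)"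
proof -
  have "(\<lambda>i. if i \<in> {a + 1..a + b} then q i else i) = join_perms a id (right_part a b q)"
  proof
    fix i
    consider "i \<le> a" | "i \<in> {a + 1..a + b}" | "i > a + b" by force
    then show "(if i \<in> {a + 1..a + b} then q i else i) = join_perms a id (right_part a b q) i"
    proof cases
      case 2
      then have "i - a \<in> {1..b}" unfolding atLeastAtMost_iff by arith
      then show ?thesis using 2 block_perms_right[OF q 2] by (auto simp: join_perms_def right_part_def)
    qed (auto simp: join_perms_def right_part_def)
  qed
  then show ?thesis
    unfolding sign_within_def using sign_join[OF permutes_id right_part_permutes[OF q], of a] by simp
qed

text \<open>The normal form of a matrix coefficient of \<open>\<sigma>\<^bsub>(\<alpha>, \<beta>)\<^esub>\<close>. The fixed permutation \<open>u\<close> takes \<open>B1\<close> back to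
\<open>B0\<close>, which gives the sign of a bijection from \<open>B0\<close> to \<open>B1\<close> a meaning.\<close>

definition transport_term ::
    "nat \<Rightarrow> nat set \<Rightarrow> nat set \<Rightarrow> (nat \<Rightarrow> nat) \<Rightarrow> ((nat \<Rightarrow> nat) \<Rightarrow> complex) \<Rightarrow> nat set \<times> (nat \<Rightarrow> nat) \<Rightarrow> complex" where
  "transport_term n B0 B1 u F = (\<lambda>(A, p). if p permutes {1..n} \<and> p ` B0 = B1
     then parity_char B1 A * of_int (sign_within B0 (u \<circ> p)) * F p else 0)"

definition transport_terms :: "nat \<Rightarrow> ((nat \<Rightarrow> nat) \<Rightarrow> complex) set \<Rightarrow> (nat set \<times> (nat \<Rightarrow> nat) \<Rightarrow> complex) set" where
  "transport_terms n V = {transport_term n B0 B1 u F |B0 B1 u F.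
     B0 \<subseteq> {1..n} \<and> B1 \<subseteq> {1..n} \<and> u permutes {1..n} \<and> u ` B1 = B0 \<and> F \<in> V}"

text \<open>The coset representatives \<open>(T, t)\<close> and \<open>(S, s)\<close> conjugate the block \<open>B\<close> on which the sign character
lives to \<open>t ` B\<close> and \<open>s ` B\<close>; their own sign changes \<open>T\<close> and \<open>S\<close> only contribute a constant.\<close>

lemma induced_entry:
  assumes ij: "T \<subseteq> {1..a + b}" "t permutes {1..a + b}" "S \<subseteq> {1..a + b}" "s permutes {1..a + b}"
    and V: "two_sided (sym_group (a + b)) V"
    and F0: "F0 \<in> V" and Ap: "A \<subseteq> {1..a + b}" "p permutes {1..a + b}"
  defines "B \<equiv> {a + 1..a + b}"
  defines "x \<equiv> inv\<^bsub>weyl_C (a + b)\<^esub> (T, t) \<otimes>\<^bsub>weyl_C (a + b)\<^esub> (A, p) \<otimes>\<^bsub>weyl_C (a + b)\<^esub> (S, s)"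
  shows "(if snd x \<in> block_perms a b then parity_char B (fst x) * of_int (sign_within B (snd x)) * F0 (snd x) else 0) =
    parity_char (t ` B) T * parity_char (s ` B) S *
      transport_term (a + b) (s ` B) (t ` B) (s \<circ> inv' t) (translate (sym_group (a + b)) (inv' t) s F0) (A, p)"
proof -
  let ?n = "a + b"
  let ?q = "inv' t \<circ> p \<circ> s"
  have B: "B \<subseteq> {1..?n}" by (auto simp: B_def)
  have ti: "inv' t permutes {1..?n}" using ij(2) by (rule permutes_inv)
  have q: "?q permutes {1..?n}" using ti ij(4) Ap(2) by (intro permutes_compose)
  have fin: "finite A" "finite T" "finite S" using ij(1,3) Ap(1) finite_subset[OF _ finite_atLeastAtMost] by blast+
  have x: "x = (sym_diff (sym_diff (inv' t ` T) (inv' t ` A)) ((inv' t \<circ> p) ` S), ?q)"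
    unfolding x_def weyl_C_inv[OF ij(1,2)] by (simp add: weyl_C_simps)
  have blockB: "?q \<in> block_perms a b \<longleftrightarrow> ?q ` B = B"
  proof -
    have "B = {1..?n} - {1..a}" "{1..a} = {1..?n} - B" by (auto simp: B_def)
    moreover have "?q ` ({1..?n} - X) = {1..?n} - ?q ` X" for X
      using permutes_image[OF q] permutes_inj[OF q] by (simp only: image_set_diff)
    ultimately show ?thesis using q unfolding block_perms_def mem_Collect_eq by metis
  qed
  have qB: "?q ` B = B \<longleftrightarrow> p ` s ` B = t ` B"
  proof -
    have "?q ` B = inv' t ` p ` s ` B" by (simp only: image_comp comp_assoc)
    then show ?thesis using image_inv_permutes[OF ij(2)] by metis
  qed
  show ?thesis
  proof (cases "?q ` B = B")
    case True
    have "parity_char B (inv' t ` X) = parity_char (t ` B) X" for X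
      using parity_char_image[OF ij(2), of B "inv' t ` X"] image_inv_permutes(1)[OF ij(2), of X] by simp
    moreover have "parity_char B ((inv' t \<circ> p) ` S) = parity_char (s ` B) S"
    proof -
      have "(inv' t \<circ> p) ` s ` B = B" using True by (simp only: image_comp)
      then show ?thesis
        using parity_char_image[OF permutes_compose[OF Ap(2) ti], of "s ` B" S] by simp
    qed
    ultimately have par: "parity_char B (fst x) = parity_char (t ` B) T * parity_char (t ` B) A * parity_char (s ` B) S"
      using fin by (simp add: x parity_char_sym_diff)
    have "s \<circ> inv' t \<circ> p = s \<circ> ?q \<circ> inv' s"
      using permutes_inv_o(1)[OF ij(4)] by (simp add: comp_assoc)
    then have sgn: "sign_within (s ` B) (s \<circ> inv' t \<circ> p) = sign_within B ?q"
      using sign_within_conj[OF ij(4) q True B] by simp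
    have "translate (sym_group ?n) (inv' t) s F0 p = F0 ?q" using Ap(2) by (simp add: translate_sym)
    then show ?thesis
      using True Ap(2) qB blockB par sgn by (simp add: x transport_term_def mult.left_commute mult.assoc)
  next
    case False
    then show ?thesis using qB blockB by (simp add: x transport_term_def)
  qed
qed

lemma rep_dim_twisted:
  "rep_dim (weyl_C m) (twisted_outer_tensor \<alpha> \<beta>) =
     rep_dim (sym_group (sum_list \<alpha>)) (sigma \<alpha>) * rep_dim (sym_group (sum_list \<beta>)) (sigma \<beta>)"
proof -
  have id: "(\<lambda>i. if i \<in> {1..sum_list \<alpha>} then id i else i) = id"
    "(\<lambda>i. if i \<in> {1..sum_list \<beta>} then id (sum_list \<alpha> + i) - sum_list \<alpha> else i) = id"
    by auto
  show ?thesis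
    unfolding rep_dim_def weyl_C_simps(2) sym_group_simps(2) twisted_outer_tensor_def split Let_def id
    by (simp add: kronecker_def)
qed

lemma sigma_bip_carrier:
  "rep_dim (weyl_C n) (sigma_bip (\<alpha>, \<beta>)) =
     length (left_transversal (weyl_C (sum_list \<alpha> + sum_list \<beta>)) (young_subgroup_C (sum_list \<alpha>) (sum_list \<beta>))) *
     (rep_dim (sym_group (sum_list \<alpha>)) (sigma \<alpha>) * rep_dim (sym_group (sum_list \<beta>)) (sigma \<beta>))"
  "sigma_bip (\<alpha>, \<beta>) w \<in> carrier_mat (rep_dim (weyl_C n) (sigma_bip (\<alpha>, \<beta>))) (rep_dim (weyl_C n) (sigma_bip (\<alpha>, \<beta>)))"
  by (simp_all add: rep_dim_def[of "weyl_C n"] sigma_bip_def induced_rep_def Let_def rep_dim_twisted)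

lemma twisted_entry:
  assumes q: "q \<in> block_perms (sum_list \<alpha>) (sum_list \<beta>)"
    and ij: "i < rep_dim (sym_group (sum_list \<alpha>)) (sigma \<alpha>) * rep_dim (sym_group (sum_list \<beta>)) (sigma \<beta>)"
      "j < rep_dim (sym_group (sum_list \<alpha>)) (sigma \<alpha>) * rep_dim (sym_group (sum_list \<beta>)) (sigma \<beta>)"
  defines "e \<equiv> rep_dim (sym_group (sum_list \<beta>)) (sigma \<beta>)"
  shows "twisted_outer_tensor \<alpha> \<beta> (X, q) $$ (i, j) = parity_char {sum_list \<alpha> + 1..sum_list \<alpha> + sum_list \<beta>} X *
    (sigma \<alpha> (left_part (sum_list \<alpha>) q) $$ (i div e, j div e) *
     sigma \<beta> (right_part (sum_list \<alpha>) (sum_list \<beta>) q) $$ (i mod e, j mod e))"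
proof -
  let ?a = "sum_list \<alpha>" and ?b = "sum_list \<beta>"
  have A: "sigma \<alpha> (left_part ?a q) \<in> carrier_mat (rep_dim (sym_group ?a) (sigma \<alpha>)) (rep_dim (sym_group ?a) (sigma \<alpha>))"
    using sigma_is_rep[of \<alpha>] left_part_permutes[OF q] by (simp add: is_rep_def sym_group_simps)
  have B: "sigma \<beta> (right_part ?a ?b q) \<in> carrier_mat e e"
    using sigma_is_rep[of \<beta>] right_part_permutes[OF q] by (simp add: is_rep_def sym_group_simps e_def)
  have "twisted_outer_tensor \<alpha> \<beta> (X, q) = parity_char {?a + 1..?a + ?b} X \<cdot>\<^sub>m
      kronecker (sigma \<alpha> (left_part ?a q)) (sigma \<beta> (right_part ?a ?b q))"
    by (simp add: twisted_outer_tensor_def Let_def parity_char_def left_part_def right_part_def)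
  then show ?thesis
    using kronecker_entry[OF A B] kronecker_carrier[OF A B] ij by (simp add: e_def)
qed

text \<open>By \<open>lift\<close>, an entry of \<open>\<sigma>\<^sub>\<alpha> \<boxtimes> \<sigma>\<^sub>\<beta>\<close> is a function \<open>F0\<close> from \<open>V\<close> on the block subgroup, up to the sign
of the second component. Conjugation by the coset representatives then gives the normal form.\<close>

lemma coeffs_sigma_bip:
  fixes \<alpha> \<beta> :: "nat list"
  defines "a \<equiv> sum_list \<alpha>" and "b \<equiv> sum_list \<beta>"
  assumes V: "two_sided (sym_group (a + b)) V"
    and lift: "\<And>f g. f \<in> sigma_coeffs \<alpha> \<Longrightarrow> (\<lambda>q. of_int (sign q) * g q) \<in> sigma_coeffs \<beta> \<Longrightarrow>
       block_prod a b f g \<in> restrict_to (block_perms a b) ` V"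
    and ij: "i < rep_dim (weyl_C (a + b)) (sigma_bip (\<alpha>, \<beta>))" "j < rep_dim (weyl_C (a + b)) (sigma_bip (\<alpha>, \<beta>))"
  shows "\<exists>c. \<exists>\<Phi>\<in>transport_terms (a + b) V. \<forall>w\<in>carrier (weyl_C (a + b)). sigma_bip (\<alpha>, \<beta>) w $$ (i, j) = c * \<Phi> w"
proof -
  interpret W: fin_group "weyl_C (a + b)" by (rule weyl_C_fin)
  let ?ts = "left_transversal (weyl_C (a + b)) (young_subgroup_C a b)"
  define d where "d = rep_dim (sym_group a) (sigma \<alpha>) * rep_dim (sym_group b) (sigma \<beta>)"
  define e where "e = rep_dim (sym_group b) (sigma \<beta>)"
  have dim: "rep_dim (weyl_C (a + b)) (sigma_bip (\<alpha>, \<beta>)) = length ?ts * d"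
    using sigma_bip_carrier(1)[of "a + b" \<alpha> \<beta>] by (simp add: d_def a_def b_def)
  have dim_tw: "rep_dim (weyl_C (a + b)) (twisted_outer_tensor \<alpha> \<beta>) = d"
    by (simp add: rep_dim_twisted d_def a_def b_def)
  have ij': "i < length ?ts * d" "j < length ?ts * d" using ij by (simp_all add: dim)
  then have "0 < d" by (cases d) auto
  have idx: "i div d < length ?ts" "j div d < length ?ts" "i mod d < d" "j mod d < d"
    using ij' \<open>0 < d\<close> by (auto simp: less_mult_imp_div_less)
  have ts: "set ?ts \<subseteq> carrier (weyl_C (a + b))"
    by (rule W.left_transversal_subset[OF young_subgroup_C_subgroup])
  obtain T t where Tt: "?ts ! (i div d) = (T, t)" by (cases "?ts ! (i div d)")
  obtain S s where Ss: "?ts ! (j div d) = (S, s)" by (cases "?ts ! (j div d)")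
  have TS: "T \<subseteq> {1..a + b}" "t permutes {1..a + b}" "S \<subseteq> {1..a + b}" "s permutes {1..a + b}"
  proof -
    have "(T, t) \<in> carrier (weyl_C (a + b))" "(S, s) \<in> carrier (weyl_C (a + b))"
      using subsetD[OF ts nth_mem[OF idx(1)]] subsetD[OF ts nth_mem[OF idx(2)]] by (simp_all add: Tt Ss)
    then show "T \<subseteq> {1..a + b}" "t permutes {1..a + b}" "S \<subseteq> {1..a + b}" "s permutes {1..a + b}"
      by (simp_all add: weyl_C_simps)
  qed
  let ?i = "i mod d" and ?j = "j mod d"
  have e0: "e > 0" using \<open>0 < d\<close> by (auto simp: d_def e_def)
  have sub: "?i div e < rep_dim (sym_group a) (sigma \<alpha>)" "?j div e < rep_dim (sym_group a) (sigma \<alpha>)" "?i mod e < e" "?j mod e < e"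
    using idx e0 by (auto simp: d_def e_def less_mult_imp_div_less)
  define f where "f = (\<lambda>p. if p \<in> carrier (sym_group a) then sigma \<alpha> p $$ (?i div e, ?j div e) else 0)"
  define g' where "g' = (\<lambda>p. if p \<in> carrier (sym_group b) then sigma \<beta> p $$ (?i mod e, ?j mod e) else 0)"
  define g where "g = (\<lambda>q. of_int (sign q) * g' q)"
  have f: "f \<in> sigma_coeffs \<alpha>" unfolding f_def sigma_coeffs_def
    using sub(1,2) unfolding a_def by (intro coeffs_entry)
  have g': "g' \<in> sigma_coeffs \<beta>" unfolding g'_def sigma_coeffs_def
    using sub(3,4) unfolding b_def e_def by (intro coeffs_entry)
  have "(\<lambda>q. of_int (sign q) * g q) = g'"
    using sign_sq by (auto simp: g_def fun_eq_iff mult.assoc[symmetric])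
  then obtain F0 where F0: "F0 \<in> V" "block_prod a b f g = restrict_to (block_perms a b) F0"
    using lift[OF f, of g] g' by auto
  define B where "B = {a + 1..a + b}"
  define c where "c = parity_char (t ` B) T * parity_char (s ` B) S"
  define \<Phi> where "\<Phi> = transport_term (a + b) (s ` B) (t ` B) (s \<circ> inv' t) (translate (sym_group (a + b)) (inv' t) s F0)"
  have "\<Phi> \<in> transport_terms (a + b) V"
    unfolding transport_terms_def \<Phi>_def
  proof (intro CollectI exI conjI refl)
    have B: "B \<subseteq> {1..a + b}" by (auto simp: B_def)
    show "s ` B \<subseteq> {1..a + b}" "t ` B \<subseteq> {1..a + b}" using B image_permutes_subset TS by blast+
    show "s \<circ> inv' t permutes {1..a + b}" using TS by (intro permutes_compose permutes_inv)
    show "(s \<circ> inv' t) ` t ` B = s ` B"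
    proof -
      have "(s \<circ> inv' t) ` t ` B = s ` inv' t ` t ` B" by (simp only: image_comp comp_assoc)
      then show ?thesis by (simp only: image_inv_permutes[OF TS(2)])
    qed
    show "translate (sym_group (a + b)) (inv' t) s F0 \<in> V"
      using fin_group.two_sided_translate[OF sym_group_fin V F0(1)] TS by (simp add: sym_group_simps permutes_inv)
  qed (rule refl)
  moreover have "sigma_bip (\<alpha>, \<beta>) w $$ (i, j) = c * \<Phi> w" if w: "w \<in> carrier (weyl_C (a + b))" for w
  proof -
    obtain A p where Ap: "w = (A, p)" by (cases w)
    have A: "A \<subseteq> {1..a + b}" "p permutes {1..a + b}" using w by (simp_all add: Ap weyl_C_simps)
    define x where "x = inv\<^bsub>weyl_C (a + b)\<^esub> (T, t) \<otimes>\<^bsub>weyl_C (a + b)\<^esub> (A, p) \<otimes>\<^bsub>weyl_C (a + b)\<^esub> (S, s)"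
    obtain X q where Xq: "x = (X, q)" by (cases x)
    have "x \<in> carrier (weyl_C (a + b))"
      unfolding x_def using TS A by (intro W.m_closed W.inv_closed) (simp_all add: weyl_C_simps)
    then have X: "X \<subseteq> {1..a + b}" by (simp add: Xq weyl_C_simps)
    have "sigma_bip (\<alpha>, \<beta>) w $$ (i, j) = (if x \<in> young_subgroup_C a b then twisted_outer_tensor \<alpha> \<beta> x $$ (?i, ?j) else 0)"
      using ij'
      by (simp add: sigma_bip_def induced_rep_def Let_def a_def[symmetric] b_def[symmetric] dim_tw Tt Ss Ap x_def)
    also have "\<dots> = (if q \<in> block_perms a b then parity_char B X * of_int (sign_within B q) * F0 q else 0)"
    proof (cases "q \<in> block_perms a b")
      case True
      have q: "left_part a q \<in> carrier (sym_group a)" "right_part a b q \<in> carrier (sym_group b)"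
        using left_part_permutes[OF True] right_part_permutes[OF True] by (simp_all add: sym_group_simps)
      have g_val: "of_int (sign r) * g r = g' r" for r
        by (simp add: g_def mult.assoc[symmetric] sign_sq)
      have "F0 q = block_prod a b f g q" using True by (simp add: F0(2) restrict_to_def)
      also have "\<dots> = f (left_part a q) * g (right_part a b q)" using True by (simp add: block_prod_def)
      finally have "of_int (sign_within B q) * F0 q = f (left_part a q) * g' (right_part a b q)"
        unfolding B_def sign_within_right[OF True] by (simp only: mult.left_commute[of _ "f _"] g_val)
      moreover have "twisted_outer_tensor \<alpha> \<beta> (X, q) $$ (?i, ?j) =
          parity_char B X * (f (left_part a q) * g' (right_part a b q))"
        using twisted_entry[of q \<alpha> \<beta> ?i ?j X] True idx(3,4) q
        by (simp add: a_def[symmetric] b_def[symmetric] d_def e_def[symmetric] f_def g'_def B_def)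
      ultimately show ?thesis using True X by (simp add: Xq young_subgroup_C_iff mult.assoc)
    next
      case False
      then show ?thesis by (simp add: Xq young_subgroup_C_iff)
    qed
    also have "\<dots> = c * \<Phi> w"
      using induced_entry[OF TS V F0(1) A] unfolding x_def[symmetric] Xq fst_conv snd_conv B_def[symmetric] c_def[symmetric] \<Phi>_def[symmetric] Ap .
    finally show ?thesis .
  qed
  ultimately show ?thesis by blast
qed

lemma comp_image_eq: "p ` A = B \<Longrightarrow> q ` B = C \<Longrightarrow> (q \<circ> p) ` A = C"
  by (simp only: image_comp[symmetric])

section \<open>Averaging over sign changes\<close>

text \<open>Up to a factor, the projection to the functions invariant under the sign changes in \<open>\<A>\<close>.\<close>

definition sign_average :: "(nat set) set \<Rightarrow> nat \<Rightarrow> (nat set \<times> (nat \<Rightarrow> nat) \<Rightarrow> complex) \<Rightarrow> (nat \<Rightarrow> nat) \<Rightarrow> complex" where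
  "sign_average \<A> n \<Theta> = (\<lambda>p. if p permutes {1..n} then \<Sum>A\<in>\<A>. \<Theta> (A, p) else 0)"

lemma sign_average_linear:
  "sign_average \<A> n (f + g) = sign_average \<A> n f + sign_average \<A> n g"
  "sign_average \<A> n (\<lambda>w. c * f w) = (\<lambda>p. c * sign_average \<A> n f p)"
  by (auto simp: sign_average_def fun_eq_iff sum.distrib sum_distrib_left)

text \<open>Changing the signs in \<open>Z\<close> as well is an involution on \<open>\<A>\<close> that negates each summand.\<close>

lemma parity_sum_zero:
  assumes fin: "finite \<A>" "\<And>A. A \<in> \<A> \<Longrightarrow> finite A" and Z: "finite Z"
    and inv: "\<And>A. A \<in> \<A> \<Longrightarrow> sym_diff A Z \<in> \<A>"
    and odd: "parity_char B Z * parity_char D Z = -1"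
  shows "(\<Sum>A\<in>\<A>. parity_char B A * parity_char D A) = 0"
proof -
  have "(\<Sum>A\<in>\<A>. parity_char B A * parity_char D A) = (\<Sum>A\<in>\<A>. - (parity_char B A * parity_char D A))"
  proof (rule sum.reindex_bij_witness[where i = "\<lambda>A. sym_diff A Z" and j = "\<lambda>A. sym_diff A Z"])
    fix A assume A: "A \<in> \<A>"
    have "parity_char B (sym_diff A Z) * parity_char D (sym_diff A Z) =
        (parity_char B A * parity_char D A) * (parity_char B Z * parity_char D Z)"
      using fin(2)[OF A] Z by (simp add: parity_char_sym_diff mult.assoc mult.left_commute)
    then show "- (parity_char B (sym_diff A Z) * parity_char D (sym_diff A Z)) = parity_char B A * parity_char D A"
      by (simp add: odd)
    show "sym_diff (sym_diff A Z) Z = A" "sym_diff (sym_diff A Z) Z = A" by auto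
    show "sym_diff A Z \<in> \<A>" "sym_diff A Z \<in> \<A>" using inv[OF A] by auto
  qed
  then show ?thesis by (simp add: sum_negf)
qed

text \<open>The average contains the factor \<open>\<Sum>\<^sub>A \<chi>\<^sub>B(A) \<chi>\<^sub>D(A)\<close> with \<open>B = B1\<close> and \<open>D = D1\<close>. If it is not zero, either
\<open>D = B\<close>, and then the product of the two signs is constant on the permutations that take \<open>B0\<close> to
\<open>B1\<close>; or \<open>D\<close> is the complement of \<open>B\<close>, and then the product is \<open>sign p\<close> up to a constant.\<close>

lemma sign_average_transport_terms:
  assumes V: "two_sided (sym_group n) V"
    and kappa: "\<And>B D. B \<subseteq> {1..n} \<Longrightarrow> D \<subseteq> {1..n} \<Longrightarrow> (\<Sum>A\<in>\<A>. parity_char B A * parity_char D A) \<noteq> 0 \<Longrightarrow>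
       D = B \<or> D = {1..n} - B \<and> (\<forall>f\<in>V. (\<lambda>g. of_int (sign g) * f g) \<in> V)"
    and \<Phi>: "\<Phi> \<in> transport_terms n V" and \<Psi>: "\<Psi> \<in> transport_terms n V"
  shows "sign_average \<A> n (\<Phi> * \<Psi>) \<in> product_span (product_span V V) (two_row_space n)"
proof -
  obtain B0 B1 u F where Phi: "\<Phi> = transport_term n B0 B1 u F" and B: "B0 \<subseteq> {1..n}" "B1 \<subseteq> {1..n}"
    and u: "u permutes {1..n}" "u ` B1 = B0" and F: "F \<in> V"
    using \<Phi> by (auto simp: transport_terms_def)
  obtain D0 D1 w E where Psi: "\<Psi> = transport_term n D0 D1 w E" and D: "D0 \<subseteq> {1..n}" "D1 \<subseteq> {1..n}"
    and w: "w permutes {1..n}" "w ` D1 = D0" and E: "E \<in> V"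
    using \<Psi> by (auto simp: transport_terms_def)
  let ?P = "product_span (product_span V V) (two_row_space n)"
  have P: "cfun.subspace ?P" by (rule product_span_subspace)
  define \<kappa> where "\<kappa> = (\<Sum>A\<in>\<A>. parity_char B1 A * parity_char D1 A)"
  have avg: "sign_average \<A> n (\<Phi> * \<Psi>) p = (if p permutes {1..n} \<and> p ` B0 = B1 \<and> p ` D0 = D1
      then \<kappa> * of_int (sign_within B0 (u \<circ> p) * sign_within D0 (w \<circ> p)) * (F p * E p) else 0)" for p
  proof (cases "p permutes {1..n} \<and> p ` B0 = B1 \<and> p ` D0 = D1")
    case True
    have "(\<Phi> * \<Psi>) (A, p) = parity_char B1 A * parity_char D1 A *
        (of_int (sign_within B0 (u \<circ> p) * sign_within D0 (w \<circ> p)) * (F p * E p))" for A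
      using True by (simp add: Phi Psi transport_term_def)
    then show ?thesis
      using True by (simp only: sign_average_def \<kappa>_def sum_distrib_right) (simp add: mult.assoc)
  next
    case False
    then have "(\<Phi> * \<Psi>) (A, p) = 0" for A by (auto simp: Phi Psi transport_term_def)
    then have "(\<Sum>A\<in>\<A>. (\<Phi> * \<Psi>) (A, p)) = 0" by (intro sum.neutral) blast
    then show ?thesis using False by (simp only: sign_average_def if_False if_cancel)
  qed
  have ind: "(\<lambda>p. if p permutes {1..n} \<and> p ` B0 = B1 then 1 else 0) \<in> two_row_space n"
  proof (rule set_transport_indicator[OF B])
    show "card B0 = card B1"
      using card_image[OF inj_on_subset[OF permutes_inj[OF u(1)] subset_UNIV], of B1] u(2) by simp
  qed
  define sg where "sg = sign_within B0 (u \<circ> inv' w)"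
  have up: "u \<circ> p permutes {1..n}" "(u \<circ> p) ` B0 = B0" if "p permutes {1..n}" "p ` B0 = B1" for p
    using permutes_compose[OF that(1) u(1)] comp_image_eq[OF that(2) u(2)] .
  show ?thesis
  proof (cases "\<kappa> \<noteq> 0 \<and> (\<exists>p. p permutes {1..n} \<and> p ` B0 = B1 \<and> p ` D0 = D1)")
    case False
    then have "sign_average \<A> n (\<Phi> * \<Psi>) = 0" by (auto simp: avg fun_eq_iff)
    then show ?thesis using cfun.subspace_0[OF P] by simp
  next
    case True
    then obtain p0 where p0: "p0 permutes {1..n}" "p0 ` B0 = B1" "p0 ` D0 = D1" by blast
    have uw: "u \<circ> inv' w permutes {1..n}" using u w by (intro permutes_compose permutes_inv)
    have up_split: "u \<circ> p = (u \<circ> inv' w) \<circ> (w \<circ> p)" for p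
      using permutes_inv_o(2)[OF w(1)] by (metis comp_assoc comp_id)
    consider "D1 = B1" | "D1 = {1..n} - B1" "\<forall>f\<in>V. (\<lambda>g. of_int (sign g) * f g) \<in> V"
      using kappa[OF B(2) D(2)] True by (auto simp: \<kappa>_def)
    then show ?thesis
    proof cases
      case 1
      then have D0: "D0 = B0" using p0 inj_image_eq_iff[OF permutes_inj[OF p0(1)]] by metis
      have wp: "w \<circ> p permutes {1..n}" "(w \<circ> p) ` B0 = B0" if "p permutes {1..n}" "p ` B0 = B1" for p
        using permutes_compose[OF that(1) w(1)] comp_image_eq[OF that(2), of w B0] w(2) 1 D0 by simp_all
      have "inv' w ` B0 = B1" using w(2) image_inv_permutes(2)[OF w(1), of D1] 1 D0 by simp
      then have uwB: "(u \<circ> inv' w) ` B0 = B0" using comp_image_eq u(2) by blast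
      have sgn: "sign_within B0 (u \<circ> p) * sign_within D0 (w \<circ> p) = sg" if "p permutes {1..n}" "p ` B0 = B1" for p
      proof -
        have "sign_within B0 (u \<circ> p) = sg * sign_within B0 (w \<circ> p)"
          unfolding sg_def using sign_within_comp[OF uw uwB wp[OF that] B(1)] up_split[of p] by simp
        moreover have "sign_within B0 (w \<circ> p) * sign_within B0 (w \<circ> p) = 1" by (simp add: sign_within_def)
        ultimately show ?thesis by (simp add: D0 mult.assoc)
      qed
      have "sign_average \<A> n (\<Phi> * \<Psi>) = (\<lambda>p. (\<kappa> * of_int sg) * ((F * E) * (\<lambda>p. if p permutes {1..n} \<and> p ` B0 = B1 then 1 else 0)) p)"
        using sgn by (auto simp: avg fun_eq_iff 1 D0)
      also have "\<dots> \<in> ?P" using F E ind by (intro cfun.subspace_scale[OF P] product_span_in)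
      finally show ?thesis .
    next
      case 2
      have D0: "D0 = {1..n} - B0"
      proof -
        have "p0 ` ({1..n} - B0) = {1..n} - B1"
          using permutes_image[OF p0(1)] permutes_inj[OF p0(1)] p0(2) by (simp add: image_set_diff)
        then show ?thesis using p0(3) 2(1) inj_image_eq_iff[OF permutes_inj[OF p0(1)]] by metis
      qed
      have wB: "w ` B1 = B0"
      proof -
        have "w ` ({1..n} - D1) = {1..n} - D0"
          using permutes_image[OF w(1)] permutes_inj[OF w(1)] w(2) by (simp add: image_set_diff)
        moreover have "{1..n} - D1 = B1" "{1..n} - D0 = B0" using 2(1) D0 B by auto
        ultimately show ?thesis by simp
      qed
      have wp: "w \<circ> p permutes {1..n}" "(w \<circ> p) ` B0 = B0" if "p permutes {1..n}" "p ` B0 = B1" for p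
        using permutes_compose[OF that(1) w(1)] comp_image_eq[OF that(2) wB] .
      have "inv' w ` B0 = B1" using wB image_inv_permutes(2)[OF w(1), of B1] by simp
      then have uwB: "(u \<circ> inv' w) ` B0 = B0" using comp_image_eq u(2) by blast
      have sgn: "sign_within B0 (u \<circ> p) * sign_within D0 (w \<circ> p) = sg * sign w * sign p" if "p permutes {1..n}" "p ` B0 = B1" for p
      proof -
        have "sign_within B0 (u \<circ> p) = sg * sign_within B0 (w \<circ> p)"
          unfolding sg_def using sign_within_comp[OF uw uwB wp[OF that] B(1)] up_split[of p] by simp
        moreover have "sign_within D0 (w \<circ> p) = sign w * sign p * sign_within B0 (w \<circ> p)"
          unfolding D0 sign_within_compl[OF wp[OF that] B(1)] perm_sign_comp[OF w(1) that(1)] by simp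
        moreover have "sign_within B0 (w \<circ> p) * sign_within B0 (w \<circ> p) = 1" by (simp add: sign_within_def)
        ultimately show ?thesis by (simp add: mult.assoc mult.left_commute)
      qed
      have same: "p ` D0 = D1" if "p permutes {1..n}" "p ` B0 = B1" for p
        unfolding D0 2(1) using permutes_image[OF that(1)] permutes_inj[OF that(1)] that(2) by (simp add: image_set_diff)
      have "sign_average \<A> n (\<Phi> * \<Psi>) = (\<lambda>p. (\<kappa> * of_int (sg * sign w)) *
          (((\<lambda>g. of_int (sign g) * F g) * E) * (\<lambda>p. if p permutes {1..n} \<and> p ` B0 = B1 then 1 else 0)) p)"
        using sgn same by (auto simp: avg fun_eq_iff)
      also have "\<dots> \<in> ?P" using 2(2) F E ind by (intro cfun.subspace_scale[OF P] product_span_in) auto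
      finally show ?thesis .
    qed
  qed
qed

section \<open>The families of types C and D\<close>

lemma down_closed_eq_lessThan:
  assumes "finite J" "\<And>i j :: nat. j \<in> J \<Longrightarrow> i < j \<Longrightarrow> i \<in> J"
  shows "J = {..<card J}"
proof (cases "J = {}")
  case False
  have "J = {..Max J}"
  proof
    show "{..Max J} \<subseteq> J" using assms(2)[of "Max J"] Max_in[OF assms(1) False] le_neq_implies_less by blast
  qed (use assms(1) in auto)
  then have "J = {..<Suc (Max J)}" by (simp add: lessThan_Suc_atMost)
  then show ?thesis by (metis card_lessThan)
qed simp

text \<open>The common form of the two families: \<open>m = k + 1\<close>, \<open>l = k\<close> in type C and \<open>m = l = k\<close> in type D.\<close>

definition symbol_pair :: "nat \<Rightarrow> nat \<Rightarrow> nat list \<Rightarrow> nat list \<Rightarrow> bool" where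
  "symbol_pair m l as bs \<longleftrightarrow> length as = m \<and> length bs = l \<and> sorted as \<and> sorted bs \<and>
     {as ! i + i |i. i < m} \<union> {bs ! j + j |j. j < l} = {0..<m + l}"

lemma sorted_shift_less_iff:
  assumes "sorted as" "i < length as" "i' < length as"
  shows "as ! i + i < as ! i' + i' \<longleftrightarrow> i < i'"
  using sorted_nth_mono[OF assms(1), of i i'] sorted_nth_mono[OF assms(1), of i' i] assms(2,3)
  by (cases "i < i'") (auto simp: not_less intro: add_le_less_mono)

lemma sorted_shift_inj:
  assumes "sorted as"
  shows "inj_on (\<lambda>i. as ! i + i) {..<length as}"
proof (rule inj_onI)
  fix x y assume xy: "x \<in> {..<length as}" "y \<in> {..<length as}" "as ! x + x = as ! y + y"
  then have "\<not> x < y" "\<not> y < x"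
    using sorted_shift_less_iff[OF assms, of x y] sorted_shift_less_iff[OF assms, of y x] by simp_all
  then show "x = y" by simp
qed

lemma symbol_pair_disjoint:
  assumes S: "symbol_pair m l as bs" and ij: "i < m" "j < l"
  shows "as ! i + i \<noteq> bs ! j + j"
proof -
  let ?A = "(\<lambda>i. as ! i + i) ` {..<m}" and ?B = "(\<lambda>j. bs ! j + j) ` {..<l}"
  have inj: "inj_on (\<lambda>i. as ! i + i) {..<m}" "inj_on (\<lambda>j. bs ! j + j) {..<l}"
    using S sorted_shift_inj[of as] sorted_shift_inj[of bs] by (simp_all add: symbol_pair_def)
  have "?A = {as ! i + i |i. i < m}" "?B = {bs ! j + j |j. j < l}" by auto
  then have "?A \<union> ?B = {0..<m + l}" using S by (simp add: symbol_pair_def)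
  then have "card (?A \<union> ?B) = m + l" by simp
  moreover have "card ?A = m" "card ?B = l" using inj by (simp_all add: card_image)
  ultimately have "card (?A \<inter> ?B) = 0" using card_Un_Int[of ?A ?B] by simp
  then have "?A \<inter> ?B = {}" by simp
  then show ?thesis using ij by blast
qed

text \<open>There are \<open>as ! i + i\<close> numbers below \<open>as ! i + i\<close>. Exactly \<open>i\<close> of them come from \<open>as\<close>, hence \<open>as ! i\<close>
from \<open>bs\<close>, and those are the first ones.\<close>

lemma symbol_pair_count:
  assumes S: "symbol_pair m l as bs" and i: "i < m"
  shows "{j. j < l \<and> bs ! j + j < as ! i + i} = {..<as ! i}"
proof -
  let ?c = "as ! i + i"
  let ?J = "{j. j < l \<and> bs ! j + j < ?c}"
  have sorted: "sorted as" "sorted bs" "length as = m" "length bs = l"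
    and cover: "{as ! i + i |i. i < m} \<union> {bs ! j + j |j. j < l} = {0..<m + l}"
    using S by (auto simp: symbol_pair_def)
  have "?c \<in> {0..<m + l}" unfolding cover[symmetric] using i by blast
  then have "{..<?c} = {x \<in> {0..<m + l}. x < ?c}" by auto
  also have "\<dots> = (\<lambda>i. as ! i + i) ` {..<i} \<union> (\<lambda>j. bs ! j + j) ` ?J"
    unfolding cover[symmetric] using i sorted sorted_shift_less_iff[of as _ i] by auto
  finally have eq: "{..<?c} = (\<lambda>i. as ! i + i) ` {..<i} \<union> (\<lambda>j. bs ! j + j) ` ?J" .
  have "card {..<?c} = card ((\<lambda>i. as ! i + i) ` {..<i}) + card ((\<lambda>j. bs ! j + j) ` ?J)"
    unfolding eq
  proof (rule card_Un_disjoint)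
    show "(\<lambda>i. as ! i + i) ` {..<i} \<inter> (\<lambda>j. bs ! j + j) ` ?J = {}"
    proof (rule equals0I)
      fix x assume "x \<in> (\<lambda>i. as ! i + i) ` {..<i} \<inter> (\<lambda>j. bs ! j + j) ` ?J"
      then obtain i' j where "i' < i" "j < l" "as ! i' + i' = bs ! j + j" by auto
      then show False using symbol_pair_disjoint[OF S, of i' j] i by simp
    qed
  qed auto
  also have "card ((\<lambda>i. as ! i + i) ` {..<i}) = i"
    using inj_on_subset[OF sorted_shift_inj[OF sorted(1)], of "{..<i}"] i sorted by (simp add: card_image)
  also have "card ((\<lambda>j. bs ! j + j) ` ?J) = card ?J"
    using sorted by (intro card_image inj_on_subset[OF sorted_shift_inj[OF sorted(2)]]) auto
  finally have "card ?J = as ! i" by simp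
  moreover have "?J = {..<card ?J}"
  proof (rule down_closed_eq_lessThan)
    fix i' j assume "j \<in> ?J" "i' < j"
    then show "i' \<in> ?J" using sorted sorted_shift_less_iff[of bs i' j] by auto
  qed simp
  ultimately show ?thesis by simp
qed

lemma symbol_pair_sym: "symbol_pair m l as bs \<Longrightarrow> symbol_pair l m bs as"
  by (simp add: symbol_pair_def Un_commute add.commute)

text \<open>The two partitions are the complementary parts of an \<open>m \<times> l\<close> rectangle, one of them transposed.\<close>

lemma symbol_pair_conjugate:
  assumes S: "symbol_pair m l as bs"
  shows "i < m \<Longrightarrow> as ! i \<le> l" "j < l \<Longrightarrow> bs ! j \<le> m"
    "i < m \<Longrightarrow> j < l \<Longrightarrow> i < bs ! j \<longleftrightarrow> as ! i \<le> j"
proof -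
  note A = symbol_pair_count[OF S] and B = symbol_pair_count[OF symbol_pair_sym[OF S]]
  show "as ! i \<le> l" if "i < m"
  proof -
    have "{..<as ! i} \<subseteq> {..<l}" unfolding A[OF that, symmetric] by blast
    then show ?thesis by simp
  qed
  show "bs ! j \<le> m" if "j < l"
  proof -
    have "{..<bs ! j} \<subseteq> {..<m}" unfolding B[OF that, symmetric] by blast
    then show ?thesis by simp
  qed
  assume ij: "i < m" "j < l"
  have "j < as ! i \<longleftrightarrow> bs ! j + j < as ! i + i" using A[OF ij(1)] ij(2) by blast
  moreover have "i < bs ! j \<longleftrightarrow> as ! i + i < bs ! j + j" using B[OF ij(2)] ij(1) by blast
  ultimately show "i < bs ! j \<longleftrightarrow> as ! i \<le> j" using symbol_pair_disjoint[OF S ij] by linarith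
qed

text \<open>Since \<open>bs\<close> gives the transpose of the complement of \<open>as\<close>, multiplying a coefficient of its
representation by the sign yields a coefficient for the complement itself.\<close>

theorem symbol_pair_restriction:
  assumes S: "symbol_pair m l as bs"
  shows "sum_list as + sum_list bs = m * l"
    "f \<in> sigma_coeffs (partition_of as) \<Longrightarrow> (\<lambda>q. of_int (sign q) * g q) \<in> sigma_coeffs (partition_of bs) \<Longrightarrow>
      block_prod (sum_list as) (sum_list bs) f g \<in>
        restrict_to (block_perms (sum_list as) (sum_list bs)) ` sigma_coeffs (replicate m l)"
proof -
  have len: "length as = m" "length bs = l" and sorted: "sorted as" "sorted bs"
    using S by (auto simp: symbol_pair_def)
  note conj = symbol_pair_conjugate[OF S]
  have co: "co_diagram l as = {(i, j). i < m \<and> m - 1 - i < bs ! j \<and> j < l}"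
  proof -
    have "as ! (m - 1 - i) \<le> j \<longleftrightarrow> m - 1 - i < bs ! j" if "i < m" "j < l" for i j
      using conj(3)[of "m - 1 - i" j] that by simp
    then show ?thesis by (auto simp: co_diagram_def rev_nth len One_nat_def)
  qed
  have fin: "finite (co_diagram l as)"
    by (rule finite_subset[of _ "{..<m} \<times> {..<l}"]) (auto simp: co)
  define b where "b = card (co_diagram l as)"
  obtain h where h: "bij_betw h {1..b} (co_diagram l as)"
    using ex_bij_betw_nat_finite_1[OF fin] unfolding b_def by blast
  define r s where "r i = fst (h i)" and "s i = snd (h i)" for i
  have bij: "bij_betw (\<lambda>i. (r i, s i)) {1..b} (co_diagram l as)" using h by (simp add: r_def s_def)
  let ?X = "prod.swap ` co_diagram l as"
  have "bij_betw prod.swap (co_diagram l as) ?X" by (auto simp: bij_betw_def inj_on_def)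
  from bij_betw_trans[OF bij this]
  have bij': "bij_betw (\<lambda>i. (s i, r i)) {1..b} ?X" by (simp add: comp_def)
  have inj: "inj_on (\<lambda>j. l - 1 - j) (fst ` ?X)" "inj_on (\<lambda>i. m - 1 - i) (snd ` ?X)"
    by (rule inj_on_reflect, force simp: co)+
  have img: "(\<lambda>(j, i). (l - 1 - j, m - 1 - i)) ` ?X = diagram (partition_of bs)"
  proof -
    have D: "diagram (partition_of bs) = {(j, i). j < l \<and> i < bs ! (l - 1 - j)}"
      using diagram_partition_of[OF sorted(2)] by (auto simp: rev_nth len One_nat_def)
    show ?thesis
      unfolding D
    proof (intro equalityI subsetI)
      fix x assume "x \<in> (\<lambda>(j, i). (l - 1 - j, m - 1 - i)) ` ?X"
      then show "x \<in> {(j, i). j < l \<and> i < bs ! (l - 1 - j)}" by (auto simp: co)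
    next
      fix x :: "nat \<times> nat" assume "x \<in> {(j, i). j < l \<and> i < bs ! (l - 1 - j)}"
      then obtain j i where x: "x = (j, i)" "j < l" "i < bs ! (l - 1 - j)" by auto
      have "bs ! (l - 1 - j) \<le> m" using x by (intro conj(2)) auto
      then have "i < m" using x by simp
      then have cell: "(m - 1 - i, l - 1 - j) \<in> co_diagram l as" and invol: "l - 1 - (l - 1 - j) = j" "m - 1 - (m - 1 - i) = i"
        using x by (auto simp: co)
      from imageI[OF cell, of prod.swap] have "(l - 1 - j, m - 1 - i) \<in> ?X" by simp
      then show "x \<in> (\<lambda>(j, i). (l - 1 - j, m - 1 - i)) ` ?X"
        by (rule rev_image_eqI) (simp add: x(1) invol del: diff_diff_left)
    qed
  qed
  have sum_b: "sum_list bs = b"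
    using coeffs_sigma(1)[OF bij' inj img] by (simp add: sum_list_partition_of)
  have beta: "sigma_coeffs (partition_of bs) = tableau_space b s r"
    using coeffs_sigma(2)[OF bij' inj img] by (simp add: sigma_coeffs_def sum_list_partition_of sum_b)
  have le: "\<forall>x\<in>set as. x \<le> l" using conj(1) by (auto simp: in_set_conv_nth len)
  have zero: "0 \<in> sigma_coeffs lam" "0 \<in> tableau_space b r s" for lam
    using cfun.subspace_0[OF coeffs_subspace] tableau_space_two_sided[of b r s]
    by (auto simp: sigma_coeffs_def two_sided_def cfun.subspace_0)
  show "sum_list as + sum_list bs = m * l"
    using rectangle_restriction(1)[OF sorted(1) le bij zero] by (simp add: sum_b len)
  assume f: "f \<in> sigma_coeffs (partition_of as)" and g: "(\<lambda>q. of_int (sign q) * g q) \<in> sigma_coeffs (partition_of bs)"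
  have "(\<lambda>q. of_int (sign q) * (of_int (sign q) * g q)) \<in> tableau_space b r s"
    using sign_times_tableau_space[OF g[unfolded beta]] .
  moreover have "(\<lambda>q. of_int (sign q) * (of_int (sign q) * g q)) = g"
    using sign_sq by (auto simp: fun_eq_iff mult.assoc[symmetric])
  ultimately have "g \<in> tableau_space b r s" by simp
  from rectangle_restriction(2)[OF sorted(1) le bij f this]
  show "block_prod (sum_list as) (sum_list bs) f g \<in>
      restrict_to (block_perms (sum_list as) (sum_list bs)) ` sigma_coeffs (replicate m l)"
    by (simp add: sum_b len)
qed

text \<open>Every coefficient of the sum over the family is a combination of normal forms. As the tensor square
contains all irreducible representations, \<open>\<delta>\<close> on the Weyl group is a combination of products of two of
them. Averaging over \<open>\<A>\<close> turns it into \<open>\<delta>\<close> on \<open>S\<^sub>n\<close>. The hypothesis \<open>kappa\<close> names the pairs of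
characters that this average does not separate.\<close>

theorem rectangle_from_weyl_group:
  assumes W: "fin_group W" "carrier W = {(A, p). A \<in> \<A> \<and> p permutes {1..n}}" "\<one>\<^bsub>W\<^esub> = ({}, id)"
    and A: "\<A> \<subseteq> Pow {1..n}" "{} \<in> \<A>"
    and n: "n = m * l"
    and fam: "finite fam" "\<And>\<alpha> \<beta>. (\<alpha>, \<beta>) \<in> fam \<Longrightarrow> \<exists>as bs. symbol_pair m l as bs \<and> \<alpha> = partition_of as \<and> \<beta> = partition_of bs"
    and kappa: "\<And>B D. B \<subseteq> {1..n} \<Longrightarrow> D \<subseteq> {1..n} \<Longrightarrow> (\<Sum>A\<in>\<A>. parity_char B A * parity_char D A) \<noteq> 0 \<Longrightarrow>
       D = B \<or> D = {1..n} - B \<and> (\<forall>f\<in>sigma_coeffs (replicate m l). (\<lambda>g. of_int (sign g) * f g) \<in> sigma_coeffs (replicate m l))"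
    and all: "contains_all_irreps W (tensor_rep (direct_sum fam sigma_bip) (direct_sum fam sigma_bip))"
  shows "contains_all_irreps (sym_group n) (square_times_two_rows n (replicate m l))"
proof (rule contains_all_irreps_square_times_two_rows)
  interpret W: fin_group W by (rule W(1))
  show sum_rect: "sum_list (replicate m l) = n" by (simp add: sum_list_replicate n)
  let ?V = "sigma_coeffs (replicate m l)"
  let ?P = "product_span (product_span ?V ?V) (two_row_space n)"
  let ?F = "direct_sum fam sigma_bip"
  have V: "two_sided (sym_group n) ?V"
    unfolding sigma_coeffs_def sum_rect coeffs_sigma_std[of "replicate m l", unfolded sum_rect]
    by (rule tableau_space_two_sided)
  define xs where "xs = (SOME xs. distinct xs \<and> set xs = fam)"
  have xs: "set xs = fam"
    using someI_ex[of "\<lambda>xs. distinct xs \<and> set xs = fam"] finite_distinct_list[OF fam(1)] unfolding xs_def by blast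
  have F: "?F = direct_sum_list (map sigma_bip xs)" by (simp add: direct_sum_def xs_def)
  have dimW: "rep_dim W \<rho> = rep_dim (weyl_C n) \<rho>" for \<rho>
    by (simp add: rep_dim_def W(3) weyl_C_simps)
  have unif: "\<forall>\<rho>\<in>set (map sigma_bip xs). uniform_dim W \<rho>"
    using sigma_bip_carrier(2) by (auto simp: uniform_dim_def dimW)
  have unifF: "uniform_dim W ?F" unfolding F by (rule uniform_dim_direct_sum_list[OF unif])
  define TT where "TT = restrict_to (carrier W) ` transport_terms n ?V"
  have "coeffs W (sigma_bip x) \<subseteq> cfun.span TT" if xfam: "x \<in> fam" for x
    unfolding coeffs_def
  proof (rule cfun.span_minimal[OF _ cfun.subspace_span], safe)
    fix i j assume ij: "i < rep_dim W (sigma_bip x)" "j < rep_dim W (sigma_bip x)"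
    obtain \<alpha> \<beta> where x: "x = (\<alpha>, \<beta>)" by (cases x)
    obtain as bs where S: "symbol_pair m l as bs" and ab: "\<alpha> = partition_of as" "\<beta> = partition_of bs"
      using fam(2) xfam unfolding x by blast
    note sums = sum_list_partition_of[of as, folded ab(1)] sum_list_partition_of[of bs, folded ab(2)]
    have n': "sum_list \<alpha> + sum_list \<beta> = n" using symbol_pair_restriction(1)[OF S] by (simp add: sums n)
    have "\<exists>c. \<exists>\<Phi>\<in>transport_terms (sum_list \<alpha> + sum_list \<beta>) ?V. \<forall>w\<in>carrier (weyl_C (sum_list \<alpha> + sum_list \<beta>)).
        sigma_bip (\<alpha>, \<beta>) w $$ (i, j) = c * \<Phi> w"
    proof (rule coeffs_sigma_bip)
      show "two_sided (sym_group (sum_list \<alpha> + sum_list \<beta>)) ?V" unfolding n' by (rule V)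
      show "i < rep_dim (weyl_C (sum_list \<alpha> + sum_list \<beta>)) (sigma_bip (\<alpha>, \<beta>))"
        "j < rep_dim (weyl_C (sum_list \<alpha> + sum_list \<beta>)) (sigma_bip (\<alpha>, \<beta>))"
        unfolding n' using ij by (simp_all add: dimW x)
      fix f g assume "f \<in> sigma_coeffs \<alpha>" "(\<lambda>q. of_int (sign q) * g q) \<in> sigma_coeffs \<beta>"
      then show "block_prod (sum_list \<alpha>) (sum_list \<beta>) f g \<in> restrict_to (block_perms (sum_list \<alpha>) (sum_list \<beta>)) ` ?V"
        using symbol_pair_restriction(2)[OF S, of f g] unfolding ab sum_list_partition_of by blast
    qed
    then obtain c \<Phi> where c: "\<Phi> \<in> transport_terms n ?V" "\<forall>w\<in>carrier (weyl_C n). sigma_bip x w $$ (i, j) = c * \<Phi> w"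
      unfolding n' x by blast
    have "carrier W \<subseteq> carrier (weyl_C n)" using A(1) by (auto simp: W(2) weyl_C_simps)
    then have "(\<lambda>w. if w \<in> carrier W then sigma_bip x w $$ (i, j) else 0) = (\<lambda>w. c * restrict_to (carrier W) \<Phi> w)"
      using c(2) by (auto simp: restrict_to_def fun_eq_iff)
    also have "\<dots> \<in> cfun.span TT"
      using c(1) by (intro cfun.span_scale cfun.span_base) (simp add: TT_def)
    finally show "(\<lambda>w. if w \<in> carrier W then sigma_bip x w $$ (i, j) else 0) \<in> cfun.span TT" .
  qed
  then have "coeffs W ?F \<subseteq> cfun.span TT"
    unfolding F coeffs_direct_sum_list[OF unif]
    using xs by (intro cfun.span_minimal[OF _ cfun.subspace_span]) auto
  moreover have avg: "sign_average \<A> n (f * g) \<in> ?P" if f: "f \<in> cfun.span TT" and g: "g \<in> cfun.span TT" for f g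
  proof (rule span_bilinear[where M = "\<lambda>f g. sign_average \<A> n (f * g)", OF product_span_subspace _ _ _ _ _ f g])
    fix f g assume "f \<in> TT" "g \<in> TT"
    then obtain \<Phi> \<Psi> where PhiPsi: "\<Phi> \<in> transport_terms n ?V" "\<Psi> \<in> transport_terms n ?V"
      "f = restrict_to (carrier W) \<Phi>" "g = restrict_to (carrier W) \<Psi>" by (auto simp: TT_def)
    have "sign_average \<A> n (f * g) = sign_average \<A> n (\<Phi> * \<Psi>)"
      unfolding sign_average_def PhiPsi(3,4) restrict_to_def W(2) by (intro ext) simp
    then show "sign_average \<A> n (f * g) \<in> ?P"
      using sign_average_transport_terms[OF V kappa PhiPsi(1,2)] by simp
  qed (simp_all add: sign_average_def fun_eq_iff algebra_simps sum.distrib sum_distrib_left)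
  ultimately have gens: "sign_average \<A> n (f * g) \<in> ?P" if "f \<in> coeffs W ?F" "g \<in> coeffs W ?F" for f g
    using that by blast
  have "coeffs W (tensor_rep ?F ?F) = supported_on (carrier W)"
  proof (rule W.coeffs_if_contains_all_irreps[OF _ all])
    show "tensor_rep ?F ?F g \<in> carrier_mat (rep_dim W (tensor_rep ?F ?F)) (rep_dim W (tensor_rep ?F ?F))"
      if "g \<in> carrier W" for g
      using uniform_dim_tensor[OF unifF unifF] that by (simp add: uniform_dim_def)
  qed
  then have "supported_on (carrier W) = product_span (coeffs W ?F) (coeffs W ?F)"
    using coeffs_tensor[OF unifF unifF] by simp
  moreover define \<delta> where "\<delta> = (\<lambda>w :: nat set \<times> (nat \<Rightarrow> nat). if w = ({}, id) then 1 else 0 :: complex)"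
  have "\<delta> \<in> supported_on (carrier W)"
    using A(2) by (auto simp: \<delta>_def supported_on_def W(2) permutes_id)
  ultimately have "\<delta> \<in> cfun.span {f * g |f g. f \<in> coeffs W ?F \<and> g \<in> coeffs W ?F}"
    by (simp add: product_span_def)
  then have "sign_average \<A> n \<delta> \<in> ?P"
    by (rule span_linear_image[where L = "sign_average \<A> n", OF _ product_span_subspace _ sign_average_linear])
       (use gens in blast)
  moreover have "sign_average \<A> n \<delta> = delta_id"
  proof
    fix p
    have "finite \<A>" using A(1) finite_subset by blast
    moreover have "\<delta> (A, p) = (if A = {} then delta_id p else 0)" for A by (simp add: \<delta>_def delta_id_def)
    ultimately show "sign_average \<A> n \<delta> p = delta_id p"
      using A(2) by (auto simp: sign_average_def delta_id_def permutes_id)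
  qed
  ultimately show "delta_id \<in> ?P" by simp
qed

text \<open>Otherwise the direct sum over the family, defined by a list of its members, would be arbitrary.\<close>

lemma finite_family:
  assumes "\<And>\<alpha> \<beta>. (\<alpha>, \<beta>) \<in> fam \<Longrightarrow> \<exists>as bs. symbol_pair m l as bs \<and> \<alpha> = partition_of as \<and> \<beta> = partition_of bs"
  shows "finite fam"
proof (rule finite_subset)
  let ?L = "\<lambda>m l. {xs :: nat list. set xs \<subseteq> {..l} \<and> length xs = m}"
  show "fam \<subseteq> (\<lambda>(as, bs). (partition_of as, partition_of bs)) ` (?L m l \<times> ?L l m)"
  proof
    fix x assume "x \<in> fam"
    moreover obtain \<alpha> \<beta> where x: "x = (\<alpha>, \<beta>)" by (cases x)
    ultimately obtain as bs where S: "symbol_pair m l as bs" and ab: "\<alpha> = partition_of as" "\<beta> = partition_of bs"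
      using assms by blast
    have "length as = m" "length bs = l" using S by (auto simp: symbol_pair_def)
    then have "(as, bs) \<in> ?L m l \<times> ?L l m"
      using symbol_pair_conjugate(1,2)[OF S] by (auto simp: in_set_conv_nth)
    then show "x \<in> (\<lambda>(as, bs). (partition_of as, partition_of bs)) ` (?L m l \<times> ?L l m)"
      unfolding x ab by (rule rev_image_eqI) simp
  qed
  show "finite ((\<lambda>(as, bs). (partition_of as, partition_of bs)) ` (?L m l \<times> ?L l m))"
    by (intro finite_imageI finite_cartesian_product finite_lists_length_eq) auto
qed

lemma parity_char_singleton: "parity_char B {x} = (if x \<in> B then -1 else 1)"
  by (simp add: parity_char_def)

text \<open>The diagram of the square is invariant under transposition.\<close>

lemma sign_square_closed:
  assumes "f \<in> sigma_coeffs (replicate k k)"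
  shows "(\<lambda>g. of_int (sign g) * f g) \<in> sigma_coeffs (replicate k k)"
proof -
  let ?lam = "replicate k k"
  let ?n = "sum_list ?lam" and ?r = "fst \<circ> std_cell ?lam" and ?s = "snd \<circ> std_cell ?lam"
  have bij: "bij_betw (\<lambda>i. (?r i, ?s i)) {1..?n} (diagram ?lam)"
    using bij_betw_std_cell[of ?lam] by simp
  have "bij_betw prod.swap (diagram ?lam) (diagram ?lam)"
    by (rule bij_betw_byWitness[where f' = prod.swap]) (auto simp: diagram_def)
  from bij_betw_trans[OF bij this]
  have "bij_betw (\<lambda>i. (?s i, ?r i)) {1..?n} (diagram ?lam)" by (simp add: comp_def prod.swap_def)
  then have "tableau_space ?n ?s ?r = tableau_space ?n ?r ?s" by (rule tableau_space_same_cells[OF _ bij])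
  then show ?thesis
    using sign_times_tableau_space[of f ?n ?r ?s] assms unfolding sigma_coeffs_def coeffs_sigma_std by simp
qed

text \<open>Two different characters are separated by a single sign change, at a point of exactly one of the
two sets.\<close>

theorem rectangle_from_type_C:
  assumes "generalised_saxl_conjecture_C" "k \<ge> 1"
  shows "contains_all_irreps (sym_group (k * (k + 1))) (square_times_two_rows (k * (k + 1)) (replicate (k + 1) k))"
proof (rule rectangle_from_weyl_group[where W = "weyl_C (k * (k + 1))" and \<A> = "Pow {1..k * (k + 1)}" and fam = "family_C k"])
  let ?n = "k * (k + 1)"
  show "fin_group (weyl_C ?n)" by (rule weyl_C_fin)
  show "carrier (weyl_C ?n) = {(A, p). A \<in> Pow {1..?n} \<and> p permutes {1..?n}}" by (simp add: weyl_C_def)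
  show fam: "\<exists>as bs. symbol_pair (k + 1) k as bs \<and> \<alpha> = partition_of as \<and> \<beta> = partition_of bs"
    if mem: "(\<alpha>, \<beta>) \<in> family_C k" for \<alpha> \<beta>
  proof -
    obtain as bs where *: "\<alpha> = partition_of as" "\<beta> = partition_of bs" "length as = k + 1" "length bs = k"
      "sorted as" "sorted bs" "{as ! i + i |i. i \<le> k} \<union> {bs ! j + j |j. j < k} = {0..2 * k}"
      using mem unfolding family_C_def by blast
    have "{as ! i + i |i. i < k + 1} = {as ! i + i |i. i \<le> k}" "{0..<k + 1 + k} = {0..2 * k}"
      by (auto simp: less_Suc_eq_le)
    then have "symbol_pair (k + 1) k as bs" using * by (simp only: symbol_pair_def)
    then show ?thesis using * by blast
  qed
  then show "finite (family_C k)" by (rule finite_family)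
  show "contains_all_irreps (weyl_C ?n) (tensor_rep (direct_sum (family_C k) sigma_bip) (direct_sum (family_C k) sigma_bip))"
    using assms by (simp add: generalised_saxl_conjecture_C_def Let_def)
  fix B D assume BD: "B \<subseteq> {1..?n}" "D \<subseteq> {1..?n}"
    and ne: "(\<Sum>A\<in>Pow {1..?n}. parity_char B A * parity_char D A) \<noteq> 0"
  have "D = B"
  proof (rule ccontr)
    assume "D \<noteq> B"
    then obtain x where x: "x \<in> sym_diff B D" by blast
    have "(\<Sum>A\<in>Pow {1..?n}. parity_char B A * parity_char D A) = 0"
    proof (rule parity_sum_zero[where Z = "{x}"])
      show "parity_char B {x} * parity_char D {x} = -1" using x by (auto simp: parity_char_singleton)
      show "sym_diff A {x} \<in> Pow {1..?n}" if "A \<in> Pow {1..?n}" for A using that x BD by auto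
    qed (auto intro: finite_subset)
    then show False using ne by simp
  qed
  then show "D = B \<or> D = {1..?n} - B \<and> (\<forall>f\<in>sigma_coeffs (replicate (k + 1) k).
      (\<lambda>g. of_int (sign g) * f g) \<in> sigma_coeffs (replicate (k + 1) k))" ..
qed (auto simp: weyl_C_simps mult.commute)

text \<open>An even set of sign changes that separates two characters needs a point \<open>x\<close> in exactly one of the sets
and a point \<open>y\<close> in both or in none. Such a \<open>y\<close> is missing only if the sets are complementary.\<close>

theorem rectangle_from_type_D:
  assumes "generalised_saxl_conjecture_D" "k \<ge> 2"
  shows "contains_all_irreps (sym_group (k ^ 2)) (square_times_two_rows (k ^ 2) (replicate k k))"
proof (rule rectangle_from_weyl_group[where W = "weyl_D (k ^ 2)" and \<A> = "{A. A \<subseteq> {1..k ^ 2} \<and> even (card A)}" and fam = "family_D k"])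
  let ?n = "k ^ 2" and ?A = "{A. A \<subseteq> {1..k ^ 2} \<and> even (card A)}"
  show "fin_group (weyl_D ?n)" by (rule weyl_D_fin)
  show "carrier (weyl_D ?n) = {(A, p). A \<in> ?A \<and> p permutes {1..?n}}" by (auto simp: weyl_D_def weyl_C_def)
  show fam: "\<exists>as bs. symbol_pair k k as bs \<and> \<alpha> = partition_of as \<and> \<beta> = partition_of bs"
    if "(\<alpha>, \<beta>) \<in> family_D k" for \<alpha> \<beta>
    using that unfolding family_D_def symbol_pair_def mult_2 by blast
  then show "finite (family_D k)" by (rule finite_family)
  show "contains_all_irreps (weyl_D ?n) (tensor_rep (direct_sum (family_D k) sigma_bip) (direct_sum (family_D k) sigma_bip))"
    using assms by (simp add: generalised_saxl_conjecture_D_def Let_def)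
  fix B D assume BD: "B \<subseteq> {1..?n}" "D \<subseteq> {1..?n}"
    and ne: "(\<Sum>A\<in>?A. parity_char B A * parity_char D A) \<noteq> 0"
  have "D = B \<or> D = {1..?n} - B"
  proof (rule ccontr)
    assume neq: "\<not> (D = B \<or> D = {1..?n} - B)"
    then obtain x where x: "x \<in> sym_diff B D" by blast
    obtain y where y: "y \<in> {1..?n}" "y \<in> B \<longleftrightarrow> y \<in> D" using neq BD by blast
    have "(\<Sum>A\<in>?A. parity_char B A * parity_char D A) = 0"
    proof (rule parity_sum_zero[where Z = "sym_diff {x} {y}"])
      show "parity_char B (sym_diff {x} {y}) * parity_char D (sym_diff {x} {y}) = -1"
        using x y(2) by (auto simp: parity_char_sym_diff parity_char_singleton)
      show "sym_diff A (sym_diff {x} {y}) \<in> ?A" if A: "A \<in> ?A" for A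
      proof -
        have fin: "finite A" using A finite_subset by auto
        have "parity_char UNIV (sym_diff A (sym_diff {x} {y})) = 1"
          using fin A even_card_parity[OF fin] by (simp add: parity_char_sym_diff parity_char_singleton)
        then have "even (card (sym_diff A (sym_diff {x} {y})))" using fin by (simp add: even_card_parity)
        moreover have "sym_diff A (sym_diff {x} {y}) \<subseteq> {1..?n}" using A x y BD by auto
        ultimately show ?thesis by simp
      qed
      show "finite ?A" by (rule finite_subset[of _ "Pow {1..?n}"]) auto
      show "finite A" if "A \<in> ?A" for A using that finite_subset by auto
    qed auto
    then show False using ne by simp
  qed
  then show "D = B \<or> D = {1..?n} - B \<and> (\<forall>f\<in>sigma_coeffs (replicate k k).
      (\<lambda>g. of_int (sign g) * f g) \<in> sigma_coeffs (replicate k k))"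
    using sign_square_closed by blast
qed (auto simp: weyl_D_simps power2_eq_square)

theorem corollary6p7:
  fixes k :: nat
  assumes "k \<ge> 1"
  shows "(saxl_conjecture \<or> generalised_saxl_conjecture_C \<longrightarrow>
            contains_all_irreps (sym_group (k * (k + 1)))
              (square_times_two_rows (k * (k + 1)) (replicate (k + 1) k))) \<and>
         (saxl_conjecture \<or> generalised_saxl_conjecture_D \<longrightarrow>
            contains_all_irreps (sym_group (k ^ 2))
              (square_times_two_rows (k ^ 2) (replicate k k)))"
proof (intro conjI impI)
  assume "saxl_conjecture \<or> generalised_saxl_conjecture_C"
  then show "contains_all_irreps (sym_group (k * (k + 1))) (square_times_two_rows (k * (k + 1)) (replicate (k + 1) k))"
  proof
    assume S: "saxl_conjecture"
    have "contains_all_irreps (sym_group ((k + 1) * k)) (square_times_two_rows ((k + 1) * k) (replicate (k + 1) k))"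
      by (rule rectangle_from_staircases[OF _ delta_id_saxl[OF S] delta_id_saxl[OF S]]) simp
    then show ?thesis by (simp only: mult.commute)
  qed (rule rectangle_from_type_C[OF _ assms])
next
  assume hyp: "saxl_conjecture \<or> generalised_saxl_conjecture_D"
  show "contains_all_irreps (sym_group (k ^ 2)) (square_times_two_rows (k ^ 2) (replicate k k))"
  proof (cases "saxl_conjecture \<or> k = 1")
    case True
    have "delta_id \<in> product_span (sigma_coeffs (rev [1..<p + 1])) (sigma_coeffs (rev [1..<p + 1]))" if "p \<le> k" for p
      using True
    proof
      assume "k = 1"
      then have "p = 0 \<or> p = 1" using that by auto
      moreover have "sum_list (rev [1..<0 + 1]) \<le> (1 :: nat)" "sum_list (rev [1..<1 + 1]) \<le> (1 :: nat)"
        by code_simp+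
      ultimately show ?thesis by (intro delta_id_small) (elim disjE, simp_all only:)
    qed (rule delta_id_saxl)
    from this[of "k - 1"] this[of k]
    have "contains_all_irreps (sym_group (k * k)) (square_times_two_rows (k * k) (replicate k k))"
      using assms by (intro rectangle_from_staircases) auto
    then show ?thesis by (simp only: power2_eq_square)
  next
    case False
    then show ?thesis using hyp assms by (intro rectangle_from_type_D) auto
  qed
qed

end
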